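(* Let $\theta(q,z):=\sum_{j=0}^{\infty}q^{j(j+1)/2}z^j$ for $|q|<1$, $z\in\mathbb{C}$. Let $Z_J(q)$, $\ell_a(q)$, $n_a(q)$, $p_a(q)$ and the spectral numbers $\tilde{q}_k\in(0,1)$, $\bar{q}_k\in(-1,0)$ be as defined in the context. Then: (1) For $q\in(0,1)$, one has $Z_{[-e^{\pi},0)}(q)=o(1/(1-q))$ as $q\to 1^-$. (2) The set of zeros of the functions $\theta(\tilde{q}_k,\cdot)$ (over all $k\in\mathbb{N}^*$) is everywhere dense in $(-\infty,-e^{\pi}]$. For every $a\geq e^{\pi}$ one has $\lim_{q\to 1^-}\ell_a(q)(1-q)=\ln(a/e^{\pi})$. (3) For $q\in(-1,0)$, one has $Z_{[-e^{\pi/2},0)}(q)=o(1/(1+q))$ as $q\to -1^+$. (4) The set of zeros of the functions $\theta(\bar{q}_{2s-1},\cdot)$ (over all $s\in\mathbb{N}^*$) is everywhere dense in $(-\infty,-e^{\pi/2}]$. For every $a\geq e^{\pi/2}$ one has $\lim_{q\to -1^+}n_a(q)(1+q)=\ln(a/e^{\pi/2})/2$. (5) For $q\in(-1,0)$, one has $Z_{(0,e^{\pi/2}]}(q)=o(1/(1+q))$ as $q\to -1^+$. (6) The set of zeros of the functions $\theta(\bar{q}_{2s},\cdot)$ (over all $s\in\mathbb{N}^*$) is everywhere dense in $[e^{\pi/2},\infty)$. For every $a\geq e^{\pi/2}$ one has $\lim_{q\to -1^+}p_a(q)(1+q)=\ln(a/e^{\pi/2})/2$.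
   Context: $\mathbb{N}^*$ is the set of positive integers. A set $E\subset\mathbb{C}$ is everywhere dense in an interval $J\subset\mathbb{R}$ if $E\cap J$ is dense in $J$. Counting functions. For $q\in(-1,0)\cup(0,1)$ and a finite interval $J\subset\mathbb{R}$, $Z_J(q)$ denotes the number of zeros of $\theta(q,\cdot)$, counted with multiplicity, belonging to $J$. For $q\in(0,1)$ and $a\geq e^{\pi}$, $\ell_a(q):=Z_{[-a,-e^{\pi}]}(q)$. For $q\in(-1,0)$ and $a\geq e^{\pi/2}$, $n_a(q):=Z_{[-a,-e^{\pi/2}]}(q)$ and $p_a(q):=Z_{[e^{\pi/2},a]}(q)$. Spectral numbers. A value of $q$ is a spectral number if $\theta(q,\cdot)$ has a multiple zero. Positive spectral numbers: it is known that the spectral numbers in $(0,1)$ form a strictly increasing sequence $0<\tilde{q}_1<\tilde{q}_2<\cdots<1$ with $\lim_{k\to\infty}\tilde{q}_k=1$. Negative spectral numbers: it is known that for $q\in(-1,0)$ with $|q|$ sufficiently small all zeros of $\theta(q,\cdot)$ are real and simple; they are denoted $\cdots<\xi_4<\xi_2<0<\xi_1<\xi_3<\cdots$, with $\xi_j\sim -q^{-j}$ as $q\to 0$. These zeros are followed continuously as $q$ decreases from $0^-$ to $-1$, for as long as they are real. It is known that for each $s\in\mathbb{N}^*$ there is a unique value $\bar{q}_{2s-1}\in(-1,0)$ at which the zeros $\xi_{4s-2}$ and $\xi_{4s}$ coalesce into a double zero (for smaller $q$ they form a complex conjugate pair), and a unique value $\bar{q}_{2s}\in(-1,0)$ at which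 the zeros $\xi_{4s-1}$ and $\xi_{4s+1}$ coalesce into a double zero (for smaller $q$ they form a complex conjugate pair). The numbers $\bar{q}_k$, $k\in\mathbb{N}^*$, are the spectral numbers in $(-1,0)$. *)

theory Defs
  imports "HOL-Complex_Analysis.Complex_Analysis" "HOL-Library.Landau_Symbols"
begin

definition theta :: "complex \<Rightarrow> complex \<Rightarrow> complex" where
  "theta q z = (\<Sum>j. q ^ (j * (j + 1) div 2) * z ^ j)"

(* For 0 < |q| < 1 the function theta q is entire with theta q 0 = 1, so on a bounded
   interval the index set of the sum is finite and zorder is the multiplicity of the zero. *)
definition zero_count :: "real set \<Rightarrow> real \<Rightarrow> nat" where
  "zero_count J q =
     (\<Sum>x | x \<in> J \<and> theta (of_real q) (of_real x) = 0.
        nat (zorder (theta (of_real q)) (of_real x)))"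

definition l_count :: "real \<Rightarrow> real \<Rightarrow> nat" where
  "l_count a q = zero_count {- a..- exp pi} q"

definition n_count :: "real \<Rightarrow> real \<Rightarrow> nat" where
  "n_count a q = zero_count {- a..- exp (pi / 2)} q"

definition p_count :: "real \<Rightarrow> real \<Rightarrow> nat" where
  "p_count a q = zero_count {exp (pi / 2)..a} q"

definition spectral :: "complex \<Rightarrow> bool" where
  "spectral q \<longleftrightarrow> norm q < 1 \<and> (\<exists>z. theta q z = 0 \<and> zorder (theta q) z \<ge> 2)"

(* The numbers q~_1 < q~_2 < ... are the elements of this set listed in increasing order. *)
definition positive_spectral :: "real set" where
  "positive_spectral = {q. 0 < q \<and> q < 1 \<and> spectral (of_real q)}"

(* f is the real zero xi_j, identified near 0 by xi_j ~ - q^(-j) and followed continuously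
   as q decreases from 0 to b. Simplicity on (b,0) makes the continuation unambiguous. *)
definition zero_branch :: "nat \<Rightarrow> real \<Rightarrow> (real \<Rightarrow> real) \<Rightarrow> bool" where
  "zero_branch j b f \<longleftrightarrow>
     continuous_on {b..<0} f \<and>
     (\<forall>q\<in>{b..<0}. theta (of_real q) (of_real (f q)) = 0) \<and>
     (\<forall>q\<in>{b<..<0}. zorder (theta (of_real q)) (of_real (f q)) = 1) \<and>
     f \<sim>[at_left 0] (\<lambda>q. - (q powi (- int j)))"

definition coalesce_at :: "nat \<Rightarrow> nat \<Rightarrow> real \<Rightarrow> bool" where
  "coalesce_at i j b \<longleftrightarrow> - 1 < b \<and> b < 0 \<and>
     (\<exists>f g. zero_branch i b f \<and> zero_branch j b g \<and> f b = g b \<and>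
            zorder (theta (of_real b)) (of_real (f b)) = 2)"

(* For k = 2s-1 the coalescing zeros are xi_(4s-2) and xi_(4s);
   for k = 2s they are xi_(4s-1) and xi_(4s+1). Meaningful for k >= 1. *)
definition qbar :: "nat \<Rightarrow> real" where
  "qbar k = (THE b. if odd k then coalesce_at (2 * k) (2 * k + 2) b
                    else coalesce_at (2 * k - 1) (2 * k + 1) b)"

definition everywhere_dense_in :: "complex set \<Rightarrow> real set \<Rightarrow> bool" where
  "everywhere_dense_in E J \<longleftrightarrow>
     complex_of_real ` J \<subseteq> closure (E \<inter> complex_of_real ` J)"

end

theory Submission
  imports Defs
begin

text \<open>With \<open>q = k exp (- e)\<close> and \<open>z = s exp (w + e/2)\<close>, \<open>k, s \<in> {1, -1}\<close>, the series becomes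
  \<open>\<phi> e w = (\<Sum>j. c j * exp (j w - e j\<^sup>2 / 2))\<close> with signs \<open>c j\<close>, a solution of the backward heat equation.
  As \<open>e\<close> increases, a real zero of order \<open>m\<close> splits into \<open>m\<close> real zeros (Hermite polynomials describe
  the splitting), so the number of real zeros in a window at whose ends \<open>\<phi>\<close> does not vanish is
  nondecreasing in \<open>e\<close>. For large \<open>e\<close>, neighbouring pairs of terms dominate, the zeros are explicit, and
  each window contains two of them; hence there are at most two for every \<open>e > 0\<close>.

  The combination \<open>\<phi> e w \<mp> exp (- e/2 - w) * \<phi> e (- w - e)\<close> is a two-sided theta series. By the triple
  product it has size \<open>exp ((w\<^sup>2 - \<alpha>\<^sup>2) / (2 e))\<close> up to subexponential factors, with \<open>\<alpha> = \<pi>\<close> for positive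
  and \<open>\<alpha> = \<pi>/2\<close> for negative \<open>q\<close>, and it alternates in sign along a grid of step \<open>d e\<close> (\<open>d = 1\<close> or
  \<open>d = 2\<close>). For \<open>0 < w < \<alpha>\<close> the reflected term wins and \<open>\<phi>\<close> has no zeros; for \<open>w > \<alpha>\<close> the theta
  series wins, and each grid step contributes a zero. This gives the counting limits and the density
  of the zeros as \<open>e\<close> tends to 0. A window far to the right loses its two zeros through a double zero,
  at a value of \<open>e\<close> that tends to 0 with the position of the window: these are the spectral numbers.\<close>

section \<open>The series in exponential coordinates\<close>

text \<open>Sign changes on the grid bound the number of zeros only from below; the matching upper
  bound is the obstacle. Monotonicity in \<open>e\<close> supplies it, but only for windows at whose
  ends the function vanishes for no \<open>e > 0\<close> at all, not merely for small
  \<open>e\<close>. The ends are therefore grid points of one parity, where the theta series and the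
  reflected term have the same sign.

  The reflected term is the part of the two-sided series with negative index: putting
  \<open>j = - 1 - i\<close> reproduces the function itself at \<open>- w - e\<close>.

  The constant \<pi> comes from Euler's sum: minus the logarithm of the product of all
  \<open>1 - exp (- e m)\<close> is about \<open>\<pi>^2 / (6 e)\<close>, and the triple product
  contributes three such products. For negative \<open>q\<close> the terms of even and of odd index
  each form an alternating series with \<open>4 e\<close> for \<open>e\<close> and
  \<open>2 w\<close> for \<open>w\<close>, which halves \<pi>.

  For positive \<open>q\<close> any double zero yields a spectral number. For negative
  \<open>q\<close> the spectral numbers are defined by labelled zeros followed from
  \<open>q = 0\<close>, so a collision must be matched with its labels: these are read off for large
  \<open>e\<close>, and uniqueness of the continuation does the rest.\<close>

definition ptt :: "(nat \<Rightarrow> real) \<Rightarrow> nat \<Rightarrow> complex \<Rightarrow> complex \<Rightarrow> complex" where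
  "ptt c j e w = of_real (c j) * exp (of_nat j * w - e * (of_nat j)^2 / 2)"

text \<open>The time \<open>e\<close> is complex because the splitting of zeros rests on a Taylor
  expansion in a complex variable \<open>s\<close>, with time \<open>e + s^2\<close>.\<close>

definition pt :: "(nat \<Rightarrow> real) \<Rightarrow> complex \<Rightarrow> complex \<Rightarrow> complex" where
  "pt c e w = (\<Sum>j. ptt c j e w)"

definition ptr :: "(nat \<Rightarrow> real) \<Rightarrow> real \<Rightarrow> real \<Rightarrow> real" where
  "ptr c e v = (\<Sum>j. c j * exp (real j * v - e * (real j)^2 / 2))"

definition pmaj :: "real \<Rightarrow> real \<Rightarrow> nat \<Rightarrow> real" where
  "pmaj e B j = exp (real j * B - e * (real j)^2 / 2)"

text \<open>Completing the square gives
  \<open>(B + 1) j - e j^2 / 2 \<le> (B + 1)^2 / (2 e)\<close>, so the terms are dominated by a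
  constant multiple of \<open>exp (- j)\<close>.\<close>

lemma summable_pmaj:
  assumes "e > 0"
  shows "summable (pmaj e B)"
proof (rule summable_comparison_test)
  define K where "K = (B + 1)^2 / (2 * e)"
  have "real j * B - e * (real j)^2 / 2 \<le> K + (- real j)" for j
  proof -
    have "0 \<le> (e * real j - (B + 1))^2" by simp
    hence "(B + 1) * (e * real j) - (e * real j)^2 / 2 \<le> (B + 1)^2 / 2"
      by (simp add: power2_diff algebra_simps)
    moreover have "e * (real j * B - e * (real j)^2 / 2 + real j) = (B + 1) * (e * real j) - (e * real j)^2 / 2"
      by (simp add: algebra_simps power2_eq_square)
    moreover have "e * K = (B + 1)^2 / 2" using assms by (simp add: K_def)
    ultimately have "e * (real j * B - e * (real j)^2 / 2 + real j) \<le> e * K" by simp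
    thus ?thesis using assms by (simp add: mult_le_cancel_left)
  qed
  hence "norm (pmaj e B j) \<le> exp K * exp (-1) ^ j" for j
    by (simp add: pmaj_def exp_add[symmetric] exp_of_nat_mult[symmetric])
  thus "\<exists>N. \<forall>n\<ge>N. norm (pmaj e B n) \<le> exp K * exp (-1) ^ n" by blast
  show "summable (\<lambda>n. exp K * exp (-1 :: real) ^ n)"
    by (intro summable_mult summable_geometric) simp
qed

lemma norm_ptt_le:
  assumes "\<bar>c j\<bar> \<le> 1" "e0 \<le> Re e" "Re w \<le> B"
  shows "norm (ptt c j e w) \<le> pmaj e0 B j"
proof -
  have "norm (ptt c j e w) = \<bar>c j\<bar> * exp (real j * Re w - Re e * (real j)^2 / 2)"
    by (simp add: ptt_def norm_mult norm_exp_eq_Re power2_eq_square)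
  also have "\<dots> \<le> 1 * exp (real j * B - e0 * (real j)^2 / 2)"
    using assms by (intro mult_mono) (auto intro!: add_mono diff_mono mult_left_mono mult_right_mono)
  finally show ?thesis by (simp add: pmaj_def)
qed

text \<open>Only the modulus of the coefficients enters the analytic part, so one development serves
  all three sign patterns.\<close>

locale sign_seq =
  fixes c :: "nat \<Rightarrow> real"
  assumes c_abs: "\<bar>c j\<bar> = 1"
begin

lemma summable_ptt: "Re e > 0 \<Longrightarrow> summable (\<lambda>j. ptt c j e w)"
  by (rule summable_comparison_test'[OF summable_pmaj[of "Re e" "Re w"]])
     (auto intro!: norm_ptt_le simp: c_abs)

text \<open>Stated for a family of times and arguments, since joint continuity, holomorphy and
  derivatives along curves in both variables are all drawn from it.\<close>

lemma pt_uniform: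
  assumes "e0 > 0" "\<And>s. s \<in> A \<Longrightarrow> e0 \<le> Re (E s)" "\<And>s. s \<in> A \<Longrightarrow> Re (W s) \<le> B"
  shows "uniform_limit A (\<lambda>N s. \<Sum>j<N. ptt c j (E s) (W s)) (\<lambda>s. pt c (E s) (W s)) sequentially"
  unfolding pt_def
  by (rule Weierstrass_m_test[where M = "pmaj e0 B"])
     (use assms in \<open>auto intro!: norm_ptt_le summable_pmaj simp: c_abs\<close>)

lemma continuous_on_pt_prod:
  "continuous_on {p. Re (fst p) > 0} (\<lambda>p. pt c (fst p) (snd p))"
proof -
  have S: "open {p :: complex \<times> complex. Re (fst p) > 0}"
    by (intro open_Collect_less continuous_intros)
  show ?thesis
    unfolding continuous_on_eq_continuous_at[OF S]
  proof
    fix p0 :: "complex \<times> complex" assume p0: "p0 \<in> {p. Re (fst p) > 0}"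
    define U where "U = {p :: complex \<times> complex. Re (fst p0) / 2 < Re (fst p)} \<inter>
                        {p. Re (snd p) < Re (snd p0) + 1}"
    have U: "open U" unfolding U_def
      by (intro open_Int open_Collect_less continuous_intros)
    have "uniform_limit U (\<lambda>N s. \<Sum>j<N. ptt c j (fst s) (snd s)) (\<lambda>s. pt c (fst s) (snd s)) sequentially"
      by (rule pt_uniform[of "Re (fst p0) / 2" _ _ _ "Re (snd p0) + 1"]) (use p0 in \<open>auto simp: U_def\<close>)
    hence "continuous_on U (\<lambda>s. pt c (fst s) (snd s))"
      by (rule uniform_limit_theorem[rotated])
         (auto simp: ptt_def intro!: always_eventually continuous_intros)
    thus "isCont (\<lambda>p. pt c (fst p) (snd p)) p0"
      using U p0 by (auto simp: continuous_on_eq_continuous_at U_def)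
  qed
qed

lemma continuous_on_pt [continuous_intros]:
  assumes "continuous_on A E" "continuous_on A W" "\<And>s. s \<in> A \<Longrightarrow> Re (E s) > 0"
  shows "continuous_on A (\<lambda>s. pt c (E s) (W s))"
proof -
  have "continuous_on A (\<lambda>s. (E s, W s))" using assms by (auto intro: continuous_on_Pair)
  moreover have "(\<lambda>s. (E s, W s)) ` A \<subseteq> {p. 0 < Re (fst p)}" using assms(3) by auto
  ultimately show ?thesis using continuous_on_compose2[OF continuous_on_pt_prod, of A "\<lambda>s. (E s, W s)"] by simp
qed

lemma pt_holo_comp:
  assumes "open A" "E holomorphic_on A" "W holomorphic_on A" "\<And>s. s \<in> A \<Longrightarrow> Re (E s) > 0"
  shows "(\<lambda>s. pt c (E s) (W s)) holomorphic_on A"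
proof (rule holomorphic_uniform_sequence[OF assms(1)])
  show "(\<lambda>s. \<Sum>j<n. ptt c j (E s) (W s)) holomorphic_on A" for n
    unfolding ptt_def by (intro holomorphic_intros assms) auto
  fix x assume x: "x \<in> A"
  obtain d where d: "d > 0" "cball x d \<subseteq> A" using assms(1) x by (meson open_contains_cball)
  have cE: "continuous_on (cball x d) E" and cW: "continuous_on (cball x d) W"
    using assms(2,3) d holomorphic_on_imp_continuous_on continuous_on_subset by blast+
  have ne: "cball x d \<noteq> {}" using d by auto
  have "continuous_on (cball x d) (\<lambda>s. Re (E s))" "continuous_on (cball x d) (\<lambda>s. Re (W s))"
    by (intro continuous_intros cE cW)+
  then obtain s0 s1 where s: "s0 \<in> cball x d" "\<And>s. s \<in> cball x d \<Longrightarrow> Re (E s0) \<le> Re (E s)"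
      "\<And>s. s \<in> cball x d \<Longrightarrow> Re (W s) \<le> Re (W s1)"
    using continuous_attains_inf[OF compact_cball ne] continuous_attains_sup[OF compact_cball ne] by metis
  have "uniform_limit (cball x d) (\<lambda>N s. \<Sum>j<N. ptt c j (E s) (W s)) (\<lambda>s. pt c (E s) (W s)) sequentially"
    by (rule pt_uniform[of "Re (E s0)" _ _ _ "Re (W s1)"]) (use s assms(4) d in auto)
  thus "\<exists>d>0. cball x d \<subseteq> A \<and>
      uniform_limit (cball x d) (\<lambda>N s. \<Sum>j<N. ptt c j (E s) (W s)) (\<lambda>s. pt c (E s) (W s)) sequentially"
    using d by blast
qed

lemma pt_holo: "Re e > 0 \<Longrightarrow> pt c e holomorphic_on A"
  by (rule holomorphic_on_subset[of _ UNIV]) (auto intro!: pt_holo_comp[of UNIV "\<lambda>_. e" "\<lambda>w. w"])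

lemma pt_analytic: "Re e > 0 \<Longrightarrow> pt c e analytic_on A"
  using pt_holo[of e UNIV] analytic_on_open[of UNIV] analytic_on_subset by blast

lemma pt_of_real: "e > 0 \<Longrightarrow> pt c (of_real e) (of_real v) = of_real (ptr c e v)"
proof -
  assume e: "e > 0"
  have *: "ptt c j (of_real e) (of_real v) = of_real (c j * exp (real j * v - e * (real j)^2 / 2))" for j
    by (simp add: ptt_def exp_of_real[symmetric])
  have "summable (\<lambda>j. c j * exp (real j * v - e * (real j)^2 / 2))"
    using summable_ptt[of "of_real e" "of_real v"] e unfolding * summable_complex_of_real by simp
  thus ?thesis
    unfolding pt_def ptr_def * by (rule suminf_of_real[symmetric])
qed

lemma continuous_on_ptr [continuous_intros]:
  assumes "continuous_on A E" "continuous_on A W" "\<And>s. s \<in> A \<Longrightarrow> E s > 0"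
  shows "continuous_on A (\<lambda>s. ptr c (E s) (W s))"
proof -
  have "continuous_on A (\<lambda>s. Re (pt c (of_real (E s)) (of_real (W s))))"
    by (intro continuous_intros assms) (simp add: assms(3))
  thus ?thesis by (rule continuous_on_eq) (simp add: pt_of_real assms(3))
qed

lemma summable_ptr: "e > 0 \<Longrightarrow> summable (\<lambda>j. c j * exp (real j * v - e * (real j)^2 / 2))"
  by (rule summable_comparison_test'[OF summable_pmaj[of e v]]) (auto simp: pmaj_def abs_mult c_abs)

lemma pt_eq_0_real_iff: "e > 0 \<Longrightarrow> pt c (of_real e) (of_real v) = 0 \<longleftrightarrow> ptr c e v = 0"
  by (simp add: pt_of_real)

text \<open>At \<open>-2\<close> the term of index 0 has modulus 1, while the others sum to at most
  \<open>exp (-2) / (1 - exp (-2)) < 1\<close>. The function is thus not identically zero, so its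
  zeros are isolated and have finite order.\<close>

lemma pt_nonzero_left: "\<exists>w. pt c (of_real e) w \<noteq> 0" if e: "e > 0"
proof -
  define v :: real where "v = - 2"
  have "norm (pt c (of_real e) (of_real v) - ptt c 0 (of_real e) (of_real v)) < 1"
  proof -
    have sm: "summable (\<lambda>j. ptt c j (of_real e) (of_real v))" using summable_ptt e by simp
    have "pt c (of_real e) (of_real v) - ptt c 0 (of_real e) (of_real v) = (\<Sum>j. ptt c (Suc j) (of_real e) (of_real v))"
      unfolding pt_def using suminf_split_head[OF sm] by simp
    also have "norm \<dots> \<le> (\<Sum>j. exp (-2) * exp (-2) ^ j)"
    proof (rule norm_suminf_le)
      show "norm (ptt c (Suc j) (of_real e) (of_real v)) \<le> exp (-2) * exp (-2) ^ j" for j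
      proof -
        have "norm (ptt c (Suc j) (of_real e) (of_real v)) \<le> pmaj 0 (-2) (Suc j)"
          by (rule norm_ptt_le) (use e c_abs in \<open>auto simp: v_def\<close>)
        also have "\<dots> = exp (-2) * exp (-2) ^ j"
          by (simp add: pmaj_def exp_of_nat_mult[symmetric] exp_add[symmetric] algebra_simps)
        finally show ?thesis .
      qed
    qed (auto intro!: summable_mult summable_geometric)
    also have "\<dots> = exp (-2) * (1 / (1 - exp (-2)))"
      by (subst suminf_mult) (auto intro!: summable_geometric simp: suminf_geometric)
    also have "\<dots> < 1"
    proof -
      have "exp (-2 :: real) < 1/2"
        using exp_ge_add_one_self[of "2::real"] by (simp add: exp_minus field_simps)
      thus ?thesis by (simp add: field_simps)
    qed
    finally show ?thesis .
  qed
  moreover have "norm (ptt c 0 (of_real e) (of_real v)) = 1" by (simp add: ptt_def c_abs)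
  ultimately have "pt c (of_real e) (of_real v) \<noteq> 0" by auto
  thus ?thesis by blast
qed

end

section \<open>Hermite polynomials and the splitting of multiple zeros\<close>

text \<open>The probabilists' Hermite polynomials, with generating function
  \<open>exp (x y - x^2 / 2)\<close>. With \<open>x = j s\<close> this is the factor that the term
  of index \<open>j\<close> acquires when \<open>(e, v)\<close> is replaced by
  \<open>(e + s^2, v + s y)\<close>.\<close>

fun he :: "nat \<Rightarrow> 'a::real_normed_field \<Rightarrow> 'a" where
  "he 0 y = 1"
| "he (Suc 0) y = y"
| "he (Suc (Suc n)) y = y * he (Suc n) y - of_nat (Suc n) * he n y"

lemma he_Suc: "he (Suc n) y = y * he n y - of_nat n * he (n - 1) y"
  by (cases n) auto

lemma DERIV_he: "(he n has_field_derivative of_nat n * he (n - 1) y) (at y)"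
proof (induction n arbitrary: y rule: induct_nat_012)
  case (ge2 n)
  have "((\<lambda>y::'a. y * he (Suc n) y - of_nat (Suc n) * he n y) has_field_derivative
     (1 * he (Suc n) y + of_nat (Suc n) * he n y * y) - of_nat (Suc n) * (of_nat n * he (n - 1) y)) (at y)"
    using ge2.IH(1)[of y] ge2.IH(2)[of y] by (intro DERIV_diff DERIV_mult DERIV_cmult DERIV_ident) auto
  moreover have "(1 * he (Suc n) y + of_nat (Suc n) * he n y * y) - of_nat (Suc n) * (of_nat n * he (n - 1) y)
      = of_nat (Suc (Suc n)) * he (Suc n) y"
    unfolding he_Suc[of n] by (simp add: algebra_simps)
  ultimately show ?case by simp
next
  case 0
  have "he 0 = (\<lambda>y::'a. 1)" by auto
  thus ?case by simp
next
  case 1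
  have "he (Suc 0) = (\<lambda>y::'a. y)" by auto
  thus ?case by simp
qed

lemma DERIV_he_chain [derivative_intros]:
  "(f has_field_derivative f') (at x) \<Longrightarrow> x' = of_nat n * he (n - 1) (f x) * f' \<Longrightarrow>
   ((\<lambda>x. he n (f x)) has_field_derivative x') (at x)"
  using DERIV_chain2[OF DERIV_he[of n]] by simp

lemma of_real_he: "he n (of_real y :: complex) = of_real (he n y)"
  by (induction n rule: induct_nat_012) auto

lemma he_minus: "he n (- y) = (-1)^n * he n (y::real)"
  by (induction n rule: induct_nat_012) (auto simp: algebra_simps)

text \<open>By induction the derivative \<open>Suc n * he n\<close> is at least 1 far to the right,
  so the next polynomial grows there at least linearly.\<close>

lemma he_ge_1: "\<exists>Y>0. \<forall>y\<ge>Y. he n y \<ge> (1::real)"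
proof (induction n)
  case 0 show ?case by (auto intro!: exI[of _ 1])
next
  case (Suc n)
  then obtain Y where Y: "Y > 0" "\<And>y. y \<ge> Y \<Longrightarrow> he n y \<ge> (1::real)" by blast
  define Y' where "Y' = Y + \<bar>he (Suc n) Y\<bar> + 1"
  have "he (Suc n) y \<ge> 1" if "y \<ge> Y'" for y
  proof -
    have "Y < y" using that by (simp add: Y'_def)
    then obtain z where z: "z > Y" "he (Suc n) y - he (Suc n) Y = (y - Y) * (of_nat (Suc n) * he n z)"
      using MVT2[of Y y "he (Suc n)" "\<lambda>z. of_nat (Suc n) * he n z"] DERIV_he[of "Suc n"] by auto
    have "1 * 1 \<le> real (Suc n) * he n z" using Y(2)[of z] z(1) by (intro mult_mono) auto
    hence "y - Y \<le> (y - Y) * (of_nat (Suc n) * he n z)" using \<open>Y < y\<close> by simp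
    thus ?thesis using z(2) that by (simp add: Y'_def)
  qed
  moreover have "Y' > 0" using Y(1) by (simp add: Y'_def)
  ultimately show ?case by blast
qed

text \<open>The derivative of \<open>he m x * exp (- x^2 / 2)\<close> is
  \<open>- he (Suc m) x * exp (- x^2 / 2)\<close>. Between consecutive alternation points for
  \<open>m\<close> the mean value theorem finds a point where \<open>he (Suc m)\<close> has the
  required sign.\<close>

lemma he_alternates:
  "\<exists>y. (\<forall>i<m. y i < y (Suc i)) \<and> (\<forall>i\<le>m. (-1)^(m+i) * he m (y i) > (0::real))"
proof (induction m)
  case 0 show ?case by auto
next
  case (Suc m)
  then obtain y where y: "\<And>i. i < m \<Longrightarrow> y i < y (Suc i)"
    and alt: "\<And>i. i \<le> m \<Longrightarrow> (-1)^(m+i) * he m (y i) > (0::real)" by blast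
  define F :: "real \<Rightarrow> real" where "F = (\<lambda>x. he m x * exp (- (x^2 / 2)))"
  have dF: "(F has_real_derivative - he (Suc m) x * exp (- (x^2 / 2))) (at x)" for x
    unfolding F_def he_Suc by (auto intro!: derivative_eq_intros simp: algebra_simps)
  have "\<exists>z. y i < z \<and> z < y (Suc i) \<and> (-1)^(m+i) * he (Suc m) z > 0" if i: "i < m" for i
  proof -
    obtain z where z: "y i < z" "z < y (Suc i)"
        "F (y (Suc i)) - F (y i) = (y (Suc i) - y i) * (- he (Suc m) z * exp (- (z^2 / 2)))"
      using MVT2[OF y[OF i], of F "\<lambda>z. - he (Suc m) z * exp (- (z^2 / 2))"] dF by blast
    have "(-1)^(m+i) * F (y i) > 0" "(-1)^(m+i) * F (y (Suc i)) < 0"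
      using alt[of i] alt[of "Suc i"] i
      by (simp_all add: F_def mult.assoc[symmetric] zero_less_mult_iff mult_less_0_iff)
    hence "(-1)^(m+i) * (F (y (Suc i)) - F (y i)) < 0" by (simp add: algebra_simps)
    hence "((y (Suc i) - y i) * exp (- (z^2 / 2))) * ((-1)^(m+i) * he (Suc m) z) > 0"
      unfolding z(3) by (simp add: algebra_simps)
    hence "(-1)^(m+i) * he (Suc m) z > 0"
      using y[OF i] by (rule_tac zero_less_mult_pos[of "(y (Suc i) - y i) * exp (- (z^2 / 2))"]) auto
    thus ?thesis using z by blast
  qed
  then obtain z where z: "\<And>i. i < m \<Longrightarrow> y i < z i \<and> z i < y (Suc i) \<and> (-1)^(m+i) * he (Suc m) (z i) > 0"
    by metis
  obtain Y where Y: "Y > 0" "\<And>y. y \<ge> Y \<Longrightarrow> he (Suc m) y \<ge> (1::real)" using he_ge_1 by blast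
  \<comment> \<open>The inner points come from the mean value theorem; the two outermost ones are
    taken so far out that \<open>he_ge_1\<close>, combined with the parity of the polynomial, fixes
    the sign.\<close>
  define x where "x i = (if i = 0 then min (- Y) (y 0 - 1) else if i = Suc m then max Y (y m + 1) else z (i - 1))" for i
  have x0: "x 0 < y 0" and xm: "x (Suc m) > y m" by (auto simp: x_def)
  have xz: "x (Suc i) = z i" if "i < m" for i using that by (simp add: x_def)
  have "x i < x (Suc i)" if "i < Suc m" for i
  proof -
    have "x i \<le> y i"
    proof (cases i)
      case (Suc k)
      hence "x i = z k" "z k < y (Suc k)" using that xz[of k] z[of k] by auto
      thus ?thesis using Suc by simp
    qed (use x0 in auto)
    moreover have "y i \<le> x (Suc i)"
    proof (cases "i = m")
      case True thus ?thesis using xm by simp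
    next
      case False
      hence "i < m" using that by simp
      thus ?thesis using xz z by fastforce
    qed
    moreover have "x (Suc i) \<noteq> y i"
    proof (cases "i = m")
      case True thus ?thesis using xm by simp
    next
      case False
      hence "i < m" using that by simp
      thus ?thesis using xz z by fastforce
    qed
    ultimately show ?thesis by linarith
  qed
  moreover have "(-1)^(Suc m + i) * he (Suc m) (x i) > 0" if i_le: "i \<le> Suc m" for i
  proof -
    consider "i = 0" | "i = Suc m" | "0 < i" "i \<le> m"
      using i_le by linarith
    thus ?thesis
    proof cases
      case 1
      have "he (Suc m) (- x 0) \<ge> 1" by (rule Y(2)) (auto simp: x_def)
      hence "(-1)^Suc m * he (Suc m) (x 0) \<ge> 1" unfolding he_minus .
      thus ?thesis using 1 by simp
    next
      case 2
      have "he (Suc m) (x (Suc m)) \<ge> 1" by (rule Y(2)) (auto simp: x_def)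
      thus ?thesis using 2 by (simp add: power_add[symmetric] del: he.simps)
    next
      case 3
      then obtain k where "i = Suc k" "k < m" by (cases i) auto
      thus ?thesis using z[of k] xz[of k] by (simp del: he.simps)
    qed
  qed
  ultimately show ?case by blast
qed

lemma alternation_zeros:
  fixes g :: "real \<Rightarrow> real"
  assumes cont: "continuous_on {y 0..y n} g" and mono: "\<And>i. i < n \<Longrightarrow> y i < y (Suc i)"
    and alt: "\<And>i. i \<le> n \<Longrightarrow> (-1)^i * s * g (y i) > 0"
  shows "\<exists>S. S \<subseteq> {y 0<..<y n} \<and> finite S \<and> card S = n \<and> (\<forall>v\<in>S. g v = 0)"
proof -
  have ymono: "y i \<le> y j" if "i \<le> j" "j \<le> n" for i j
    using that
  proof (induction j)
    case (Suc j)
    thus ?case using mono[of j] by (cases "i = Suc j") (auto simp: le_Suc_eq)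
  qed simp
  have "\<exists>z. y i < z \<and> z < y (Suc i) \<and> g z = 0" if i: "i < n" for i
  proof -
    have c: "continuous_on {y i..y (Suc i)} g"
      by (rule continuous_on_subset[OF cont]) (use ymono[of 0 i] ymono[of "Suc i" n] i in auto)
    have "(-1)^i * s * g (y i) > 0" "(-1)^i * s * g (y (Suc i)) < 0"
      using alt[of i] alt[of "Suc i"] i by auto
    hence ne: "g (y i) \<noteq> 0" "g (y (Suc i)) \<noteq> 0" and "g (y i) * g (y (Suc i)) < 0"
      by (auto simp: zero_less_mult_iff mult_less_0_iff)
    hence "(g (y i) \<le> 0 \<and> 0 \<le> g (y (Suc i))) \<or> (g (y (Suc i)) \<le> 0 \<and> 0 \<le> g (y i))"
      by (auto simp: mult_less_0_iff)
    then obtain z where z: "y i \<le> z" "z \<le> y (Suc i)" "g z = 0"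
      using IVT'[of g "y i" 0 "y (Suc i)"] IVT2'[of g "y (Suc i)" 0 "y i"] c mono[OF i] by auto
    thus ?thesis using ne by (metis order_le_less)
  qed
  then obtain z where z: "\<And>i. i < n \<Longrightarrow> y i < z i \<and> z i < y (Suc i) \<and> g (z i) = 0" by metis
  have lt: "z i < z j" if "i < j" "j < n" for i j
    using z[of i] z[of j] ymono[of "Suc i" j] that by fastforce
  have "inj_on z {..<n}"
    by (rule inj_onI) (metis lt lessThan_iff linorder_neqE_nat order_less_irrefl)
  hence "card (z ` {..<n}) = n" by (simp add: card_image)
  moreover have "z ` {..<n} \<subseteq> {y 0<..<y n}"
  proof clarify
    fix i assume "i < n"
    thus "z i \<in> {y 0<..<y n}"
      using z[of i] ymono[of 0 i] ymono[of "Suc i" n] by auto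
  qed
  ultimately show ?thesis using z by (intro exI[of _ "z ` {..<n}"]) auto
qed

section \<open>Counting real zeros by Rouche's theorem\<close>

context sign_seq begin

lemma zorder_pt:
  assumes "e > 0"
  shows "zorder (pt c (of_real e)) w \<ge> 0" "zorder (pt c (of_real e)) w > 0 \<longleftrightarrow> pt c (of_real e) w = 0"
proof -
  have "if pt c (of_real e) w = 0 then zorder (pt c (of_real e)) w > 0 else zorder (pt c (of_real e)) w = 0"
    using zorder_exist_zero[of "pt c (of_real e)" UNIV w] pt_nonzero_left[OF assms] pt_holo[of "of_real e"] assms by (auto simp: connected_UNIV)
  thus "zorder (pt c (of_real e)) w \<ge> 0" "zorder (pt c (of_real e)) w > 0 \<longleftrightarrow> pt c (of_real e) w = 0"
    by (auto split: if_splits)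
qed

lemma finite_zeros_pt:
  assumes "e > 0" "compact K"
  shows "finite {w \<in> K. pt c (of_real e) w = 0}"
proof (cases "pt c (of_real e) constant_on UNIV")
  case True
  thus ?thesis using pt_nonzero_left[OF assms(1)] by (auto simp: constant_on_def)
next
  case False
  thus ?thesis
    using holomorphic_compact_finite_zeros[of "pt c (of_real e)" UNIV K] assms pt_holo by auto
qed

lemma finite_zeros_ptr:
  assumes "e > 0"
  shows "finite {v \<in> {l..r}. ptr c e v = 0}"
proof -
  have "finite {w \<in> of_real ` {l..r}. pt c (of_real e) w = 0}"
    by (intro finite_zeros_pt assms compact_continuous_image continuous_intros) auto
  moreover have "of_real ` {v \<in> {l..r}. ptr c e v = 0} \<subseteq> {w \<in> of_real ` {l..r}. pt c (of_real e) w = 0}"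
    using pt_of_real[OF assms] by auto
  ultimately show ?thesis
    by (meson finite_subset finite_imageD inj_of_real inj_on_subset subset_UNIV)
qed

text \<open>Uniform continuity on a compact set of times and arguments. It provides the inequality
  on a contour that Rouche's theorem asks for.\<close>

lemma pt_close:
  assumes "e0 > 0" "compact K" "m > 0"
  shows "\<forall>\<^sub>F e in at e0. \<forall>w\<in>K. norm (pt c (of_real e) w - pt c (of_real e0) w) < m"
proof -
  define C where "C = {e0/2..2*e0} \<times> K"
  have "continuous_on C (\<lambda>p. pt c (of_real (fst p)) (snd p))"
    by (intro continuous_intros) (use assms in \<open>auto simp: C_def\<close>)
  moreover have "compact C" unfolding C_def using assms by (intro compact_Times) auto
  ultimately have "uniformly_continuous_on C (\<lambda>p. pt c (of_real (fst p)) (snd p))"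
    by (rule compact_uniformly_continuous)
  then obtain d where d: "d > 0" "\<And>p p'. p \<in> C \<Longrightarrow> p' \<in> C \<Longrightarrow> dist p' p < d \<Longrightarrow>
      dist (pt c (of_real (fst p')) (snd p')) (pt c (of_real (fst p)) (snd p)) < m"
    using \<open>m > 0\<close> unfolding uniformly_continuous_on_def by metis
  have "\<forall>\<^sub>F e in at e0. dist e e0 < min d (e0/2)"
    using assms d(1) by (auto simp: eventually_at intro!: exI[of _ "min d (e0/2)"])
  thus ?thesis
  proof eventually_elim
    case (elim e)
    show ?case
    proof
      fix w assume w: "w \<in> K"
      have "dist (e, w) (e0, w) < d" using elim by (simp add: dist_Pair_Pair)
      moreover have "\<bar>e - e0\<bar> < e0/2" using elim by (simp add: dist_real_def)
      hence "e0/2 \<le> e" "e \<le> 2 * e0" "e0/2 \<le> e0" "e0 \<le> 2 * e0" using assms(1) by linarith+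
      hence "(e, w) \<in> C" "(e0, w) \<in> C"
        using w by (auto simp: C_def)
      ultimately show "norm (pt c (of_real e) w - pt c (of_real e0) w) < m"
        using d(2)[of "(e0,w)" "(e,w)"] by (simp add: dist_norm)
    qed
  qed
qed

text \<open>Multiplicity is that of the complex entire function, so the count is comparable with the
  number of zeros in a rectangle.\<close>

definition zcount :: "real \<Rightarrow> real set \<Rightarrow> nat" where
  "zcount e A = (\<Sum>v | v \<in> A \<and> ptr c e v = 0. nat (zorder (pt c (of_real e)) (of_real v)))"

text \<open>Rouche's theorem is about sums weighted by winding numbers over an open set
  \<open>S\<close> larger than the rectangle. Zeros inside have winding number 1, those outside 0,
  and the contour carries none, so the weighted sum is the plain sum of orders.\<close>

lemma winding_sum_rectpath:
  assumes e: "e > 0" and lr: "Re a < Re b" "Im a < Im b"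
    and S: "bounded S" "cbox a b \<subseteq> S"
    and nz: "\<And>w. w \<in> path_image (rectpath a b) \<Longrightarrow> pt c (of_real e) w \<noteq> 0"
  shows "(\<Sum>p\<in>{p\<in>S. pt c (of_real e) p = 0}. winding_number (rectpath a b) p * of_int (zorder (pt c (of_real e)) p))
       = of_int (\<Sum>p\<in>{p\<in>box a b. pt c (of_real e) p = 0}. zorder (pt c (of_real e)) p)"
    and "finite {p\<in>S. pt c (of_real e) p = 0}"
proof -
  have "finite {w \<in> closure S. pt c (of_real e) w = 0}"
    using S(1) by (intro finite_zeros_pt e) (simp add: compact_closure)
  thus fin: "finite {p\<in>S. pt c (of_real e) p = 0}"
    by (rule rev_finite_subset) (use closure_subset in auto)
  have "(\<Sum>p\<in>{p\<in>S. pt c (of_real e) p = 0}. winding_number (rectpath a b) p * of_int (zorder (pt c (of_real e)) p))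
     = (\<Sum>p\<in>{p\<in>box a b. pt c (of_real e) p = 0}. of_int (zorder (pt c (of_real e)) p))"
  proof (rule sum.mono_neutral_cong_right[OF fin])
    show "{p \<in> box a b. pt c (of_real e) p = 0} \<subseteq> {p \<in> S. pt c (of_real e) p = 0}"
      using S(2) box_subset_cbox by blast
    show "\<forall>p\<in>{p \<in> S. pt c (of_real e) p = 0} - {p \<in> box a b. pt c (of_real e) p = 0}.
       winding_number (rectpath a b) p * of_int (zorder (pt c (of_real e)) p) = 0"
    proof
      fix p assume p: "p \<in> {p \<in> S. pt c (of_real e) p = 0} - {p \<in> box a b. pt c (of_real e) p = 0}"
      hence "p \<notin> path_image (rectpath a b)" using nz by blast
      hence "p \<notin> cbox a b" using p lr by (auto simp: path_image_rectpath_cbox_minus_box)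
      hence "winding_number (rectpath a b) p = 0"
        by (intro winding_number_rectpath_outside) (use lr in auto)
      thus "winding_number (rectpath a b) p * of_int (zorder (pt c (of_real e)) p) = 0" by simp
    qed
    show "winding_number (rectpath a b) p * of_int (zorder (pt c (of_real e)) p) = of_int (zorder (pt c (of_real e)) p)"
      if "p \<in> {p \<in> box a b. pt c (of_real e) p = 0}" for p
      using winding_number_rectpath[of p a b] that by simp
  qed
  thus "(\<Sum>p\<in>{p\<in>S. pt c (of_real e) p = 0}. winding_number (rectpath a b) p * of_int (zorder (pt c (of_real e)) p))
       = of_int (\<Sum>p\<in>{p\<in>box a b. pt c (of_real e) p = 0}. zorder (pt c (of_real e)) p)" by simp
qed

text \<open>Take a rectangle around the interval so thin that at time \<open>e0\<close> all its
  zeros are real. The total number of zeros in it is constant for \<open>e\<close> near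
  \<open>e0\<close>, but some of them may have left the real axis, hence only an inequality.\<close>

lemma zcount_usc:
  assumes e0: "e0 > 0" and lr: "l < r" and nzl: "ptr c e0 l \<noteq> 0" and nzr: "ptr c e0 r \<noteq> 0"
  shows "\<forall>\<^sub>F e in at e0. zcount e {l..r} \<le> zcount e0 {l..r}"
proof -
  define K where "K = cbox (Complex l (-1)) (Complex r 1)"
  define I where "I = (\<lambda>w. \<bar>Im w\<bar>) ` {w \<in> K. pt c (of_real e0) w = 0 \<and> Im w \<noteq> 0}"
  have "finite {w \<in> K. pt c (of_real e0) w = 0}"
    unfolding K_def by (intro finite_zeros_pt e0 compact_cbox)
  hence finI: "finite I" unfolding I_def by (auto elim: rev_finite_subset)
  \<comment> \<open>Half of the least distance from the real axis of a nonreal zero in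
    \<open>K\<close>; the inserted 1 covers the case without such zeros.\<close>
  define h where "h = Min (insert 1 I) / 2"
  have "Min (insert 1 I) > 0" using finI by (subst Min_gr_iff) (auto simp: I_def)
  moreover have "Min (insert 1 I) \<le> 1" using finI by simp
  moreover have "Min (insert 1 I) \<le> x" if "x \<in> I" for x using finI that by simp
  ultimately have h: "h > 0" "h < 1" "\<And>x. x \<in> I \<Longrightarrow> h < x" by (fastforce simp: h_def)+
  have Im0: "Im w = 0" if "w \<in> K" "pt c (of_real e0) w = 0" "\<bar>Im w\<bar> \<le> h" for w
    using h(3)[of "\<bar>Im w\<bar>"] that unfolding I_def by force
  define a where "a = Complex l (-h)"
  define b where "b = Complex r h"
  have ab: "Re a < Re b" "Im a < Im b" using lr h by (auto simp: a_def b_def)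
  define P where "P = path_image (rectpath a b)"
  have P: "P = {z. Re z \<in> {l, r} \<and> Im z \<in> {-h..h}} \<union> {z. Im z \<in> {-h, h} \<and> Re z \<in> {l..r}}"
    unfolding P_def using ab path_image_rectpath[of a b] by (simp add: a_def b_def)
  have PK: "w \<in> K \<and> \<bar>Im w\<bar> \<le> h" if "w \<in> P" for w
    using that h lr unfolding P K_def by (auto simp: in_cbox_complex_iff)
  have nzP: "pt c (of_real e0) w \<noteq> 0" if "w \<in> P" for w
  proof
    assume z: "pt c (of_real e0) w = 0"
    hence "Im w = 0" using Im0 PK that by blast
    moreover from this have "w = of_real l \<or> w = of_real r"
      using that h unfolding P by (auto simp: complex_eq_iff)
    ultimately show False using z nzl nzr e0 by (auto simp: pt_of_real)
  qed
  have cP: "compact P" unfolding P_def by (intro compact_path_image path_rectpath)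
  have "a \<in> P" unfolding P_def by (metis pathstart_in_path_image pathstart_rectpath)
  hence "P \<noteq> {}" by blast
  moreover have "continuous_on P (\<lambda>w. norm (pt c (of_real e0) w))"
    by (intro continuous_intros) (use e0 in auto)
  ultimately obtain w0 where w0: "w0 \<in> P" "\<And>w. w \<in> P \<Longrightarrow> norm (pt c (of_real e0) w0) \<le> norm (pt c (of_real e0) w)"
    using continuous_attains_inf[OF cP] by metis
  define m where "m = norm (pt c (of_real e0) w0)"
  have m: "m > 0" using nzP[OF w0(1)] by (simp add: m_def)
  define S where "S = box (Complex (l - 1) (-2)) (Complex (r + 1) 2)"
  have S: "open S" "connected S" "bounded S" "cbox a b \<subseteq> S" "P \<subseteq> S"
    using h lr unfolding S_def P a_def b_def
    by (auto simp: in_cbox_complex_iff in_box_complex_iff intro!: convex_connected)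
  have out: "winding_number (rectpath a b) z = 0" if "z \<notin> S" for z
    by (rule winding_number_rectpath_outside) (use ab S that in auto)
  define Zb where "Zb e = {p \<in> box a b. pt c (of_real e) p = 0}" for e
  have nn: "zorder (pt c (of_real e)) w \<ge> 0" if "e > 0" for e w using zorder_pt that by blast
  have zc: "int (zcount e {l..r}) = (\<Sum>p\<in>of_real ` {v. v \<in> {l..r} \<and> ptr c e v = 0}. zorder (pt c (of_real e)) p)"
    if "e > 0" for e
    unfolding zcount_def by (subst sum.reindex) (auto simp: inj_on_def o_def nn[OF that] intro!: sum.cong)
  have "\<forall>\<^sub>F e in at e0. \<forall>w\<in>P. norm (pt c (of_real e) w - pt c (of_real e0) w) < m"
    by (rule pt_close[OF e0 cP m])
  moreover have "\<forall>\<^sub>F e in at e0. e > 0" using e0 order_tendstoD(1)[OF tendsto_ident_at] by blast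
  ultimately show ?thesis
  proof eventually_elim
    case (elim e)
    have nzP': "pt c (of_real e) w \<noteq> 0" if "w \<in> P" for w
      using elim(1) w0(2)[OF that] that by (auto simp: m_def)
    note W0 = winding_sum_rectpath[OF e0 ab S(3,4) nzP[unfolded P_def]]
    note W1 = winding_sum_rectpath[OF elim(2) ab S(3,4) nzP'[unfolded P_def]]
    have "(\<Sum>p\<in>{p\<in>S. pt c (of_real e0) p + (pt c (of_real e) p - pt c (of_real e0) p) = 0}.
             winding_number (rectpath a b) p *
               of_int (zorder (\<lambda>p. pt c (of_real e0) p + (pt c (of_real e) p - pt c (of_real e0) p)) p))
        = (\<Sum>p\<in>{p\<in>S. pt c (of_real e0) p = 0}. winding_number (rectpath a b) p * of_int (zorder (pt c (of_real e0)) p))"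
    proof (rule Rouche_theorem[OF S(1,2)])
      show "\<forall>z\<in>path_image (rectpath a b). cmod (pt c (of_real e) z - pt c (of_real e0) z) < cmod (pt c (of_real e0) z)"
        using elim(1) w0(2) unfolding P_def m_def by force
    qed (use W0(2) W1(2) S out e0 elim(2) in \<open>auto simp: P_def intro!: pt_holo holomorphic_on_diff\<close>)
    hence R: "(\<Sum>p\<in>{p\<in>S. pt c (of_real e) p = 0}. winding_number (rectpath a b) p * of_int (zorder (pt c (of_real e)) p))
        = (\<Sum>p\<in>{p\<in>S. pt c (of_real e0) p = 0}. winding_number (rectpath a b) p * of_int (zorder (pt c (of_real e0)) p))"
      by simp
    have "(of_int (\<Sum>p\<in>Zb e. zorder (pt c (of_real e)) p) :: complex) = of_int (\<Sum>p\<in>Zb e0. zorder (pt c (of_real e0)) p)"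
      unfolding Zb_def using W0(1) W1(1) R by metis
    hence eq: "(\<Sum>p\<in>Zb e. zorder (pt c (of_real e)) p) = (\<Sum>p\<in>Zb e0. zorder (pt c (of_real e0)) p)"
      by (simp only: of_int_eq_iff)
    have sub: "of_real ` {v. v \<in> {l..r} \<and> ptr c e v = 0} \<subseteq> Zb e"
    proof clarify
      fix v assume v: "v \<in> {l..r}" "ptr c e v = 0"
      hence "pt c (of_real e) (of_real v) = 0" using elim by (simp add: pt_of_real)
      moreover from this have "of_real v \<notin> P" using nzP' by blast
      hence "v \<noteq> l" "v \<noteq> r" using h unfolding P by auto
      ultimately show "of_real v \<in> Zb e" using v h by (auto simp: Zb_def a_def b_def in_box_complex_iff)
    qed
    have eq0: "of_real ` {v. v \<in> {l..r} \<and> ptr c e0 v = 0} = Zb e0"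
    proof (intro equalityI subsetI)
      fix p :: complex assume "p \<in> of_real ` {v. v \<in> {l..r} \<and> ptr c e0 v = 0}"
      then obtain v where v: "v \<in> {l..r}" "ptr c e0 v = 0" "p = of_real v" by blast
      hence "v \<noteq> l" "v \<noteq> r" using nzl nzr by auto
      thus "p \<in> Zb e0" using v h e0 by (auto simp: Zb_def a_def b_def in_box_complex_iff pt_of_real)
    next
      fix p :: complex assume p: "p \<in> Zb e0"
      hence "p \<in> K" "\<bar>Im p\<bar> \<le> h" using h
        by (auto simp: Zb_def a_def b_def K_def in_box_complex_iff in_cbox_complex_iff)
      hence "Im p = 0" using Im0 p by (auto simp: Zb_def)
      hence pr: "p = of_real (Re p)" by (simp add: complex_eq_iff)
      hence "ptr c e0 (Re p) = 0" using p pt_of_real[OF e0, of "Re p"] by (auto simp: Zb_def)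
      moreover have "Re p \<in> {l..r}" using p by (auto simp: Zb_def a_def b_def in_box_complex_iff)
      ultimately show "p \<in> of_real ` {v. v \<in> {l..r} \<and> ptr c e0 v = 0}" using pr by blast
    qed
    have fin: "finite (Zb e)"
      by (rule rev_finite_subset[OF W1(2)]) (use S(4) box_subset_cbox in \<open>auto simp: Zb_def\<close>)
    have "int (zcount e {l..r}) \<le> (\<Sum>p\<in>Zb e. zorder (pt c (of_real e)) p)"
      unfolding zc[OF elim(2)] by (rule sum_mono2[OF fin sub]) (use nn elim(2) in auto)
    also have "\<dots> = int (zcount e0 {l..r})" unfolding eq zc[OF e0] eq0 ..
    finally show ?case by simp
  qed
qed

section \<open>Taylor coefficients along the curve \<open>(e + s^2, v + s y)\<close>\<close>

lemma deriv_partial_w: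
  "(deriv ^^ k) (\<lambda>w. \<Sum>j<N. ptt c j e w) = (\<lambda>w. \<Sum>j<N. of_nat j ^ k * ptt c j e w)"
proof (induction k)
  case (Suc k)
  have "((\<lambda>w. \<Sum>j<N. of_nat j ^ k * ptt c j e w) has_field_derivative (\<Sum>j<N. of_nat j ^ Suc k * ptt c j e w)) (at w)" for w
    unfolding ptt_def by (auto intro!: derivative_eq_intros sum.cong)
  thus ?case by (simp add: Suc.IH fun_eq_iff DERIV_imp_deriv)
qed simp

text \<open>Each differentiation in \<open>s\<close> multiplies a term by \<open>j\<close> and
  raises the Hermite index by one: the chain rule yields
  \<open>y' * he k y' - k * he (k - 1) y'\<close> with \<open>y' = y - j s\<close>, which is the
  Hermite recurrence.\<close>

lemma deriv_partial_s:
  "(deriv ^^ k) (\<lambda>s. \<Sum>j<N. ptt c j (e + s^2) (v + s * y)) =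
   (\<lambda>s. \<Sum>j<N. of_nat j ^ k * he k (y - of_nat j * s) * ptt c j (e + s^2) (v + s * y))"
proof (induction k)
  case (Suc k)
  have "((\<lambda>s. of_nat j ^ k * he k (y - of_nat j * s) * ptt c j (e + s^2) (v + s * y)) has_field_derivative
         of_nat j ^ Suc k * he (Suc k) (y - of_nat j * s) * ptt c j (e + s^2) (v + s * y)) (at s)" for s j
    unfolding ptt_def he_Suc[of k] by (auto intro!: derivative_eq_intros simp: algebra_simps power2_eq_square)
  hence "((\<lambda>s. \<Sum>j<N. of_nat j ^ k * he k (y - of_nat j * s) * ptt c j (e + s^2) (v + s * y)) has_field_derivative
         (\<Sum>j<N. of_nat j ^ Suc k * he (Suc k) (y - of_nat j * s) * ptt c j (e + s^2) (v + s * y))) (at s)" for s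
    by (intro DERIV_sum) auto
  thus ?case by (simp add: Suc.IH fun_eq_iff DERIV_imp_deriv del: he.simps)
qed simp

lemma moment_tendsto:
  assumes e: "e > 0"
  shows "(\<lambda>N. \<Sum>j<N. of_nat j ^ k * ptt c j (of_real e) w) \<longlonglongrightarrow> (deriv ^^ k) (pt c (of_real e)) w"
proof -
  have "uniform_limit (ball w 1) (\<lambda>N w. \<Sum>j<N. ptt c j (of_real e) w) (pt c (of_real e)) sequentially"
  proof (rule pt_uniform[of e _ "\<lambda>_. of_real e" "\<lambda>w. w" "Re w + 1"])
    fix s assume "s \<in> ball w 1"
    thus "Re s \<le> Re w + 1" using abs_Re_le_cmod[of "s - w"] by (auto simp: dist_norm norm_minus_commute)
  qed (use e in auto)
  hence "(\<lambda>N. (deriv ^^ k) (\<lambda>w. \<Sum>j<N. ptt c j (of_real e) w) w) \<longlonglongrightarrow> (deriv ^^ k) (pt c (of_real e)) w"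
    by (rule higher_deriv_complex_uniform_limit)
       (auto simp: ptt_def intro!: always_eventually holomorphic_intros)
  thus ?thesis by (simp add: deriv_partial_w)
qed

lemma ptt_of_real: "ptt c j (of_real e) (of_real v) = of_real (c j * exp (real j * v - e * (real j)^2 / 2))"
  by (simp add: ptt_def exp_of_real[symmetric])

lemma moment_real: "e > 0 \<Longrightarrow> (deriv ^^ k) (pt c (of_real e)) (of_real v) \<in> \<real>"
proof (rule Lim_in_closed_set[OF closed_complex_Reals _ _ moment_tendsto])
  show "\<forall>\<^sub>F N in sequentially. (\<Sum>j<N. of_nat j ^ k * ptt c j (of_real e) (of_real v)) \<in> \<real>"
    by (auto simp: ptt_of_real intro!: always_eventually sum_in_Reals)
qed auto

text \<open>At \<open>s = 0\<close> the Hermite factor no longer depends on \<open>j\<close> and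
  leaves the sum. What remains is the derivative in \<open>w\<close>, since both sides are limits of
  the same finite sums.\<close>

lemma deriv_scaled:
  assumes e: "e > 0"
  shows "(deriv ^^ k) (\<lambda>s. pt c (of_real e + s^2) (of_real v + s * of_real y)) 0 =
         of_real (he k y) * (deriv ^^ k) (pt c (of_real e)) (of_real v)"
proof -
  \<comment> \<open>For \<open>|s| < sqrt (e/2)\<close> the real part of \<open>e + s^2\<close>
    stays above \<open>e/2\<close>, as uniform convergence requires.\<close>
  define \<rho> where "\<rho> = sqrt (e/2)"
  have rho: "\<rho> > 0" "\<rho>^2 = e/2" using e by (auto simp: \<rho>_def)
  have "uniform_limit (ball 0 \<rho>) (\<lambda>N s. \<Sum>j<N. ptt c j (of_real e + s^2) (of_real v + s * of_real y))
      (\<lambda>s. pt c (of_real e + s^2) (of_real v + s * of_real y)) sequentially"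
  proof (rule pt_uniform[of "e/2" _ _ _ "v + \<rho> * \<bar>y\<bar>"])
    fix s :: complex assume s: "s \<in> ball 0 \<rho>"
    hence "norm (s^2) \<le> \<rho>^2" by (auto simp: norm_power intro!: power_mono)
    thus "e/2 \<le> Re (of_real e + s^2)" using abs_Re_le_cmod[of "s^2"] rho by auto
    have "Re s * y \<le> \<bar>Re s\<bar> * \<bar>y\<bar>" by (simp flip: abs_mult)
    also have "\<dots> \<le> \<rho> * \<bar>y\<bar>" using s abs_Re_le_cmod[of s] by (intro mult_right_mono) auto
    finally show "Re (of_real v + s * of_real y) \<le> v + \<rho> * \<bar>y\<bar>" by simp
  qed (use e in auto)
  hence "(\<lambda>N. (deriv ^^ k) (\<lambda>s. \<Sum>j<N. ptt c j (of_real e + s^2) (of_real v + s * of_real y)) 0)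
     \<longlonglongrightarrow> (deriv ^^ k) (\<lambda>s. pt c (of_real e + s^2) (of_real v + s * of_real y)) 0"
    by (rule higher_deriv_complex_uniform_limit)
       (use rho in \<open>auto simp: ptt_def intro!: always_eventually holomorphic_intros\<close>)
  moreover have "(\<lambda>N. (deriv ^^ k) (\<lambda>s. \<Sum>j<N. ptt c j (of_real e + s^2) (of_real v + s * of_real y)) 0)
     = (\<lambda>N. of_real (he k y) * (\<Sum>j<N. of_nat j ^ k * ptt c j (of_real e) (of_real v)))"
    by (simp add: deriv_partial_s of_real_he sum_distrib_left mult_ac)
  ultimately have "(\<lambda>N. of_real (he k y) * (\<Sum>j<N. of_nat j ^ k * ptt c j (of_real e) (of_real v)))
     \<longlonglongrightarrow> (deriv ^^ k) (\<lambda>s. pt c (of_real e + s^2) (of_real v + s * of_real y)) 0" by simp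
  moreover have "(\<lambda>N. of_real (he k y) * (\<Sum>j<N. of_nat j ^ k * ptt c j (of_real e) (of_real v)))
     \<longlonglongrightarrow> of_real (he k y) * (deriv ^^ k) (pt c (of_real e)) (of_real v)"
    by (intro tendsto_mult_left moment_tendsto e)
  ultimately show ?thesis by (rule LIMSEQ_unique)
qed

lemma higher_deriv_zorder:
  assumes e: "e > 0" and m: "int m = zorder (pt c (of_real e)) w"
  shows "k < m \<Longrightarrow> (deriv ^^ k) (pt c (of_real e)) w = 0" "(deriv ^^ m) (pt c (of_real e)) w \<noteq> 0"
proof -
  let ?f = "pt c (of_real e)" and ?F = "fps_expansion (pt c (of_real e)) w"
  have an: "?f analytic_on {w}" by (rule pt_analytic) (use e in simp)
  have F: "(\<lambda>z. ?f (w + z)) has_fps_expansion ?F" by (rule analytic_at_imp_has_fps_expansion[OF an])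
  have nz: "?F \<noteq> 0"
  proof
    assume "?F = 0"
    hence "\<forall>k. (deriv ^^ k) ?f w = 0" by (auto simp: fps_expansion_def fps_eq_iff)
    hence "?f z = 0" for z
      using holomorphic_fun_eq_0_on_connected[of ?f UNIV w z] pt_holo[of "of_real e" UNIV] e
      by (auto simp: connected_UNIV)
    thus False using pt_nonzero_left[OF e] by blast
  qed
  have sd: "subdegree ?F = m" using has_fps_expansion_zorder[OF F nz] m by simp
  have nth: "fps_nth ?F k = (deriv ^^ k) ?f w / fact k" for k by (simp add: fps_expansion_def)
  show "(deriv ^^ k) ?f w = 0" if "k < m" using nth_less_subdegree_zero[of k ?F] that nth sd by simp
  show "(deriv ^^ m) ?f w \<noteq> 0" using nth_subdegree_nonzero[OF nz] nth sd by simp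
qed

text \<open>Hermite polynomials describe how a zero of order \<open>m\<close> splits into \<open>m\<close> real zeros backwards
  in time: in the variables \<open>e + s\<^sup>2, v + s y\<close> the function is \<open>s\<^sup>m He\<^sub>m(y)\<close> to leading order.\<close>
lemma scaled_limit:
  assumes e: "e > 0" and m: "int m = zorder (pt c (of_real e)) (of_real v)"
  shows "((\<lambda>s. ptr c (e + s^2) (v + s * y) / s^m) \<longlongrightarrow>
            he m y * Re ((deriv ^^ m) (pt c (of_real e)) (of_real v)) / fact m) (at_right 0)"
proof -
  define F where "F = (\<lambda>s. pt c (of_real e + s^2) (of_real v + s * of_real y))"
  define \<rho> where "\<rho> = sqrt e"
  have rho: "\<rho> > 0" "\<rho>^2 = e" using e by (auto simp: \<rho>_def)
  have holo: "F holomorphic_on ball 0 \<rho>"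
    unfolding F_def
  proof (rule pt_holo_comp)
    fix s :: complex assume s: "s \<in> ball 0 \<rho>"
    hence "norm (s^2) < \<rho>^2" by (auto simp: norm_power intro!: power_strict_mono)
    thus "0 < Re (of_real e + s^2)" using abs_Re_le_cmod[of "s^2"] rho by auto
  qed (auto intro!: holomorphic_intros)
  define a where "a k = (deriv ^^ k) F 0 / fact k" for k
  have a: "a k = of_real (he k y) * (deriv ^^ k) (pt c (of_real e)) (of_real v) / fact k" for k
    unfolding a_def F_def deriv_scaled[OF e] ..
  have a0: "a k = 0" if "k < m" for k using higher_deriv_zorder(1)[OF e m that] by (simp add: a)
  define G where "G s = (if s = 0 then a m else F s / s^m)" for s
  have "(\<lambda>n. a (n + m) * s^n) sums G s" if s: "norm s < \<rho>" for s
  proof (cases "s = 0")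
    case True thus ?thesis using powser_sums_zero[of "\<lambda>n. a (n + m)"] by (simp add: G_def)
  next
    case False
    have "(\<lambda>n. a n * s^n) sums F s"
      using holomorphic_power_series[OF holo, of s] s by (simp add: a_def)
    hence "(\<lambda>n. a (n + m) * s^(n + m)) sums (F s - (\<Sum>i<m. a i * s^i))"
      by (rule sums_split_initial_segment)
    hence "(\<lambda>n. a (n + m) * s^(n + m)) sums F s" using a0 by simp
    from sums_divide[OF this, of "s^m"] show ?thesis using False by (simp add: G_def power_add)
  qed
  hence "(G \<longlongrightarrow> a (0 + m)) (at 0)" by (rule powser_limit_0[OF rho(1)])
  hence lim: "(G \<longlongrightarrow> a m) (at 0)" by simp
  have "filterlim complex_of_real (at 0) (at_right 0)"
    by (auto simp: filterlim_at eventually_at_right_field intro!: tendsto_eq_intros exI[of _ 1])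
  from filterlim_compose[OF lim this]
  have "((\<lambda>s. Re (G (of_real s))) \<longlongrightarrow> Re (a m)) (at_right 0)" by (rule tendsto_Re)
  moreover have "\<forall>\<^sub>F s in at_right 0. Re (G (of_real s)) = ptr c (e + s^2) (v + s * y) / s^m"
  proof -
    have "Re (G (of_real s)) = ptr c (e + s^2) (v + s * y) / s^m" if "s > 0" for s
    proof -
      have "F (of_real s) = pt c (of_real (e + s^2)) (of_real (v + s * y))" by (simp add: F_def)
      also have "\<dots> = of_real (ptr c (e + s^2) (v + s * y))" by (rule pt_of_real) (use e that in \<open>simp add: add_pos_pos\<close>)
      finally show ?thesis using that by (simp add: G_def flip: of_real_power of_real_divide)
    qed
    thus ?thesis by (auto simp: eventually_at_right_field intro!: exI[of _ 1])
  qed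
  ultimately have "((\<lambda>s. ptr c (e + s^2) (v + s * y) / s^m) \<longlongrightarrow> Re (a m)) (at_right 0)"
    by (rule Lim_transform_eventually)
  moreover have "Re (a m) = he m y * Re ((deriv ^^ m) (pt c (of_real e)) (of_real v)) / fact m"
  proof -
    define r where "r = he m y / fact m"
    have "a m = of_real r * (deriv ^^ m) (pt c (of_real e)) (of_real v)" by (simp add: a r_def)
    hence "Re (a m) = r * Re ((deriv ^^ m) (pt c (of_real e)) (of_real v))" by simp
    thus ?thesis by (simp add: r_def)
  qed
  ultimately show ?thesis by simp
qed

text \<open>Let \<open>y\<close> be alternation points of the Hermite polynomial of degree
  \<open>m\<close>. By \<open>scaled_limit\<close> the function at time \<open>e + s^2\<close>
  alternates in sign at the points \<open>v + s * y i\<close> once \<open>s\<close> is small, which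
  forces \<open>m\<close> zeros between them.\<close>

lemma zero_splits:
  assumes e: "e > 0" and m: "int m = zorder (pt c (of_real e)) (of_real v)" and d: "d > 0"
  shows "\<forall>\<^sub>F e' in at_right e. \<exists>S. S \<subseteq> {v - d<..<v + d} \<and> finite S \<and> card S = m \<and> (\<forall>x\<in>S. ptr c e' x = 0)"
proof -
  obtain y where y: "\<And>i. i < m \<Longrightarrow> y i < y (Suc i)" "\<And>i. i \<le> m \<Longrightarrow> (-1)^(m+i) * he m (y i) > (0::real)"
    using he_alternates by blast
  define M where "M = Re ((deriv ^^ m) (pt c (of_real e)) (of_real v))"
  have "M \<noteq> 0"
    using higher_deriv_zorder(2)[OF e m] moment_real[OF e, of m v] complex_is_Real_iff
    by (auto simp: M_def complex_eq_iff)
  \<comment> \<open>Normalises the alternation to start with a positive value at \<open>y 0\<close>;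
    \<open>M\<close>, the first nonvanishing derivative, is real because all finite sums
    are.\<close>
  define sg where "sg = (-1)^m * M"
  have ev: "\<forall>\<^sub>F s in at_right 0. (-1)^i * sg * ptr c (e + s^2) (v + s * y i) > 0 \<and> \<bar>s * y i\<bar> < d" if i: "i \<le> m" for i
  proof -
    have lim: "((\<lambda>s. (-1)^i * sg * (ptr c (e + s^2) (v + s * y i) / s^m)) \<longlongrightarrow> (-1)^i * sg * (he m (y i) * M / fact m)) (at_right 0)"
      unfolding M_def by (intro tendsto_mult_left scaled_limit e m)
    have eq: "(-1)^i * sg * (he m (y i) * M / fact m) = ((-1)^(m+i) * he m (y i)) * (M^2 / fact m)"
      by (simp add: sg_def power_add power2_eq_square)
    have "0 < (-1)^i * sg * (he m (y i) * M / fact m)"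
      unfolding eq by (rule mult_pos_pos[OF y(2)[OF i]]) (use \<open>M \<noteq> 0\<close> in simp)
    with lim have "\<forall>\<^sub>F s in at_right 0. 0 < (-1)^i * sg * (ptr c (e + s^2) (v + s * y i) / s^m)"
      by (rule order_tendstoD(1))
    moreover have "((\<lambda>s. \<bar>s * y i\<bar>) \<longlongrightarrow> \<bar>0 * y i\<bar>) (at_right 0)" by (intro tendsto_intros)
    hence "\<forall>\<^sub>F s in at_right 0. \<bar>s * y i\<bar> < d" by (rule order_tendstoD(2)) (use d in simp)
    moreover have "\<forall>\<^sub>F s in at_right (0::real). s > 0" by (simp add: eventually_at_right_less)
    ultimately show ?thesis
    proof eventually_elim
      case (elim s)
      have "0 < ((-1)^i * sg * ptr c (e + s^2) (v + s * y i)) / s^m"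
        using elim(1) by (simp only: times_divide_eq_right)
      moreover have "s^m > 0" using elim by simp
      ultimately have "0 < (-1)^i * sg * ptr c (e + s^2) (v + s * y i)"
        by (metis zero_less_divide_iff less_asym)
      thus ?case using elim by blast
    qed
  qed
  have "\<forall>\<^sub>F s in at_right 0. \<forall>i\<in>{..m}. (-1)^i * sg * ptr c (e + s^2) (v + s * y i) > 0 \<and> \<bar>s * y i\<bar> < d"
    by (intro eventually_ball_finite) (use ev in auto)
  moreover have "\<forall>\<^sub>F s in at_right (0::real). s > 0" by (simp add: eventually_at_right_less)
  ultimately have "\<forall>\<^sub>F s in at_right 0. \<exists>S. S \<subseteq> {v - d<..<v + d} \<and> finite S \<and> card S = m \<and> (\<forall>x\<in>S. ptr c (e + s^2) x = 0)"
  proof eventually_elim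
    case (elim s)
    have "\<exists>S. S \<subseteq> {v + s * y 0<..<v + s * y m} \<and> finite S \<and> card S = m \<and> (\<forall>x\<in>S. ptr c (e + s^2) x = 0)"
    proof (rule alternation_zeros[of "\<lambda>i. v + s * y i" m _ sg])
      show "continuous_on {v + s * y 0..v + s * y m} (ptr c (e + s^2))"
        by (intro continuous_intros) (use e elim in \<open>simp add: add_pos_pos\<close>)
    qed (use elim y in auto)
    moreover have "{v + s * y 0<..<v + s * y m} \<subseteq> {v - d<..<v + d}"
    proof
      fix x assume x: "x \<in> {v + s * y 0<..<v + s * y m}"
      have "\<bar>s * y 0\<bar> < d" "\<bar>s * y m\<bar> < d" using elim by auto
      thus "x \<in> {v - d<..<v + d}" using x by auto
    qed
    ultimately show ?case by (metis subset_trans)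
  qed
  moreover have "filterlim (\<lambda>e'. sqrt (e' - e)) (at_right 0) (at_right e)"
  proof -
    have "((\<lambda>e'. sqrt (e' - e)) \<longlongrightarrow> sqrt (e - e)) (at_right e)" by (intro tendsto_intros)
    moreover have "\<forall>\<^sub>F e' in at_right e. e < e'" by (simp add: eventually_at_right_less)
    hence "\<forall>\<^sub>F e' in at_right e. sqrt (e' - e) \<in> {0<..} \<and> sqrt (e' - e) \<noteq> 0"
      by eventually_elim auto
    ultimately show ?thesis by (simp add: filterlim_at)
  qed
  ultimately have "\<forall>\<^sub>F e' in at_right e. \<exists>S. S \<subseteq> {v - d<..<v + d} \<and> finite S \<and> card S = m \<and>
      (\<forall>x\<in>S. ptr c (e + (sqrt (e' - e))^2) x = 0)"
    by (rule eventually_compose_filterlim)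
  moreover have "\<forall>\<^sub>F e' in at_right e. e' > e" by (simp add: eventually_at_right_less)
  ultimately show ?thesis by eventually_elim auto
qed

end

section \<open>Monotonicity of the number of zeros\<close>

lemma finite_pos_lower_bound:
  assumes "finite D" "\<And>x. x \<in> D \<Longrightarrow> x > (0::real)"
  shows "\<exists>d>0. \<forall>x\<in>D. d \<le> x"
  using assms by (intro exI[of _ "Min (insert 1 D)"]) (auto simp: Min_gr_iff)

text \<open>Consider the supremum of the times in \<open>{e1..e2}\<close> with value at least
  \<open>Z e1\<close>. Upper semicontinuity puts the supremum itself into this set, and lower
  semicontinuity from the right pushes it further unless it is \<open>e2\<close>.\<close>

lemma nat_fun_mono_of_semicontinuous:
  fixes Z :: "real \<Rightarrow> nat"
  assumes usc: "\<And>e. e > 0 \<Longrightarrow> \<forall>\<^sub>F x in at e. Z x \<le> Z e"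
    and lsc: "\<And>e. e > 0 \<Longrightarrow> \<forall>\<^sub>F x in at_right e. Z e \<le> Z x"
    and e: "0 < e1" "e1 \<le> e2"
  shows "Z e1 \<le> Z e2"
proof -
  define S where "S = {e \<in> {e1..e2}. Z e1 \<le> Z e}"
  have S: "e1 \<in> S" "S \<subseteq> {e1..e2}" using e by (auto simp: S_def)
  have bdd: "bdd_above S" using S(2) by (meson bdd_above_Icc bdd_above_mono)
  define t where "t = Sup S"
  have t: "e1 \<le> t" "t \<le> e2" using S bdd unfolding t_def
    by (auto intro!: cSup_upper cSup_least)
  have "t \<in> S"
  proof (rule ccontr)
    assume nt: "t \<notin> S"
    obtain d where d: "d > 0" "\<And>x. x \<noteq> t \<Longrightarrow> dist x t < d \<Longrightarrow> Z x \<le> Z t"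
      using usc[of t] t e by (auto simp: eventually_at)
    have "t - d < Sup S" using d(1) by (simp add: t_def)
    then obtain x where x: "x \<in> S" "t - d < x" using less_cSup_iff[of S "t - d"] S bdd by auto
    have "x \<le> t" unfolding t_def using x bdd by (intro cSup_upper)
    hence "x \<noteq> t" "dist x t < d" using x nt by (auto simp: dist_real_def)
    hence "Z x \<le> Z t" using d by blast
    thus False using x nt t by (auto simp: S_def)
  qed
  show ?thesis
  proof (cases "t = e2")
    case True thus ?thesis using \<open>t \<in> S\<close> by (simp add: S_def)
  next
    case False
    hence lt: "t < e2" using t by simp
    have "\<forall>\<^sub>F x in at_right t. Z t \<le> Z x \<and> x \<in> {t<..<e2}"
      using lsc[of t] t e eventually_at_right_real[OF lt] by (intro eventually_conj) auto
    then obtain x where "Z t \<le> Z x" "t < x" "x < e2"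
      using eventually_happens'[of "at_right t"] by force
    hence "x \<in> S" using \<open>t \<in> S\<close> t by (auto simp: S_def)
    hence "x \<le> t" unfolding t_def using bdd by (rule cSup_upper)
    thus ?thesis using \<open>t < x\<close> by simp
  qed
qed

context sign_seq begin

lemma zcount_mono:
  assumes "e > 0" "A \<subseteq> B" "B \<subseteq> {l..r}"
  shows "zcount e A \<le> zcount e B"
  unfolding zcount_def
proof (rule sum_mono2)
  show "finite {v. v \<in> B \<and> ptr c e v = 0}"
    by (rule finite_subset[OF _ finite_zeros_ptr[OF assms(1), of l r]]) (use assms in auto)
qed (use assms in auto)

lemma zcount_cong: "(\<And>v. ptr c e v = 0 \<Longrightarrow> v \<in> A \<longleftrightarrow> v \<in> B) \<Longrightarrow> zcount e A = zcount e B"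
  unfolding zcount_def by (rule sum.cong) auto

lemma zcount_Un_le:
  assumes "e > 0" "A \<subseteq> {l..r}" "B \<subseteq> {l..r}"
  shows "zcount e (A \<union> B) \<le> zcount e A + zcount e B"
proof -
  have fin: "finite {v. v \<in> X \<and> ptr c e v = 0}" if "X \<subseteq> {l..r}" for X
    by (rule finite_subset[OF _ finite_zeros_ptr[OF assms(1), of l r]]) (use that in auto)
  have "{v. v \<in> A \<union> B \<and> ptr c e v = 0} = {v. v \<in> A \<and> ptr c e v = 0} \<union> {v. v \<in> B \<and> ptr c e v = 0}" by auto
  thus ?thesis unfolding zcount_def using fin[OF assms(2)] fin[OF assms(3)]
    by (simp add: sum_Un_nat)
qed

lemma zorder_ge_1:
  "e > 0 \<Longrightarrow> ptr c e v = 0 \<Longrightarrow> nat (zorder (pt c (of_real e)) (of_real v)) \<ge> 1"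
  using zorder_pt(2)[of e "of_real v"] pt_of_real[of e v] by simp

lemma card_le_zcount:
  assumes "e > 0" "A \<subseteq> {l..r}"
  shows "card {v \<in> A. ptr c e v = 0} \<le> zcount e A"
proof -
  have fin: "finite {v. v \<in> A \<and> ptr c e v = 0}"
    by (rule finite_subset[OF _ finite_zeros_ptr[OF assms(1), of l r]]) (use assms in auto)
  have "card {v \<in> A. ptr c e v = 0} = (\<Sum>v\<in>{v. v \<in> A \<and> ptr c e v = 0}. 1)" by simp
  also have "\<dots> \<le> zcount e A" unfolding zcount_def
    by (rule sum_mono) (use zorder_ge_1[OF assms(1)] in auto)
  finally show ?thesis .
qed

text \<open>A zero of order \<open>m\<close> turns at once into \<open>m\<close> distinct zeros, so
  the bound holds even for the number of distinct zeros just after \<open>e0\<close>.\<close>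

lemma zcount_lsc:
  assumes e0: "e0 > 0" and nzl: "ptr c e0 l \<noteq> 0" and nzr: "ptr c e0 r \<noteq> 0"
  shows "\<forall>\<^sub>F e in at_right e0. zcount e0 {l..r} \<le> card {v \<in> {l..r}. ptr c e v = 0}"
proof -
  define V where "V = {v \<in> {l..r}. ptr c e0 v = 0}"
  have finV: "finite V" unfolding V_def by (rule finite_zeros_ptr[OF e0])
  have V: "l < v" "v < r" if "v \<in> V" for v using that nzl nzr by (auto simp: V_def le_less)
  \<comment> \<open>Distances to the two ends and half distances between zeros: a radius below all
    of them keeps the neighbourhoods inside the interval and disjoint.\<close>
  define D where "D = (\<lambda>v. v - l) ` V \<union> (\<lambda>v. r - v) ` V \<union> (\<lambda>(u,v). \<bar>u - v\<bar> / 2) ` {(u,v) \<in> V \<times> V. u \<noteq> v}"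
  have "finite D" unfolding D_def using finV
    by (auto intro!: finite_imageI intro: finite_subset[of _ "V \<times> V"])
  moreover have "x > 0" if "x \<in> D" for x using that V by (auto simp: D_def)
  ultimately obtain d where d: "d > 0" "\<And>x. x \<in> D \<Longrightarrow> d \<le> x" using finite_pos_lower_bound by metis
  have d1: "d \<le> v - l" "d \<le> r - v" if "v \<in> V" for v using d(2) that by (auto simp: D_def)
  have d2: "2 * d \<le> \<bar>u - v\<bar>" if "u \<in> V" "v \<in> V" "u \<noteq> v" for u v
    using d(2)[of "\<bar>u - v\<bar> / 2"] that by (force simp: D_def)
  define m where "m v = nat (zorder (pt c (of_real e0)) (of_real v))" for v :: real
  have mz: "int (m v) = zorder (pt c (of_real e0)) (of_real v)" for v
    using zorder_pt(1)[OF e0] by (simp add: m_def)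
  have "\<forall>\<^sub>F e in at_right e0. \<forall>v\<in>V. \<exists>S. S \<subseteq> {v - d<..<v + d} \<and> finite S \<and> card S = m v \<and> (\<forall>x\<in>S. ptr c e x = 0)"
    by (intro eventually_ball_finite finV ballI zero_splits e0 mz d(1))
  moreover have "\<forall>\<^sub>F e in at_right e0. e > e0" by (simp add: eventually_at_right_less)
  ultimately show ?thesis
  proof eventually_elim
    case (elim e)
    then obtain S where S: "\<And>v. v \<in> V \<Longrightarrow> S v \<subseteq> {v - d<..<v + d} \<and> finite (S v) \<and> card (S v) = m v \<and> (\<forall>x\<in>S v. ptr c e x = 0)"
      by metis
    have "zcount e0 {l..r} = (\<Sum>v\<in>V. card (S v))"
      unfolding zcount_def V_def by (rule sum.cong) (use S in \<open>auto simp: V_def m_def\<close>)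
    also have "\<dots> = card (\<Union>v\<in>V. S v)"
    proof (rule card_UN_disjoint[symmetric, OF finV])
      show "\<forall>u\<in>V. \<forall>v\<in>V. u \<noteq> v \<longrightarrow> S u \<inter> S v = {}"
      proof (intro ballI impI, rule ccontr)
        fix u v assume uv: "u \<in> V" "v \<in> V" "u \<noteq> v" "S u \<inter> S v \<noteq> {}"
        then obtain x where "x \<in> S u" "x \<in> S v" by blast
        hence "x \<in> {u - d<..<u + d}" "x \<in> {v - d<..<v + d}" using S uv by blast+
        thus False using d2[OF uv(1-3)] by auto
      qed
    qed (use S in auto)
    also have "\<dots> \<le> card {v \<in> {l..r}. ptr c e v = 0}"
    proof (rule card_mono[OF finite_zeros_ptr])
      show "e > 0" using elim e0 by simp
      show "(\<Union>v\<in>V. S v) \<subseteq> {v \<in> {l..r}. ptr c e v = 0}"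
      proof clarify
        fix v x assume "v \<in> V" "x \<in> S v"
        hence "x \<in> {v - d<..<v + d}" "ptr c e x = 0" using S by blast+
        thus "x \<in> {l..r} \<and> ptr c e x = 0" using d1[OF \<open>v \<in> V\<close>] by auto
      qed
    qed
    finally show ?case .
  qed
qed

lemma nonzero_nbhd:
  assumes "e > 0" "ptr c e v \<noteq> 0"
  shows "\<exists>d>0. \<forall>x. \<bar>x - v\<bar> \<le> d \<longrightarrow> ptr c e x \<noteq> 0"
proof -
  have "continuous_on UNIV (ptr c e)" by (intro continuous_intros) (use assms in auto)
  hence "isCont (ptr c e) v" by (simp add: continuous_on_eq_continuous_at)
  then obtain d where d: "d > 0" "\<And>x. dist x v < d \<Longrightarrow> ptr c e x \<noteq> 0"
    using continuous_at_avoid[of v "ptr c e" 0] assms by (auto simp: dist_commute)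
  show ?thesis using d by (intro exI[of _ "d/2"]) (auto simp: dist_real_def)
qed

end

text \<open>The ends move with \<open>e\<close> because the natural ends are grid points
  proportional to \<open>e\<close>. No zero crosses them, so the count changes only when zeros leave
  or reach the real axis inside the window.\<close>

locale zero_window = sign_seq +
  fixes l r :: "real \<Rightarrow> real"
  assumes cont_l: "continuous_on {0<..} l" and cont_r: "continuous_on {0<..} r"
    and lr: "e > 0 \<Longrightarrow> l e < r e"
    and nz_l: "e > 0 \<Longrightarrow> ptr c e (l e) \<noteq> 0" and nz_r: "e > 0 \<Longrightarrow> ptr c e (r e) \<noteq> 0"
begin

abbreviation Z :: "real \<Rightarrow> nat" where "Z e \<equiv> zcount e {l e..r e}"

text \<open>Shrinking or enlarging the window slightly does not change the count at time
  \<open>e\<close>. For nearby times the moving window lies between two fixed ones, to which the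
  semicontinuity results for fixed intervals apply.\<close>

lemma window_nbhd:
  assumes e: "e > 0"
  obtains d where "d > 0" "l e + d < r e - d"
    "zcount e {l e - d..r e + d} = Z e" "zcount e {l e + d..r e - d} = Z e"
    "\<forall>x. \<bar>x - l e\<bar> \<le> d \<longrightarrow> ptr c e x \<noteq> 0" "\<forall>x. \<bar>x - r e\<bar> \<le> d \<longrightarrow> ptr c e x \<noteq> 0"
    "\<forall>\<^sub>F x in at e. \<bar>l x - l e\<bar> < d \<and> \<bar>r x - r e\<bar> < d"
proof -
  obtain d1 where d1: "d1 > 0" "\<And>x. \<bar>x - l e\<bar> \<le> d1 \<Longrightarrow> ptr c e x \<noteq> 0"
    using nonzero_nbhd[OF e nz_l[OF e]] by blast
  obtain d2 where d2: "d2 > 0" "\<And>x. \<bar>x - r e\<bar> \<le> d2 \<Longrightarrow> ptr c e x \<noteq> 0"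
    using nonzero_nbhd[OF e nz_r[OF e]] by blast
  define d where "d = min (min d1 d2) ((r e - l e) / 3)"
  have d0: "d > 0" using d1 d2 lr[OF e] by (simp add: d_def)
  have "d \<le> (r e - l e) / 3" unfolding d_def by (rule min.cobounded2)
  hence d: "d > 0" "l e + d < r e - d" using d0 lr[OF e] by auto
  have n1: "ptr c e x \<noteq> 0" if "\<bar>x - l e\<bar> \<le> d" for x using d1 that by (auto simp: d_def)
  have n2: "ptr c e x \<noteq> 0" if "\<bar>x - r e\<bar> \<le> d" for x using d2 that by (auto simp: d_def)
  have "zcount e {l e - d..r e + d} = Z e" "zcount e {l e + d..r e - d} = Z e"
    by (rule zcount_cong; use n1 n2 d in \<open>force simp: abs_le_iff\<close>)+
  moreover have "\<forall>\<^sub>F x in at e. \<bar>l x - l e\<bar> < d \<and> \<bar>r x - r e\<bar> < d"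
  proof -
    have "(l \<longlongrightarrow> l e) (at e)" "(r \<longlongrightarrow> r e) (at e)"
      using cont_l cont_r e by (auto simp: continuous_on_eq_continuous_at isCont_def)
    thus ?thesis using d(1) by (intro eventually_conj) (auto simp: tendsto_iff dist_real_def)
  qed
  ultimately show ?thesis using d n1 n2 that by blast
qed

lemma Z_usc: assumes e: "e > 0" shows "\<forall>\<^sub>F x in at e. Z x \<le> Z e"
proof -
  obtain d where d: "d > 0" "l e + d < r e - d"
    "zcount e {l e - d..r e + d} = Z e" "zcount e {l e + d..r e - d} = Z e"
    "\<forall>x. \<bar>x - l e\<bar> \<le> d \<longrightarrow> ptr c e x \<noteq> 0" "\<forall>x. \<bar>x - r e\<bar> \<le> d \<longrightarrow> ptr c e x \<noteq> 0"
    "\<forall>\<^sub>F x in at e. \<bar>l x - l e\<bar> < d \<and> \<bar>r x - r e\<bar> < d"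
    by (rule window_nbhd[OF e])
  have "\<forall>\<^sub>F x in at e. zcount x {l e - d..r e + d} \<le> zcount e {l e - d..r e + d}"
    by (rule zcount_usc) (use d lr[OF e] e in auto)
  moreover have "\<forall>\<^sub>F x in at e. x > 0" using e order_tendstoD(1)[OF tendsto_ident_at] by blast
  ultimately show ?thesis using d(7)
  proof eventually_elim
    case (elim x)
    have "Z x \<le> zcount x {l e - d..r e + d}"
      by (rule zcount_mono[where l = "l e - d" and r = "r e + d"]) (use elim in auto)
    thus ?case using elim d(3) by simp
  qed
qed

lemma Z_lsc: assumes e: "e > 0" shows "\<forall>\<^sub>F x in at_right e. Z e \<le> card {v \<in> {l x..r x}. ptr c x v = 0}"
proof -
  obtain d where d: "d > 0" "l e + d < r e - d"
    "zcount e {l e - d..r e + d} = Z e" "zcount e {l e + d..r e - d} = Z e"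
    "\<forall>x. \<bar>x - l e\<bar> \<le> d \<longrightarrow> ptr c e x \<noteq> 0" "\<forall>x. \<bar>x - r e\<bar> \<le> d \<longrightarrow> ptr c e x \<noteq> 0"
    "\<forall>\<^sub>F x in at e. \<bar>l x - l e\<bar> < d \<and> \<bar>r x - r e\<bar> < d"
    by (rule window_nbhd[OF e])
  have "\<forall>\<^sub>F x in at_right e. zcount e {l e + d..r e - d} \<le> card {v \<in> {l e + d..r e - d}. ptr c x v = 0}"
    by (rule zcount_lsc) (use d e in auto)
  moreover have "\<forall>\<^sub>F x in at_right e. \<bar>l x - l e\<bar> < d \<and> \<bar>r x - r e\<bar> < d"
    using d(7) by (simp add: eventually_at_split)
  moreover have "\<forall>\<^sub>F x in at_right e. x > e" by (simp add: eventually_at_right_less)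
  ultimately show ?thesis
  proof eventually_elim
    case (elim x)
    have "card {v \<in> {l e + d..r e - d}. ptr c x v = 0} \<le> card {v \<in> {l x..r x}. ptr c x v = 0}"
      by (rule card_mono) (use elim e finite_zeros_ptr in auto)
    thus ?case using elim d(4) by simp
  qed
qed

lemma Z_mono: "0 < e1 \<Longrightarrow> e1 \<le> e2 \<Longrightarrow> Z e1 \<le> Z e2"
proof (rule nat_fun_mono_of_semicontinuous[of Z])
  fix e :: real assume e: "e > 0"
  show "\<forall>\<^sub>F x in at e. Z x \<le> Z e" by (rule Z_usc[OF e])
  have "\<forall>\<^sub>F x in at_right e. x > e" by (simp add: eventually_at_right_less)
  with Z_lsc[OF e] show "\<forall>\<^sub>F x in at_right e. Z e \<le> Z x"
  proof eventually_elim
    case (elim x)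
    have "card {v \<in> {l x..r x}. ptr c x v = 0} \<le> Z x"
      by (rule card_le_zcount[where l = "l x" and r = "r x"]) (use elim e in auto)
    thus ?case using elim by simp
  qed
qed

end

section \<open>The two-sided theta series\<close>

definition qp :: "real \<Rightarrow> nat \<Rightarrow> real" where "qp p n = (\<Prod>m<n. 1 - p ^ Suc m)"

lemma qp_Suc: "qp p (Suc n) = qp p n * (1 - p ^ Suc n)" by (simp add: qp_def)

lemma qp_0 [simp]: "qp p 0 = 1" by (simp add: qp_def)

lemma qp_pos: "0 < p \<Longrightarrow> p < 1 \<Longrightarrow> qp p n > 0"
  unfolding qp_def by (intro prod_pos) (simp add: power_Suc_less_one del: power_Suc)

lemma qp_antimono: 
  assumes "0 < p" "p < 1" "m \<le> n" 
  shows "qp p n \<le> qp p m"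
proof (rule lift_Suc_antimono_le[OF _ assms(3)])
  fix n
  have "qp p n * (1 - p ^ Suc n) \<le> qp p n * 1"
    using qp_pos[of p n] assms by (intro mult_left_mono) auto
  thus "qp p (Suc n) \<le> qp p n" by (simp add: qp_Suc)
qed

lemma prod_lessThan_add: "(\<Prod>k<m + n. f k) = (\<Prod>k<m. f k) * (\<Prod>k<n. f (m + k :: nat) :: real)"
  by (induction n) (simp_all add: mult_ac)

text \<open>Induction on \<open>N\<close> by the q-Pascal rule; the quotient of values of
  \<open>qp\<close> is the Gaussian binomial coefficient.\<close>

lemma q_binomial:
  fixes p x :: real
  assumes p: "0 < p" "p < 1"
  shows "(\<Prod>k<N. 1 + x * p^k) = (\<Sum>k\<le>N. p^(k choose 2) * (qp p N / (qp p k * qp p (N - k))) * x^k)"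
proof (induction N)
  case (Suc N)
  \<comment> \<open>Extended by 0 beyond \<open>N\<close>, so that after shifting the index both
    sums run over the same range.\<close>
  define B where "B N k = (if k \<le> N then qp p N / (qp p k * qp p (N - k)) else 0)" for N k
  have ne: "qp p n \<noteq> 0" for n using qp_pos[OF p, of n] by simp
  have rec: "B (Suc N) (Suc k) = B N (Suc k) + p^(N - k) * B N k" if kN: "k \<le> N" for k
  proof (cases "k = N")
    case True
    thus ?thesis using ne by (simp add: B_def)
  next
    case False
    then obtain d where d: "N = Suc (k + d)" using kN less_imp_Suc_add[of k N] by auto
    have "(1 - p ^ Suc d) + p ^ Suc d * (1 - p ^ Suc k) = 1 - p ^ Suc N"
      by (simp add: d algebra_simps power_add)
    moreover have "1 - p ^ Suc d \<noteq> 0" "1 - p ^ Suc k \<noteq> 0"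
      using p power_Suc_less_one[of p] by (auto simp del: power_Suc simp: less_le)
    moreover have "B (Suc N) (Suc k) = qp p N * (1 - p ^ Suc N) / (qp p k * (1 - p ^ Suc k) * (qp p d * (1 - p ^ Suc d)))"
      by (simp add: B_def d qp_Suc)
    moreover have "B N (Suc k) = qp p N / (qp p k * (1 - p ^ Suc k) * qp p d)" by (simp add: B_def d qp_Suc)
    moreover have "B N k = qp p N / (qp p k * (qp p d * (1 - p ^ Suc d)))" by (simp add: B_def d qp_Suc)
    moreover have "N - k = Suc d" by (simp add: d)
    moreover have "X * (a + g * b) / (u * b * (w * a)) = X / (u * b * w) + g * (X / (u * (w * a)))"
      if "a \<noteq> 0" "b \<noteq> 0" "u \<noteq> 0" "w \<noteq> 0" for X a g b u w :: real
      using that by (simp add: field_simps)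
    ultimately show ?thesis using ne[of k] ne[of d] by metis
  qed
  have "(\<Prod>k<Suc N. 1 + x * p^k) = (\<Sum>k\<le>N. p^(k choose 2) * B N k * x^k) * (1 + x * p^N)"
    using Suc.IH by (simp add: B_def)
  also have "\<dots> = (\<Sum>k\<le>N. p^(k choose 2) * B N k * x^k) + (\<Sum>k\<le>N. p^N * p^(k choose 2) * B N k * x^Suc k)"
    by (simp add: algebra_simps sum_distrib_left sum_distrib_right sum.distrib)
  also have "(\<Sum>k\<le>N. p^(k choose 2) * B N k * x^k) = 1 + (\<Sum>k\<le>N. p^(Suc k choose 2) * B N (Suc k) * x^Suc k)"
  proof -
    have "(\<Sum>k\<le>N. p^(k choose 2) * B N k * x^k) = (\<Sum>k\<le>Suc N. p^(k choose 2) * B N k * x^k)"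
      by (simp add: B_def)
    also have "\<dots> = p^(0 choose 2) * B N 0 * x^0 + (\<Sum>k\<le>N. p^(Suc k choose 2) * B N (Suc k) * x^Suc k)"
      by (rule sum.atMost_Suc_shift)
    finally show ?thesis using ne by (simp add: B_def binomial_eq_0)
  qed
  also have "1 + (\<Sum>k\<le>N. p^(Suc k choose 2) * B N (Suc k) * x^Suc k) + (\<Sum>k\<le>N. p^N * p^(k choose 2) * B N k * x^Suc k)
     = 1 + (\<Sum>k\<le>N. p^(Suc k choose 2) * B (Suc N) (Suc k) * x^Suc k)"
  proof -
    have "p^N * p^(k choose 2) = p^(Suc k choose 2) * p^(N - k)" if "k \<le> N" for k
      using that by (simp add: numeral_2_eq_2 add.commute flip: power_add)
    hence "p^(Suc k choose 2) * B N (Suc k) * x^Suc k + p^N * p^(k choose 2) * B N k * x^Suc k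
         = p^(Suc k choose 2) * B (Suc N) (Suc k) * x^Suc k" if "k \<le> N" for k
      using that unfolding rec[OF that] by (simp add: algebra_simps)
    thus ?thesis by (simp add: sum.distrib[symmetric] del: power_Suc)
  qed
  also have "\<dots> = p^(0 choose 2) * B (Suc N) 0 * x^0 + (\<Sum>k\<le>N. p^(Suc k choose 2) * B (Suc N) (Suc k) * x^Suc k)"
    using ne by (simp add: B_def binomial_eq_0)
  also have "\<dots> = (\<Sum>k\<le>Suc N. p^(k choose 2) * B (Suc N) k * x^k)"
    by (rule sum.atMost_Suc_shift[symmetric])
  finally show ?case by (simp add: B_def)
qed (simp add: binomial_eq_0)

definition alt :: "nat \<Rightarrow> real" where "alt j = (-1)^j"

interpretation alt: sign_seq alt by standard (simp add: alt_def)

text \<open>The theta series \<open>(-1)^j * exp (j v - e j^2 / 2)\<close> summed over all integers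
  \<open>j\<close>: the second summand collects the negative indices.\<close>

definition psi :: "real \<Rightarrow> real \<Rightarrow> real" where
  "psi e v = ptr alt e v - exp (- e/2 - v) * ptr alt e (- v - e)"

text \<open>The two \<open>v\<close>-dependent families of factors of Jacobi's triple product, cut
  off at \<open>n\<close>; the third family is \<open>qp (exp (-e))\<close>.\<close>

definition psi_prod :: "real \<Rightarrow> real \<Rightarrow> nat \<Rightarrow> real" where
  "psi_prod e v n = (\<Prod>m<n. (1 - exp (v - e * (real m + 1/2))) * (1 - exp (- v - e * (real m + 1/2))))"

lemma choose_2_real: "real (k choose 2) = real k * (real k - 1) / 2"
  by (induction k) (auto simp: numeral_2_eq_2 algebra_simps add_divide_distrib)

text \<open>The q-binomial theorem with \<open>2n\<close> factors, centred at the middle term.\<close>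
lemma psi_prod_finite:
  assumes e: "e > 0"
  shows "psi_prod e v n = (\<Sum>k\<le>2*n. qp (exp (-e)) (2*n) / (qp (exp (-e)) k * qp (exp (-e)) (2*n - k)) *
            ((-1)^(k+n) * exp ((real k - real n) * v - e * (real k - real n)^2 / 2)))"
proof -
  define p where "p = exp (-e)"
  define x where "x = - exp (v + e * (real n - 1/2))"
  have p: "0 < p" "p < 1" using e by (auto simp: p_def)
  have xp: "x * p^k = - exp (v + e * (real n - 1/2 - real k))" for k
    by (simp add: x_def p_def exp_of_nat_mult[symmetric] exp_add[symmetric] algebra_simps)
  have "(\<Prod>k<2*n. 1 + x * p^k) = (\<Prod>k<n. 1 + x * p^k) * (\<Prod>k<n. 1 + x * p^(n+k))"
    by (simp add: mult_2 prod_lessThan_add)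
  also have "(\<Prod>k<n. 1 + x * p^k) = (\<Prod>k<n. 1 + x * p^(n - Suc k))"
    by (rule prod.nat_diff_reindex[symmetric])
  also have "\<dots> = (\<Prod>m<n. - exp (v + e * (real m + 1/2)) * (1 - exp (- v - e * (real m + 1/2))))"
  proof (rule prod.cong)
    fix m assume "m \<in> {..<n}"
    hence "real n - 1/2 - real (n - Suc m) = real m + 1/2" by (simp add: of_nat_diff)
    hence 1: "x * p^(n - Suc m) = - exp (v + e * (real m + 1/2))" by (simp only: xp)
    have 2: "- v - e * (real m + 1/2) = - (v + e * (real m + 1/2))" by simp
    show "1 + x * p^(n - Suc m) = - exp (v + e * (real m + 1/2)) * (1 - exp (- v - e * (real m + 1/2)))"
      unfolding 1 2 exp_minus by (simp add: right_diff_distrib)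
  qed simp
  also have "\<dots> = (\<Prod>m<n. - exp (v + e * (real m + 1/2))) * (\<Prod>m<n. 1 - exp (- v - e * (real m + 1/2)))"
    by (rule prod.distrib)
  also have "(\<Prod>m<n. - exp (v + e * (real m + 1/2))) = (-1)^n * exp (n * v + e * (real n)^2 / 2)"
    by (induction n) (auto simp: algebra_simps power2_eq_square add_divide_distrib simp flip: exp_add)
  also have "(\<Prod>k<n. 1 + x * p^(n+k)) = (\<Prod>m<n. 1 - exp (v - e * (real m + 1/2)))"
    unfolding xp by (simp add: algebra_simps)
  finally have "(\<Prod>k<2*n. 1 + x * p^k) = (-1)^n * exp (n * v + e * (real n)^2 / 2) * psi_prod e v n"
    by (simp add: psi_prod_def prod.distrib mult_ac)
  hence F1: "(-1)^n * exp (- (n * v) - e * (real n)^2 / 2) * (\<Prod>k<2*n. 1 + x * p^k) = psi_prod e v n"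
  proof -
    define A where "A = real n * v + e * (real n)^2 / 2"
    have "(-1)^n * exp (- A) * ((-1)^n * exp A * P) = ((-1)^n * (-1)^n) * (exp (- A) * exp A) * P" for P :: real
      by (simp only: mult_ac)
    hence "(-1)^n * exp (- A) * ((-1)^n * exp A * P) = P" for P :: real
      by (simp add: exp_minus flip: power_mult_distrib)
    moreover have "- (real n * v) - e * (real n)^2 / 2 = - A" by (simp add: A_def)
    moreover have "(\<Prod>k<2*n. 1 + x * p^k) = (-1)^n * exp A * psi_prod e v n"
      unfolding A_def by fact
    ultimately show ?thesis by metis
  qed
  have R: "(-1)^n * exp (- (n * v) - e * (real n)^2 / 2) * (p^(k choose 2) * b * x^k) =
      b * ((-1)^(k+n) * exp ((real k - real n) * v - e * (real k - real n)^2 / 2))" for k b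
  proof -
    have "p^(k choose 2) = exp (- (e * (real k * (real k - 1) / 2)))"
      by (simp add: p_def exp_of_nat_mult[symmetric] choose_2_real mult_ac)
    moreover have "x^k = (-1)^k * exp (k * (v + e * (real n - 1/2)))"
      unfolding x_def by (subst power_minus) (simp add: exp_of_nat_mult)
    moreover have "exp (- (n * v) - e * (real n)^2 / 2) * (exp (- (e * (real k * (real k - 1) / 2))) * exp (k * (v + e * (real n - 1/2))))
       = exp ((real k - real n) * v - e * (real k - real n)^2 / 2)"
      unfolding exp_add[symmetric] by (rule arg_cong[of _ _ exp]) (simp add: field_simps power2_eq_square)
    ultimately show ?thesis by (simp add: power_add mult_ac)
  qed
  show ?thesis
    by (simp only: F1[symmetric] q_binomial[OF p] sum_distrib_left R) (simp only: p_def)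
qed

text \<open>The extra factor \<open>qp (exp (-e)) n\<close> normalises the coefficients: each
  \<open>b n j\<close> lies between 0 and 1 and tends to 1 as \<open>n\<close> grows, which is what
  a dominated passage to the limit needs.\<close>

lemma psi_prod_sum:
  assumes e: "e > 0"
  defines "b \<equiv> \<lambda>n j. qp (exp (-e)) n * qp (exp (-e)) (2*n) / (qp (exp (-e)) (n + j) * qp (exp (-e)) (n - j))"
  shows "qp (exp (-e)) n * psi_prod e v n =
    (\<Sum>j<Suc n. b n j * (alt j * exp (real j * v - e * (real j)^2 / 2))) +
    (\<Sum>j<n. b n (Suc j) * (alt (Suc j) * exp (- (real (Suc j) * v) - e * (real (Suc j))^2 / 2)))"
proof -
  define f where "f k = qp (exp (-e)) n * (qp (exp (-e)) (2*n) / (qp (exp (-e)) k * qp (exp (-e)) (2*n - k)) *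
            ((-1)^(k+n) * exp ((real k - real n) * v - e * (real k - real n)^2 / 2)))" for k
  have "qp (exp (-e)) n * psi_prod e v n = (\<Sum>k\<le>2*n. f k)"
    unfolding psi_prod_finite[OF e] by (simp add: sum_distrib_left f_def)
  also have "{..2*n} = {..<n} \<union> {n..<n + Suc n}" by auto
  also have "sum f ({..<n} \<union> {n..<n + Suc n}) = sum f {..<n} + sum f {n..<n + Suc n}"
    by (rule sum.union_disjoint) auto
  also have "sum f {n..<n + Suc n} = (\<Sum>j<Suc n. f (n + j))"
    using sum.shift_bounds_nat_ivl[of f 0 n "Suc n"] by (simp add: lessThan_atLeast0 add.commute)
  also have "\<dots> = (\<Sum>j<Suc n. b n j * (alt j * exp (real j * v - e * (real j)^2 / 2)))"
  proof (rule sum.cong)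
    fix j assume "j \<in> {..<Suc n}"
    hence "2 * n - (n + j) = n - j" by auto
    thus "f (n + j) = b n j * (alt j * exp (real j * v - e * (real j)^2 / 2))"
      by (simp add: f_def b_def alt_def power_add flip: mult_2 power_mult)
  qed simp
  also have "sum f {..<n} = (\<Sum>j<n. f (n - Suc j))" by (rule sum.nat_diff_reindex[symmetric])
  also have "\<dots> = (\<Sum>j<n. b n (Suc j) * (alt (Suc j) * exp (- (real (Suc j) * v) - e * (real (Suc j))^2 / 2)))"
  proof (rule sum.cong)
    fix j assume "j \<in> {..<n}"
    then obtain d where n: "n = Suc (j + d)" using less_imp_Suc_add[of j n] by auto
    have "2 * n - (n - Suc j) = n + Suc j" "n - Suc j = d" using n by auto
    moreover have "real d - real n = - real (Suc j)" by (simp add: n)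
    moreover have "(-1::real)^(d + n) = alt (Suc j)" by (simp add: alt_def n power_add flip: power_mult_distrib)
    ultimately show "f (n - Suc j) = b n (Suc j) * (alt (Suc j) * exp (- (real (Suc j) * v) - e * (real (Suc j))^2 / 2))"
      by (simp add: f_def b_def mult_ac del: of_nat_Suc)
  qed simp
  finally show ?thesis by simp
qed

section \<open>Logarithmic expansion, the triple product in the limit, and bounds of order
  \<open>exp (- pi^2 / (2 e))\<close>\<close>

lemma ln_qp_sums:
  assumes e: "e > 0"
  shows "(\<lambda>k. (\<Sum>m<n. exp (- e * (real (Suc k) * real (Suc m)))) / real (Suc k)) sums (- ln (qp (exp (-e)) n))"
proof (induction n)
  case (Suc n)
  define y where "y = exp (-e) ^ Suc n"
  have y: "0 < y" "y < 1" using e by (auto simp: y_def power_Suc_less_one simp del: power_Suc)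
  have "(\<lambda>k. - (1 / real (Suc k) * y ^ Suc k)) sums ln (1 - y)"
  proof -
    have "(\<lambda>n. - ((- (- y)) ^ n) / real n) sums ln (1 + - y)"
      by (rule ln_series') (use y in auto)
    hence "(\<lambda>k. - ((- (- y)) ^ Suc k) / real (Suc k)) sums ln (1 + - y)"
      by (subst sums_Suc_iff) simp
    thus ?thesis by simp
  qed
  from sums_minus[OF this] have "(\<lambda>k. y ^ Suc k / real (Suc k)) sums (- ln (1 - y))" by simp
  from sums_add[OF Suc.IH this]
  have "(\<lambda>k. (\<Sum>m<n. exp (- e * (real (Suc k) * real (Suc m)))) / real (Suc k) + y ^ Suc k / real (Suc k)) sums
     (- ln (qp (exp (-e)) n) + - ln (1 - y))" .
  moreover have "y ^ Suc k = exp (- e * (real (Suc k) * real (Suc n)))" for k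
    unfolding y_def exp_of_nat_mult[symmetric] by (rule arg_cong[of _ _ exp]) (simp add: mult_ac)
  moreover have "- ln (qp (exp (-e)) n) + - ln (1 - y) = - ln (qp (exp (-e)) (Suc n))"
    using qp_pos[of "exp (-e)" n] y e by (simp add: qp_Suc ln_mult y_def)
  ultimately show ?case by (simp add: add_divide_distrib del: of_nat_Suc)
qed simp

lemma geo_sum_bound:
  assumes "e > 0"
  shows "(\<Sum>m<n. exp (- e * real (Suc m))) \<le> 1 / e"
proof -
  have "(\<Sum>m<n. exp (- e * real (Suc m))) = exp (-e) * (\<Sum>m<n. exp (-e) ^ m)"
    by (simp add: sum_distrib_left exp_of_nat_mult[symmetric] exp_add[symmetric] algebra_simps)
  also have "\<dots> = exp (-e) * ((1 - exp (-e)^n) / (1 - exp (-e)))"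
    using assms by (subst sum_gp_strict) auto
  also have "\<dots> \<le> exp (-e) * (1 / (1 - exp (-e)))"
    using assms by (intro mult_left_mono divide_right_mono) auto
  also have "\<dots> = 1 / (exp e - 1)" using assms by (simp add: exp_minus field_simps)
  also have "\<dots> \<le> 1 / e"
  proof -
    have "e \<le> exp e - 1" using exp_ge_add_one_self[of e] by linarith
    thus ?thesis using assms by (intro divide_left_mono) auto
  qed
  finally show ?thesis .
qed

text \<open>In the expansion of the logarithm the inner geometric sum belonging to \<open>k\<close>
  is at most \<open>1 / (e k)\<close>. Division by \<open>k\<close> and Euler's sum of inverse
  squares give \<open>pi^2 / (6 e)\<close>, uniformly in \<open>n\<close>.\<close>

lemma qp_lower:
  assumes e: "e > 0"
  shows "exp (- (pi^2 / (6 * e))) \<le> qp (exp (-e)) n"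
proof -
  have "- ln (qp (exp (-e)) n) \<le> 1 / e * (pi^2 / 6)"
  proof (rule sums_le[OF _ ln_qp_sums[OF e] sums_mult[OF inverse_squares_sums]])
    fix k
    have "(\<Sum>m<n. exp (- (e * real (Suc k)) * real (Suc m))) \<le> 1 / (e * real (Suc k))"
      using e by (intro geo_sum_bound) auto
    hence 1: "(\<Sum>m<n. exp (- e * (real (Suc k) * real (Suc m)))) / real (Suc k) \<le> 1 / (e * real (Suc k)) / real (Suc k)"
      by (intro divide_right_mono) (auto simp: mult.assoc)
    show "(\<Sum>m<n. exp (- e * (real (Suc k) * real (Suc m)))) / real (Suc k) \<le> 1 / e * (1 / real ((k + 1)^2))"
    proof -
      have "real ((k + 1)^2) = real (Suc k) * real (Suc k)" by (simp add: power2_eq_square algebra_simps)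
      thus ?thesis using 1 by (simp only: mult.assoc divide_divide_eq_left times_divide_times_eq mult_1)
    qed
  qed
  hence "- (pi^2 / (6 * e)) \<le> ln (qp (exp (-e)) n)" using e by (simp add: field_simps)
  thus ?thesis using qp_pos[of "exp (-e)" n] e by (subst (asm) exp_le_cancel_iff[symmetric]) simp
qed

text \<open>All summands of the expansion are nonnegative, so it may be cut after \<open>K\<close>
  of them; a finite sum is easily compared with its limit as \<open>e\<close> tends to 0.\<close>

lemma qp_upper:
  assumes e: "e > 0"
  shows "qp (exp (-e)) n \<le> exp (- (\<Sum>k<K. (\<Sum>m<n. exp (- e * (real (Suc k) * real (Suc m)))) / real (Suc k)))"
proof -
  have "(\<Sum>k<K. (\<Sum>m<n. exp (- e * (real (Suc k) * real (Suc m)))) / real (Suc k)) \<le> - ln (qp (exp (-e)) n)"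
    using ln_qp_sums[OF e, of n] by (subst sums_unique[OF ln_qp_sums[OF e, of n]], intro sum_le_suminf)
      (auto simp: sums_iff intro!: sum_nonneg divide_nonneg_pos)
  hence "ln (qp (exp (-e)) n) \<le> - (\<Sum>k<K. (\<Sum>m<n. exp (- e * (real (Suc k) * real (Suc m)))) / real (Suc k))" by simp
  thus ?thesis using qp_pos[of "exp (-e)" n] e by (subst (asm) exp_le_cancel_iff[symmetric]) simp
qed

text \<open>Jacobi's triple product, obtained from its finite form by Tannery's theorem. The limit
  \<open>Q\<close> of \<open>qp\<close> is positive by \<open>qp_lower\<close>, and therefore the
  coefficients tend to \<open>Q * Q / (Q * Q) = 1\<close>.\<close>

lemma psi_prod_tendsto:
  assumes e: "e > 0"
  shows "(\<lambda>n. qp (exp (-e)) n * psi_prod e v n) \<longlonglongrightarrow> psi e v"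
proof -
  define p where "p = exp (-e)"
  have p: "0 < p" "p < 1" using e by (auto simp: p_def)
  have "decseq (qp p)" using qp_antimono[OF p] by (auto simp: decseq_def)
  moreover have "exp (- (pi^2 / (6 * e))) \<le> qp p n" for n unfolding p_def by (rule qp_lower[OF e])
  ultimately obtain Q where Q: "qp p \<longlonglongrightarrow> Q" "\<And>n. Q \<le> qp p n"
    using decseq_convergent by metis
  have "exp (- (pi^2 / (6 * e))) \<le> Q"
    by (rule LIMSEQ_le_const[OF Q(1)]) (use qp_lower[OF e] in \<open>auto simp: p_def\<close>)
  hence Qpos: "Q > 0" by (rule less_le_trans[OF exp_gt_zero])
  define b where "b n j = qp p n * qp p (2*n) / (qp p (n + j) * qp p (n - j))" for n j
  have lim: "(\<lambda>n. b n j) \<longlonglongrightarrow> 1" for j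
  proof -
    have s1: "(\<lambda>n. qp p (2*n)) \<longlonglongrightarrow> Q"
      using LIMSEQ_subseq_LIMSEQ[OF Q(1), of "\<lambda>n. 2 * n"] by (simp add: strict_mono_def o_def)
    have s2: "(\<lambda>n. qp p (n + j)) \<longlonglongrightarrow> Q" by (rule LIMSEQ_ignore_initial_segment[OF Q(1)])
    have "(\<lambda>n. qp p (n + j - j)) \<longlonglongrightarrow> Q" using Q(1) by simp
    hence s3: "(\<lambda>n. qp p (n - j)) \<longlonglongrightarrow> Q" by (rule LIMSEQ_offset)
    have "(\<lambda>n. b n j) \<longlonglongrightarrow> Q * Q / (Q * Q)"
      unfolding b_def by (intro tendsto_intros Q s1 s2 s3) (use Qpos in auto)
    thus ?thesis using Qpos by simp
  qed
  have b01: "0 \<le> b n j \<and> b n j \<le> 1" if "j \<le> n" for n j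
  proof -
    have "qp p n * qp p (2*n) \<le> qp p (n - j) * qp p (n + j)"
      using that by (intro mult_mono qp_antimono p) (auto intro: less_imp_le qp_pos p)
    thus ?thesis using qp_pos[OF p] by (auto simp: b_def divide_simps mult_ac less_imp_le)
  qed
  have T: "(\<lambda>n. \<Sum>j. (if j < n + i then b n (j + d) * t j else 0)) \<longlonglongrightarrow> (\<Sum>j. t j)"
    if t: "\<And>j. \<bar>t j\<bar> \<le> M j" and M: "summable M" and di: "\<And>j n. j < n + i \<Longrightarrow> j + d \<le> n" for t M i d
  proof -
    have "(\<lambda>n. if j < n + i then b n (j + d) * t j else 0) \<longlonglongrightarrow> t j" for j
    proof -
      have "(\<lambda>n. b n (j + d) * t j) \<longlonglongrightarrow> 1 * t j" by (intro tendsto_intros lim)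
      moreover have "\<forall>\<^sub>F n in sequentially. (if j < n + i then b n (j + d) * t j else 0) = b n (j + d) * t j"
        using eventually_gt_at_top[of j] by eventually_elim auto
      ultimately show ?thesis using tendsto_cong by force
    qed
    moreover have "norm (if j < n + i then b n (j + d) * t j else 0) \<le> M j" for n j
    proof (cases "j < n + i")
      case True
      have "\<bar>b n (j + d)\<bar> * \<bar>t j\<bar> \<le> 1 * M j"
        using b01[OF di[OF True]] t[of j] by (intro mult_mono) auto
      thus ?thesis using True by (simp add: abs_mult)
    next
      case False
      thus ?thesis using t[of j] by simp
    qed
    ultimately show ?thesis
      using tannerys_theorem[of "\<lambda>j n. if j < n + i then b n (j + d) * t j else 0" t sequentially M] M
      by (auto simp: always_eventually)
  qed
  define t1 where "t1 j = alt j * exp (real j * v - e * (real j)^2 / 2)" for j :: nat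
  define t2 where "t2 j = alt (Suc j) * exp (- (real (Suc j) * v) - e * (real (Suc j))^2 / 2)" for j :: nat
  have L1: "(\<lambda>n. \<Sum>j. (if j < n + 1 then b n (j + 0) * t1 j else 0)) \<longlonglongrightarrow> (\<Sum>j. t1 j)"
    by (rule T[OF _ summable_pmaj[OF e, of v]]) (auto simp: t1_def alt_def pmaj_def abs_mult)
  have L2: "(\<lambda>n. \<Sum>j. (if j < n + 0 then b n (j + 1) * t2 j else 0)) \<longlonglongrightarrow> (\<Sum>j. t2 j)"
  proof (rule T)
    show "summable (\<lambda>j. pmaj e (-v) (Suc j))" using summable_pmaj[OF e, of "-v"] by (simp add: summable_Suc_iff)
    show "\<bar>t2 j\<bar> \<le> pmaj e (-v) (Suc j)" for j by (simp add: t2_def alt_def pmaj_def abs_mult)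
  qed auto
  have "t2 j = - exp (- e/2 - v) * (alt j * exp (real j * (- v - e) - e * (real j)^2 / 2))" for j
  proof -
    have "exp (- (real (Suc j) * v) - e * (real (Suc j))^2 / 2) = exp (- e/2 - v) * exp (real j * (- v - e) - e * (real j)^2 / 2)"
      unfolding exp_add[symmetric] by (rule arg_cong[of _ _ exp]) (simp add: field_simps power2_eq_square)
    thus ?thesis by (simp add: t2_def alt_def)
  qed
  hence "(\<Sum>j. t2 j) = (\<Sum>j. - exp (- e/2 - v) * (alt j * exp (real j * (- v - e) - e * (real j)^2 / 2)))" by simp
  also have "\<dots> = - exp (- e/2 - v) * ptr alt e (- v - e)"
    unfolding ptr_def by (rule suminf_mult[OF alt.summable_ptr[OF e]])
  finally have t2: "(\<Sum>j. t2 j) = - exp (- e/2 - v) * ptr alt e (- v - e)" .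
  have t1: "(\<Sum>j. t1 j) = ptr alt e v" by (simp add: t1_def ptr_def)
  have fin: "(\<Sum>j. (if j < N then g j else 0)) = (\<Sum>j<N. g j)" for N and g :: "nat \<Rightarrow> real"
    by (subst suminf_finite[of "{..<N}"]) auto
  have "qp p n * psi_prod e v n = (\<Sum>j. (if j < n + 1 then b n (j + 0) * t1 j else 0)) + (\<Sum>j. (if j < n + 0 then b n (j + 1) * t2 j else 0))" for n
    unfolding fin p_def using psi_prod_sum[OF e, where n = n and v = v] by (simp add: b_def p_def t1_def t2_def)
  hence "(\<lambda>n. qp p n * psi_prod e v n) \<longlonglongrightarrow> (\<Sum>j. t1 j) + (\<Sum>j. t2 j)"
    using tendsto_add[OF L1 L2] by simp
  thus ?thesis unfolding t1 t2 psi_def p_def by simp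
qed

lemma psi_prod_Suc_shift:
  "psi_prod e v (Suc n) = (1 - exp (v - e/2)) * (1 - exp (- v - e/2)) *
     (\<Prod>m<n. (1 - exp (v - e * (real m + 3/2))) * (1 - exp (- v - e * (real m + 3/2))))"
  unfolding psi_prod_def by (subst prod.lessThan_Suc_shift) (simp add: algebra_simps)

text \<open>With the factor pair of index 0 split off, every remaining factor is at least
  \<open>1 - exp (- e (m + 1))\<close>, because \<open>|v| \<le> e/2\<close>. Together with the
  prefactor three \<open>qp\<close> products appear, and three times \<open>pi^2 / 6\<close> is
  \<open>pi^2 / 2\<close>.\<close>

lemma psi_lower:
  assumes e: "e > 0" and v: "\<bar>v\<bar> \<le> e/2"
  shows "(1 - exp (v - e/2)) * (1 - exp (- v - e/2)) * exp (- (pi^2 / (2 * e))) \<le> psi e v"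
proof (rule LIMSEQ_le_const[OF psi_prod_tendsto[OF e]])
  define p where "p = exp (-e)"
  have p: "0 < p" "p < 1" using e by (auto simp: p_def)
  define A where "A = (1 - exp (v - e/2)) * (1 - exp (- v - e/2))"
  have A: "A \<ge> 0" using v by (auto simp: A_def intro!: mult_nonneg_nonneg)
  have "A * exp (- (pi^2 / (2 * e))) \<le> qp p n * psi_prod e v n" if n1: "n \<ge> 1" for n
  proof -
    obtain k where n: "n = Suc k" using n1 by (cases n) auto
    have "qp p k * qp p k \<le> (\<Prod>m<k. (1 - exp (v - e * (real m + 3/2))) * (1 - exp (- v - e * (real m + 3/2))))"
      unfolding qp_def prod.distrib[symmetric]
    proof (rule prod_mono, intro conjI)
      fix m
      have pm: "p ^ Suc m = exp (- (e * (real m + 1)))"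
        by (simp add: p_def exp_of_nat_mult[symmetric] exp_add[symmetric] algebra_simps)
      show "0 \<le> (1 - p ^ Suc m) * (1 - p ^ Suc m)" by simp
      have "1 - p ^ Suc m \<ge> 0" using p by (simp add: power_le_one del: power_Suc)
      moreover have "v - e * (real m + 3/2) \<le> - (e * (real m + 1))" "- v - e * (real m + 3/2) \<le> - (e * (real m + 1))"
        using v by (auto simp: algebra_simps)
      hence "exp (v - e * (real m + 3/2)) \<le> p ^ Suc m" "exp (- v - e * (real m + 3/2)) \<le> p ^ Suc m"
        unfolding pm by simp_all
      ultimately show "(1 - p ^ Suc m) * (1 - p ^ Suc m) \<le> (1 - exp (v - e * (real m + 3/2))) * (1 - exp (- v - e * (real m + 3/2)))"
        by (intro mult_mono) linarith+
    qed
    hence 1: "A * (qp p k * qp p k) \<le> psi_prod e v n"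
      unfolding n psi_prod_Suc_shift A_def[symmetric] using A by (intro mult_left_mono)
    have q: "exp (- (pi^2 / (6 * e))) \<le> qp p j" for j unfolding p_def by (rule qp_lower[OF e])
    have q0: "0 \<le> qp p j" for j using qp_pos[OF p] less_imp_le by blast
    have "exp (- (pi^2 / (2 * e))) = exp (- (pi^2 / (6 * e))) * (exp (- (pi^2 / (6 * e))) * exp (- (pi^2 / (6 * e))))"
      unfolding exp_add[symmetric] by (rule arg_cong[of _ _ exp]) (use e in \<open>simp add: field_simps\<close>)
    also have "\<dots> \<le> qp p n * (qp p k * qp p k)"
      by (intro mult_mono q q0 mult_nonneg_nonneg) auto
    finally have "A * exp (- (pi^2 / (2 * e))) \<le> A * (qp p n * (qp p k * qp p k))"
      using A by (intro mult_left_mono)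
    also have "\<dots> = qp p n * (A * (qp p k * qp p k))" by simp
    also have "\<dots> \<le> qp p n * psi_prod e v n" using 1 q0 by (intro mult_left_mono)
    finally show ?thesis .
  qed
  thus "\<exists>N. \<forall>n\<ge>N. (1 - exp (v - e/2)) * (1 - exp (- v - e/2)) * exp (- (pi^2 / (2 * e))) \<le> qp (exp (- e)) n * psi_prod e v n"
    unfolding p_def A_def by blast
qed

text \<open>The product is largest at 0 because \<open>exp v + exp (-v) \<ge> 2\<close>. There, each
  factor with exponent \<open>m + 1/2\<close> is at most the one with exponent \<open>m + 1\<close>,
  which leads back to \<open>qp\<close>.\<close>

lemma psi_prod_bounds:
  assumes e: "e > 0" and v: "\<bar>v\<bar> \<le> e/2"
  shows "0 \<le> psi_prod e v n" "psi_prod e v n \<le> psi_prod e 0 n" "psi_prod e 0 n \<le> qp (exp (-e)) n * qp (exp (-e)) n"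
proof -
  have r: "exp v * exp (- e * (real m + 1/2)) \<le> 1" "exp (-v) * exp (- e * (real m + 1/2)) \<le> 1" for m
  proof -
    have "e * (1/2) \<le> e * (real m + 1/2)" using e by (intro mult_left_mono) auto
    thus "exp v * exp (- e * (real m + 1/2)) \<le> 1" "exp (-v) * exp (- e * (real m + 1/2)) \<le> 1"
      using v by (simp_all flip: exp_add)
  qed
  have eq: "(1 - exp (w - e * (real m + 1/2))) * (1 - exp (- w - e * (real m + 1/2))) =
     (1 - exp w * exp (- e * (real m + 1/2))) * (1 - exp (-w) * exp (- e * (real m + 1/2)))" for m w
    by (simp flip: exp_add)
  show "0 \<le> psi_prod e v n" unfolding psi_prod_def eq using r by (intro prod_nonneg) (simp add: mult_nonneg_nonneg)
  show "psi_prod e v n \<le> psi_prod e 0 n" unfolding psi_prod_def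
  proof (rule prod_mono, intro conjI)
    fix m
    define s where "s = exp (- e * (real m + 1/2))"
    show "0 \<le> (1 - exp (v - e * (real m + 1/2))) * (1 - exp (- v - e * (real m + 1/2)))"
      unfolding eq using r[of m] by (simp add: mult_nonneg_nonneg)
    have "0 \<le> (exp (v/2) - exp (-v/2))^2" by simp
    also have "\<dots> = exp v + exp (-v) - 2"
    proof -
      have "exp (v/2) * exp (v/2) = exp v" "exp (v/2) * exp (-v/2) = 1" "exp (-v/2) * exp (-v/2) = exp (-v)"
        by (simp_all flip: exp_add)
      thus ?thesis by (simp add: power2_eq_square algebra_simps)
    qed
    finally have "2 * s \<le> (exp v + exp (-v)) * s" by (intro mult_right_mono) (auto simp: s_def)
    hence 1: "2 * s \<le> exp v * s + exp (-v) * s" by (simp add: distrib_right)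
    have "exp v * s * (exp (-v) * s) = (exp v * exp (-v)) * (s * s)" by (simp only: mult_ac)
    also have "\<dots> = s * s" by (simp flip: exp_add)
    finally have 2: "exp v * s * (exp (-v) * s) = s * s" .
    have "(1 - x) * (1 - y) = 1 - (x + y) + x * y" for x y :: real by (simp add: algebra_simps)
    note 3 = this[of "exp v * s" "exp (-v) * s"] this[of s s]
    have "(1 - exp v * s) * (1 - exp (-v) * s) \<le> (1 - s) * (1 - s)" unfolding 3 2 using 1 by linarith
    thus "(1 - exp (v - e * (real m + 1/2))) * (1 - exp (- v - e * (real m + 1/2))) \<le>
        (1 - exp (0 - e * (real m + 1/2))) * (1 - exp (- 0 - e * (real m + 1/2)))"
      unfolding eq s_def[symmetric] by simp
  qed
  show "psi_prod e 0 n \<le> qp (exp (-e)) n * qp (exp (-e)) n"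
    unfolding psi_prod_def qp_def prod.distrib[symmetric]
  proof (rule prod_mono, intro conjI)
    fix m
    have pm: "exp (-e) ^ Suc m = exp (- (e * (real m + 1)))"
      by (simp add: exp_of_nat_mult[symmetric] exp_add[symmetric] algebra_simps)
    have a: "exp (-e) ^ Suc m \<le> exp (0 - e * (real m + 1/2))" unfolding pm using e by simp
    have b: "exp (0 - e * (real m + 1/2)) \<le> 1" using e by simp
    show "0 \<le> (1 - exp (0 - e * (real m + 1/2))) * (1 - exp (- 0 - e * (real m + 1/2)))" using b by simp
    show "(1 - exp (0 - e * (real m + 1/2))) * (1 - exp (- 0 - e * (real m + 1/2)))
       \<le> (1 - exp (-e) ^ Suc m) * (1 - exp (-e) ^ Suc m)"
      unfolding minus_zero using a b by (intro mult_mono) linarith+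
  qed
qed

lemma psi_bounds:
  assumes e: "e > 0" and v: "\<bar>v\<bar> \<le> e/2"
  shows "0 \<le> psi e v" "psi e v \<le> psi e 0"
proof -
  have q0: "0 \<le> qp (exp (-e)) j" for j using qp_pos[of "exp (-e)" j] e by simp
  show "0 \<le> psi e v"
    by (rule LIMSEQ_le_const[OF psi_prod_tendsto[OF e]])
       (use q0 psi_prod_bounds(1)[OF e v] in \<open>auto intro!: mult_nonneg_nonneg\<close>)
  show "psi e v \<le> psi e 0"
    by (rule LIMSEQ_le[OF psi_prod_tendsto[OF e] psi_prod_tendsto[OF e]])
       (use q0 psi_prod_bounds(2)[OF e v] in \<open>auto intro!: mult_left_mono\<close>)
qed

text \<open>Three copies of \<open>qp_upper\<close> multiply. As \<open>n\<close> tends to infinity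
  the inner sums become \<open>x / (1 - x)\<close> with \<open>x = exp (- e k)\<close>, and
  \<open>1 - exp (- t) \<le> t\<close> extracts the factor \<open>1 / e\<close>.\<close>

lemma psi0_upper_finite:
  assumes e: "e > 0"
  shows "psi e 0 \<le> exp (- (3 / e * (\<Sum>k<K. exp (- (e * real (Suc k))) / (real (Suc k))^2)))"
proof -
  define S where "S n = (\<Sum>k<K. (\<Sum>m<n. exp (- e * (real (Suc k) * real (Suc m)))) / real (Suc k))" for n
  have qq: "qp (exp (-e)) n * psi_prod e 0 n \<le> exp (- (3 * S n))" for n
  proof -
    have q: "0 \<le> qp (exp (-e)) n" "qp (exp (-e)) n \<le> exp (- S n)"
      using qp_pos[of "exp (-e)" n] qp_upper[OF e, of n K] e by (auto simp: S_def)
    have "qp (exp (-e)) n * psi_prod e 0 n \<le> qp (exp (-e)) n * (qp (exp (-e)) n * qp (exp (-e)) n)"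
      using psi_prod_bounds(3)[OF e, of 0] q e by (intro mult_left_mono) auto
    also have "\<dots> \<le> exp (- S n) * (exp (- S n) * exp (- S n))" using q by (intro mult_mono) auto
    also have "\<dots> = exp (- (3 * S n))" by (simp flip: exp_add)
    finally show ?thesis .
  qed
  have "S \<longlonglongrightarrow> (\<Sum>k<K. (exp (- (e * real (Suc k))) / (1 - exp (- (e * real (Suc k))))) / real (Suc k))"
    unfolding S_def
  proof (intro tendsto_sum tendsto_divide tendsto_const)
    fix k
    define x where "x = exp (- (e * real (Suc k)))"
    have x: "0 < x" "x < 1" using e by (auto simp: x_def)
    have "(\<Sum>m<n. exp (- e * (real (Suc k) * real (Suc m)))) = (\<Sum>m<n. x * x^m)" for n
      by (rule sum.cong) (auto simp: x_def exp_of_nat_mult[symmetric] exp_add[symmetric] algebra_simps)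
    moreover have "(\<lambda>m. x * x^m) sums (x * (1 / (1 - x)))"
      using x by (intro sums_mult geometric_sums) auto
    ultimately show "(\<lambda>n. \<Sum>m<n. exp (- e * (real (Suc k) * real (Suc m)))) \<longlonglongrightarrow>
        exp (- (e * real (Suc k))) / (1 - exp (- (e * real (Suc k))))"
      by (simp add: sums_def x_def)
  qed auto
  hence "(\<lambda>n. exp (- (3 * S n))) \<longlonglongrightarrow> exp (- (3 * (\<Sum>k<K. (exp (- (e * real (Suc k))) / (1 - exp (- (e * real (Suc k))))) / real (Suc k))))"
    by (intro tendsto_intros)
  hence "psi e 0 \<le> exp (- (3 * (\<Sum>k<K. (exp (- (e * real (Suc k))) / (1 - exp (- (e * real (Suc k))))) / real (Suc k))))"
    by (rule LIMSEQ_le[OF psi_prod_tendsto[OF e]]) (use qq in auto)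
  also have "\<dots> \<le> exp (- (3 / e * (\<Sum>k<K. exp (- (e * real (Suc k))) / (real (Suc k))^2)))"
  proof -
    have "1 / e * (exp (- (e * real (Suc k))) / (real (Suc k))^2) \<le> (exp (- (e * real (Suc k))) / (1 - exp (- (e * real (Suc k))))) / real (Suc k)" for k
    proof -
      define x where "x = e * real (Suc k)"
      have x: "x > 0" using e by (simp add: x_def)
      have "1 - exp (- x) \<le> x" using exp_ge_add_one_self[of "-x"] by linarith
      hence "exp (- x) / x \<le> exp (- x) / (1 - exp (- x))" using x by (intro divide_left_mono) auto
      hence "exp (- x) / x / real (Suc k) \<le> exp (- x) / (1 - exp (- x)) / real (Suc k)" by (intro divide_right_mono) auto
      moreover have "1 / e * (exp (- x) / (real (Suc k))^2) = exp (- x) / x / real (Suc k)"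
        by (simp add: x_def power2_eq_square mult.assoc)
      ultimately show ?thesis by (simp only: x_def)
    qed
    hence "(\<Sum>k<K. 1 / e * (exp (- (e * real (Suc k))) / (real (Suc k))^2)) \<le> (\<Sum>k<K. (exp (- (e * real (Suc k))) / (1 - exp (- (e * real (Suc k))))) / real (Suc k))"
      by (intro sum_mono)
    hence "1 / e * (\<Sum>k<K. exp (- (e * real (Suc k))) / (real (Suc k))^2) \<le> (\<Sum>k<K. (exp (- (e * real (Suc k))) / (1 - exp (- (e * real (Suc k))))) / real (Suc k))"
      unfolding sum_distrib_left .
    thus ?thesis by simp
  qed
  finally show ?thesis .
qed

text \<open>The loss \<eta> pays for replacing Euler's series by finitely many terms, and these by
  their values at small positive \<open>e\<close>.\<close>

lemma psi0_upper:
  assumes "\<eta> > 0"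
  shows "\<forall>\<^sub>F e in at_right 0. psi e 0 \<le> exp (- ((pi^2 - \<eta>) / (2 * e)))"
proof -
  have "(\<lambda>K. \<Sum>k<K. 1 / real ((k + 1)^2)) \<longlonglongrightarrow> pi^2 / 6"
    using inverse_squares_sums by (simp add: sums_def)
  hence "\<forall>\<^sub>F K in sequentially. (pi^2 - \<eta>) / 6 < (\<Sum>k<K. 1 / real ((k + 1)^2))"
    by (rule order_tendstoD) (use assms in simp)
  then obtain K where K: "(pi^2 - \<eta>) / 6 < (\<Sum>k<K. 1 / (real (Suc k))^2)"
    by (auto simp: eventually_sequentially add.commute)
  have "((\<lambda>e. \<Sum>k<K. exp (- (e * real (Suc k))) / (real (Suc k))^2) \<longlongrightarrow> (\<Sum>k<K. exp (- (0 * real (Suc k))) / (real (Suc k))^2)) (at_right 0)"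
    by (intro tendsto_intros) auto
  hence "\<forall>\<^sub>F e in at_right 0. (pi^2 - \<eta>) / 6 < (\<Sum>k<K. exp (- (e * real (Suc k))) / (real (Suc k))^2)"
    by (rule order_tendstoD) (use K in simp)
  moreover have "\<forall>\<^sub>F e in at_right (0::real). e > 0" by (simp add: eventually_at_right_less)
  ultimately show ?thesis
  proof eventually_elim
    case (elim e)
    have "(pi^2 - \<eta>) / (2 * e) = 3 / e * ((pi^2 - \<eta>) / 6)" using elim by (simp add: field_simps)
    also have "\<dots> \<le> 3 / e * (\<Sum>k<K. exp (- (e * real (Suc k))) / (real (Suc k))^2)"
      using elim by (intro mult_left_mono) auto
    finally have "exp (- (3 / e * (\<Sum>k<K. exp (- (e * real (Suc k))) / (real (Suc k))^2))) \<le> exp (- ((pi^2 - \<eta>) / (2 * e)))"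
      by simp
    thus ?case using psi0_upper_finite[OF elim(2), of K] by linarith
  qed
qed

section \<open>Quasi-periodicity of the theta series\<close>

lemma ptr_alt_rec:
  assumes e: "e > 0"
  shows "ptr alt e v = 1 - exp (v - e/2) * ptr alt e (v - e)"
proof -
  have "ptr alt e v = (\<Sum>j. alt (Suc j) * exp (real (Suc j) * v - e * (real (Suc j))^2 / 2)) + 1"
    unfolding ptr_def using suminf_split_head[OF alt.summable_ptr[OF e, of v]] by (simp add: alt_def)
  also have "(\<lambda>j. alt (Suc j) * exp (real (Suc j) * v - e * (real (Suc j))^2 / 2)) =
      (\<lambda>j. - exp (v - e/2) * (alt j * exp (real j * (v - e) - e * (real j)^2 / 2)))"
  proof
    fix j
    have "exp (real (Suc j) * v - e * (real (Suc j))^2 / 2) = exp (v - e/2) * exp (real j * (v - e) - e * (real j)^2 / 2)"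
      unfolding exp_add[symmetric] by (rule arg_cong[of _ _ exp]) (simp add: field_simps power2_eq_square)
    thus "alt (Suc j) * exp (real (Suc j) * v - e * (real (Suc j))^2 / 2) =
      - exp (v - e/2) * (alt j * exp (real j * (v - e) - e * (real j)^2 / 2))" by (simp add: alt_def)
  qed
  also have "suminf \<dots> = - exp (v - e/2) * ptr alt e (v - e)"
    unfolding ptr_def by (rule suminf_mult[OF alt.summable_ptr[OF e]])
  finally show ?thesis by simp
qed

text \<open>Both halves satisfy an inhomogeneous recurrence with constant 1, and the constants
  cancel in the two-sided combination.\<close>

lemma psi_shift:
  assumes e: "e > 0"
  shows "psi e (v + e) = - exp (v + e/2) * psi e v"
proof -
  have 1: "ptr alt e (v + e) = 1 - exp (v + e/2) * ptr alt e v"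
    using ptr_alt_rec[OF e, of "v + e"] by (simp add: algebra_simps)
  have 2: "exp (- e/2 - (v + e)) * ptr alt e (- (v + e) - e) = 1 - ptr alt e (- v - e)"
    using ptr_alt_rec[OF e, of "- v - e"] by (simp add: algebra_simps)
  have "exp (v + e/2) * exp (- e/2 - v) = 1" by (simp flip: exp_add)
  thus ?thesis unfolding psi_def 1 2 by (simp add: algebra_simps)
qed

text \<open>Equivalently, \<open>exp (- v^2 / (2 e)) * psi e v\<close> changes only its sign under a
  shift by \<open>e\<close>: the origin of the quadratic exponent in all later bounds.\<close>

lemma psi_shift_nat:
  assumes e: "e > 0"
  shows "psi e (v + real k * e) = (-1)^k * exp (((v + real k * e)^2 - v^2) / (2 * e)) * psi e v"
proof (induction k)
  case (Suc k)
  have "psi e (v + real (Suc k) * e) = psi e ((v + real k * e) + e)" by (simp add: algebra_simps)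
  also have "\<dots> = (-1)^Suc k * (exp (v + real k * e + e/2) * exp (((v + real k * e)^2 - v^2) / (2 * e))) * psi e v"
    unfolding psi_shift[OF e] Suc.IH by simp
  also have "exp (v + real k * e + e/2) * exp (((v + real k * e)^2 - v^2) / (2 * e)) = exp (((v + real (Suc k) * e)^2 - v^2) / (2 * e))"
    unfolding exp_add[symmetric] by (rule arg_cong[of _ _ exp]) (use e in \<open>simp add: field_simps power2_eq_square\<close>)
  finally show ?case .
qed simp

text \<open>Subtracting the nearest multiple of \<open>e\<close> brings the argument into
  \<open>|w| \<le> e/2\<close>, where the value at 0 dominates.\<close>

lemma psi_abs_le:
  assumes e: "e > 0" and v: "v \<ge> 0"
  shows "\<bar>psi e v\<bar> \<le> exp (v^2 / (2 * e)) * psi e 0"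
proof -
  define k where "k = nat \<lfloor>v / e + 1/2\<rfloor>"
  define w where "w = v - real k * e"
  have k: "real k \<le> v / e + 1/2" "v / e + 1/2 < real k + 1"
    using e v by (auto simp: k_def of_nat_nat)
  have "real k * e \<le> v + e/2" "v \<le> real k * e + e/2" using k e by (auto simp: field_simps)
  hence w: "\<bar>w\<bar> \<le> e/2" unfolding w_def by linarith
  have "psi e v = (-1)^k * exp ((v^2 - w^2) / (2 * e)) * psi e w"
    using psi_shift_nat[OF e, of w k] by (simp add: w_def)
  hence "\<bar>psi e v\<bar> = exp ((v^2 - w^2) / (2 * e)) * psi e w"
    using psi_bounds(1)[OF e w] by (simp add: abs_mult power_abs)
  also have "\<dots> \<le> exp (v^2 / (2 * e)) * psi e 0"
    using psi_bounds[OF e w] e by (intro mult_mono) (auto simp: divide_right_mono)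
  finally show ?thesis .
qed

section \<open>Zeros for small q\<close>

definition pterm :: "real \<Rightarrow> real \<Rightarrow> nat \<Rightarrow> real" where
  "pterm e v j = exp (real j * v - e * (real j)^2 / 2)"

text \<open>The sum of all positive powers of \<open>2 * exp (- e/2)\<close>. The factor 2 leaves
  room for coefficients of size \<open>2 ^ i\<close>, which occur in the differentiated
  series.\<close>

definition cell_err :: "real \<Rightarrow> real" where
  "cell_err e = 2 * exp (- e/2) / (1 - 2 * exp (- e/2))"

lemma cell_err_bounds:
  assumes "e \<ge> 10"
  shows "0 < cell_err e" "cell_err e \<le> 1/10" "2 * exp (- e/2) < 1"
proof -
  have "exp (- e/2) \<le> exp (-5)" using assms by simp
  also have "exp (-5::real) \<le> 1/32"
  proof -
    have "(2::real)^5 \<le> exp 1 ^ 5" using exp_ge_add_one_self[of "1::real"] by (intro power_mono) auto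
    also have "exp 1 ^ 5 = exp (5::real)" by (simp flip: exp_of_nat_mult)
    finally show ?thesis by (simp add: exp_minus field_simps)
  qed
  finally have x: "exp (- e/2) \<le> 1/32" .
  thus "2 * exp (- e/2) < 1" by simp
  thus "0 < cell_err e" by (simp add: cell_err_def)
  show "cell_err e \<le> 1/10" using x by (simp add: cell_err_def field_simps)
qed

lemma cell_err_tendsto: "(cell_err \<longlongrightarrow> 0) at_top"
proof -
  have "((\<lambda>e::real. exp (- e/2)) \<longlongrightarrow> 0) at_top"
  proof (rule tendsto_sandwich[of "\<lambda>_. 0" _ _ "\<lambda>e. 2 * inverse e"])
    show "\<forall>\<^sub>F e::real in at_top. exp (- e/2) \<le> 2 * inverse e"
      using eventually_gt_at_top[of 0]
    proof eventually_elim
      case (elim e)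
      have "e/2 \<le> exp (e/2)" using exp_ge_add_one_self[of "e/2"] by linarith
      thus ?case using elim by (simp add: exp_minus field_simps)
    qed
    show "((\<lambda>e::real. 2 * inverse e) \<longlongrightarrow> 0) at_top"
      using tendsto_mult_right_zero[OF tendsto_inverse_0_at_top[OF filterlim_ident], of 2] by simp
  qed auto
  hence "((\<lambda>e::real. 2 * exp (- e/2) / (1 - 2 * exp (- e/2))) \<longlongrightarrow> 2 * 0 / (1 - 2 * 0)) at_top"
    by (intro tendsto_intros) auto
  thus ?thesis unfolding cell_err_def by simp
qed

section \<open>Dominance of two neighbouring terms\<close>

lemma pterm_pos: "pterm e v j > 0" by (simp add: pterm_def)

text \<open>The exponent is a concave quadratic in the index, with its maximum at
  \<open>v / e\<close>, which lies to the right of \<open>n\<close>. Going down \<open>i\<close>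
  steps from \<open>n\<close> loses at least \<open>e i^2 / 2 \<ge> e i / 2\<close>.\<close>

lemma pterm_low:
  assumes e: "e \<ge> 10" and v: "real n * e \<le> v" and i: "1 \<le> i" "i \<le> n"
  shows "pterm e v (n - i) \<le> exp (- e/2) ^ i * pterm e v n"
proof -
  obtain k where n: "n = k + i" using i le_iff_add[of i n] by (auto simp: add.commute)
  have "real i \<le> (real i)^2" using i by (simp add: power2_eq_square)
  hence "e * real i \<le> e * (real i)^2" using e by (intro mult_left_mono) auto
  moreover have "real i * (real n * e) \<le> real i * v" using v by (intro mult_left_mono) auto
  ultimately have "real k * v - e * (real k)^2 / 2 \<le> real i * (- e/2) + (real n * v - e * (real n)^2 / 2)"
    by (simp add: n power2_eq_square algebra_simps add_divide_distrib)
  moreover have "n - i = k" by (simp add: n)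
  ultimately show ?thesis unfolding pterm_def exp_of_nat_mult[symmetric] exp_add[symmetric] by simp
qed

lemma pterm_high:
  assumes e: "e \<ge> 10" and v: "v \<le> (real n + 1) * e" and i: "1 \<le> i"
  shows "pterm e v (Suc n + i) \<le> exp (- e/2) ^ i * pterm e v (Suc n)"
proof -
  have "real i \<le> (real i)^2" using i by (simp add: power2_eq_square)
  hence "e * real i \<le> e * (real i)^2" using e by (intro mult_left_mono) auto
  moreover have "real i * v \<le> real i * ((real n + 1) * e)" using v by (intro mult_left_mono) auto
  moreover have "real (Suc n + i) = real (Suc n) + real i" by simp
  ultimately have "real (Suc n + i) * v - e * (real (Suc n + i))^2 / 2 \<le> real i * (- e/2) + (real (Suc n) * v - e * (real (Suc n))^2 / 2)"
    by (simp add: power2_eq_square algebra_simps add_divide_distrib)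
  thus ?thesis unfolding pterm_def exp_of_nat_mult[symmetric] exp_add[symmetric] by simp
qed

lemma two_term_partial:
  assumes e: "e \<ge> 10" and v: "real n * e \<le> v" "v \<le> (real n + 1) * e"
    and d1: "\<And>i. 1 \<le> i \<Longrightarrow> i \<le> n \<Longrightarrow> \<bar>d (n - i)\<bar> \<le> 2^i"
    and d2: "\<And>i. 1 \<le> i \<Longrightarrow> \<bar>d (Suc n + i)\<bar> \<le> (2::real)^i"
  shows "\<bar>(\<Sum>j<n + 2 + M. d j * pterm e v j) - d n * pterm e v n - d (Suc n) * pterm e v (Suc n)\<bar>
     \<le> cell_err e * (pterm e v n + pterm e v (Suc n))"
proof -
  define X where "X = 2 * exp (- e/2)"
  have X: "0 \<le> X" "X < 1" using cell_err_bounds[OF e] by (auto simp: X_def)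
  have geo: "(\<Sum>i<k. X ^ Suc i) \<le> cell_err e" for k
  proof -
    have "(\<Sum>i<k. X ^ Suc i) \<le> (\<Sum>i. X ^ Suc i)"
      using X by (intro sum_le_suminf) (auto intro!: summable_mult summable_geometric)
    also have "\<dots> = X * (1 / (1 - X))"
      using X by (simp add: suminf_mult summable_geometric suminf_geometric)
    finally show ?thesis by (simp add: cell_err_def X_def)
  qed
  have spl: "(\<Sum>j<n + 2 + M. f j) = (\<Sum>i<n. f (n - Suc i)) + f n + f (Suc n) + (\<Sum>i<M. f (Suc n + Suc i))" for f :: "nat \<Rightarrow> real"
  proof -
    have *: "(\<Sum>j<n + 2 + M. f j) = (\<Sum>j<n + 2. f j) + (\<Sum>i<M. f (Suc n + Suc i))"
      by (induction M) (auto simp: add_ac)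
    show ?thesis unfolding * by (simp add: sum.nat_diff_reindex)
  qed
  have "\<bar>\<Sum>i<n. d (n - Suc i) * pterm e v (n - Suc i)\<bar> \<le> (\<Sum>i<n. X ^ Suc i * pterm e v n)"
  proof (intro order_trans[OF sum_abs] sum_mono)
    fix i assume i: "i \<in> {..<n}"
    have "\<bar>d (n - Suc i)\<bar> * pterm e v (n - Suc i) \<le> 2 ^ Suc i * (exp (- e/2) ^ Suc i * pterm e v n)"
      using i by (intro mult_mono d1 pterm_low e v) (auto simp: pterm_pos less_imp_le)
    thus "\<bar>d (n - Suc i) * pterm e v (n - Suc i)\<bar> \<le> X ^ Suc i * pterm e v n"
      using pterm_pos[of e v] by (simp add: abs_mult abs_of_pos X_def power_mult_distrib mult_ac)
  qed
  also have "\<dots> \<le> cell_err e * pterm e v n"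
    unfolding sum_distrib_right[symmetric] by (intro mult_right_mono geo) (simp add: pterm_pos less_imp_le)
  finally have 1: "\<bar>\<Sum>i<n. d (n - Suc i) * pterm e v (n - Suc i)\<bar> \<le> cell_err e * pterm e v n" .
  have "\<bar>\<Sum>i<M. d (Suc n + Suc i) * pterm e v (Suc n + Suc i)\<bar> \<le> (\<Sum>i<M. X ^ Suc i * pterm e v (Suc n))"
  proof (intro order_trans[OF sum_abs] sum_mono)
    fix i assume i: "i \<in> {..<M}"
    have "\<bar>d (Suc n + Suc i)\<bar> * pterm e v (Suc n + Suc i) \<le> 2 ^ Suc i * (exp (- e/2) ^ Suc i * pterm e v (Suc n))"
      by (intro mult_mono d2 pterm_high e v) (auto simp: pterm_pos less_imp_le)
    thus "\<bar>d (Suc n + Suc i) * pterm e v (Suc n + Suc i)\<bar> \<le> X ^ Suc i * pterm e v (Suc n)"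
      using pterm_pos[of e v] by (simp add: abs_mult abs_of_pos X_def power_mult_distrib mult_ac)
  qed
  also have "\<dots> \<le> cell_err e * pterm e v (Suc n)"
    unfolding sum_distrib_right[symmetric] by (intro mult_right_mono geo) (simp add: pterm_pos less_imp_le)
  finally have 2: "\<bar>\<Sum>i<M. d (Suc n + Suc i) * pterm e v (Suc n + Suc i)\<bar> \<le> cell_err e * pterm e v (Suc n)" .
  show ?thesis unfolding spl using 1 2 by (simp add: distrib_left)
qed

context sign_seq begin

lemma ptr_sums: "e > 0 \<Longrightarrow> (\<lambda>j. c j * pterm e v j) sums ptr c e v"
  unfolding ptr_def pterm_def by (rule summable_sums[OF summable_ptr])

definition dptr :: "real \<Rightarrow> real \<Rightarrow> real" where
  "dptr e v = Re (deriv (pt c (of_real e)) (of_real v))"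

lemma DERIV_ptr: "e > 0 \<Longrightarrow> (ptr c e has_real_derivative dptr e v) (at v)"
proof -
  assume e: "e > 0"
  have "pt c (of_real e) holomorphic_on UNIV" by (rule pt_holo) (use e in simp)
  hence "(pt c (of_real e) has_field_derivative deriv (pt c (of_real e)) (of_real v)) (at (of_real v))"
    by (rule holomorphic_derivI) auto
  hence "((\<lambda>x. pt c (of_real e) (of_real x)) has_vector_derivative deriv (pt c (of_real e)) (of_real v)) (at v)"
    by (rule has_vector_derivative_real_field)
  hence "((\<lambda>x. Re (pt c (of_real e) (of_real x))) has_real_derivative Re (deriv (pt c (of_real e)) (of_real v))) (at v)"
    unfolding has_real_derivative_iff_has_vector_derivative
    by (rule bounded_linear.has_vector_derivative[OF bounded_linear_Re])
  thus ?thesis by (simp add: dptr_def pt_of_real e)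
qed

lemma dptr_sums: "e > 0 \<Longrightarrow> (\<lambda>j. real j * c j * pterm e v j) sums dptr e v"
proof -
  assume e: "e > 0"
  have "(\<lambda>N. Re (\<Sum>j<N. of_nat j ^ 1 * ptt c j (of_real e) (of_real v))) \<longlonglongrightarrow> Re ((deriv ^^ 1) (pt c (of_real e)) (of_real v))"
    by (intro tendsto_Re moment_tendsto e)
  thus ?thesis by (simp add: sums_def dptr_def ptt_of_real pterm_def mult.assoc)
qed

text \<open>The second bound is the same estimate for the coefficients \<open>(j - n) * c j\<close>:
  subtracting \<open>n\<close> times the series removes the term \<open>n\<close> and leaves the
  term \<open>n + 1\<close> with weight 1.\<close>

lemma two_term:
  assumes e: "e \<ge> 10" and v: "real n * e \<le> v" "v \<le> (real n + 1) * e"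
  shows "\<bar>ptr c e v - c n * pterm e v n - c (Suc n) * pterm e v (Suc n)\<bar> \<le> cell_err e * (pterm e v n + pterm e v (Suc n))"
    and "\<bar>dptr e v - real n * ptr c e v - c (Suc n) * pterm e v (Suc n)\<bar> \<le> cell_err e * (pterm e v n + pterm e v (Suc n))"
proof -
  have e0: "e > 0" using e by simp
  have lim: "\<bar>s - d n * pterm e v n - d (Suc n) * pterm e v (Suc n)\<bar> \<le> cell_err e * (pterm e v n + pterm e v (Suc n))"
    if s: "(\<lambda>j. d j * pterm e v j) sums s"
      and d1: "\<And>i. 1 \<le> i \<Longrightarrow> i \<le> n \<Longrightarrow> \<bar>d (n - i)\<bar> \<le> 2^i" and d2: "\<And>i. 1 \<le> i \<Longrightarrow> \<bar>d (Suc n + i)\<bar> \<le> (2::real)^i" for d s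
  proof (rule LIMSEQ_le_const2)
    have "(\<lambda>N. \<Sum>j<N. d j * pterm e v j) \<longlonglongrightarrow> s" using s by (simp add: sums_def)
    hence "(\<lambda>M. \<Sum>j<M + (n + 2). d j * pterm e v j) \<longlonglongrightarrow> s" by (rule LIMSEQ_ignore_initial_segment)
    thus "(\<lambda>M. \<bar>(\<Sum>j<n + 2 + M. d j * pterm e v j) - d n * pterm e v n - d (Suc n) * pterm e v (Suc n)\<bar>)
        \<longlonglongrightarrow> \<bar>s - d n * pterm e v n - d (Suc n) * pterm e v (Suc n)\<bar>"
      by (intro tendsto_intros) (simp add: add_ac)
  qed (use two_term_partial[OF e v d1 d2] in blast)
  show "\<bar>ptr c e v - c n * pterm e v n - c (Suc n) * pterm e v (Suc n)\<bar> \<le> cell_err e * (pterm e v n + pterm e v (Suc n))"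
    by (rule lim[OF ptr_sums[OF e0]]) (auto simp: c_abs)
  have "(\<lambda>j. real j * c j * pterm e v j - real n * (c j * pterm e v j)) sums (dptr e v - real n * ptr c e v)"
    by (intro sums_diff sums_mult dptr_sums ptr_sums e0)
  hence s: "(\<lambda>j. ((real j - real n) * c j) * pterm e v j) sums (dptr e v - real n * ptr c e v)"
    by (simp add: algebra_simps)
  have i2: "real i \<le> 2^i" "1 + real i \<le> 2^i" if "1 \<le> i" for i
  proof -
    have "Suc i \<le> 2^i" using that by (induction i rule: dec_induct) auto
    hence "real (Suc i) \<le> real (2^i)" by (rule of_nat_mono)
    thus "real i \<le> 2^i" "1 + real i \<le> 2^i" by auto
  qed
  show "\<bar>dptr e v - real n * ptr c e v - c (Suc n) * pterm e v (Suc n)\<bar> \<le> cell_err e * (pterm e v n + pterm e v (Suc n))"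
    using lim[OF s] i2 by (simp add: abs_mult c_abs)
qed

lemma two_term_sign:
  fixes P a b E s s' :: real
  assumes "\<bar>P - s * a - s' * b\<bar> \<le> E" "E \<le> 1/10 * (a + b)" "s = 1 \<or> s = -1" "s' = - s" "0 < a" "0 < b"
  shows "2 * b \<le> a \<Longrightarrow> s * P > 0" "2 * a \<le> b \<Longrightarrow> s * P < 0"
proof -
  have "10 * E \<le> a + b" using assms(2) by simp
  thus "2 * b \<le> a \<Longrightarrow> s * P > 0" "2 * a \<le> b \<Longrightarrow> s * P < 0" using assms(1,3-6) by (auto simp: abs_le_iff)
qed

lemma c_cases: "c j = 1 \<or> c j = -1" using c_abs[of j] by (auto simp: abs_if split: if_splits)

lemma cell_same:
  assumes e: "e \<ge> 10" and v: "real n * e \<le> v" "v \<le> (real n + 1) * e" and cc: "c (Suc n) = c n"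
  shows "ptr c e v \<noteq> 0"
proof
  assume z: "ptr c e v = 0"
  have "\<bar>c n * (pterm e v n + pterm e v (Suc n))\<bar> \<le> cell_err e * (pterm e v n + pterm e v (Suc n))"
    using two_term(1)[OF e v] unfolding z cc by (simp add: distrib_left abs_minus_commute)
  hence "pterm e v n + pterm e v (Suc n) \<le> cell_err e * (pterm e v n + pterm e v (Suc n))"
    using pterm_pos[of e v n] pterm_pos[of e v "Suc n"] by (simp add: abs_mult c_abs)
  also have "\<dots> \<le> 1/10 * (pterm e v n + pterm e v (Suc n))"
    using cell_err_bounds[OF e] pterm_pos[of e v n] pterm_pos[of e v "Suc n"] by (intro mult_right_mono) auto
  finally show False using pterm_pos[of e v n] pterm_pos[of e v "Suc n"] by simp
qed

lemma pterm_ratio: "pterm e v (Suc n) = exp (v - (real n + 1/2) * e) * pterm e v n"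
  unfolding pterm_def exp_add[symmetric] by (rule arg_cong[of _ _ exp]) (simp add: power2_eq_square field_simps)

text \<open>At a zero the two dominant terms nearly cancel, so their ratio \<open>R\<close> lies
  between 9/11 and 11/9. This puts the zero near the midpoint of the cell, and the term
  \<open>n + 1\<close> dominates the derivative, which makes the zero simple.\<close>

lemma cell_zero:
  assumes e: "e \<ge> 10" and v: "real n * e \<le> v" "v \<le> (real n + 1) * e" and cc: "c (Suc n) = - c n"
    and z: "ptr c e v = 0"
  shows "\<bar>exp (v - (real n + 1/2) * e) - 1\<bar> \<le> cell_err e * (1 + exp (v - (real n + 1/2) * e))"
    and "exp (v - (real n + 1/2) * e) \<ge> 1/2"
    and "zorder (pt c (of_real e)) (of_real v) = 1"
    and "real n * e < v" "v < (real n + 1) * e"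
proof -
  define R where "R = exp (v - (real n + 1/2) * e)"
  define T where "T = pterm e v n"
  have T: "T > 0" by (simp add: T_def pterm_pos)
  have e0: "e > 0" using e by simp
  have TS: "pterm e v (Suc n) = R * T" unfolding R_def T_def by (rule pterm_ratio)
  have "\<bar>c n * ((R - 1) * T)\<bar> \<le> cell_err e * ((1 + R) * T)"
    using two_term(1)[OF e v] unfolding z cc TS T_def[symmetric] by (simp add: algebra_simps)
  hence "\<bar>R - 1\<bar> * T \<le> (cell_err e * (1 + R)) * T" using T by (simp add: abs_mult c_abs)
  hence R: "\<bar>R - 1\<bar> \<le> cell_err e * (1 + R)" using T by (simp add: mult_le_cancel_right)
  thus "\<bar>exp (v - (real n + 1/2) * e) - 1\<bar> \<le> cell_err e * (1 + exp (v - (real n + 1/2) * e))" by (simp add: R_def)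
  have Rp: "R > 0" by (simp add: R_def)
  have "cell_err e * (1 + R) \<le> 1/10 * (1 + R)" using cell_err_bounds[OF e] Rp by (intro mult_right_mono) auto
  hence R2: "\<bar>R - 1\<bar> \<le> 1/10 * (1 + R)" using R by simp
  have "R - 1 \<le> 1/10 * (1 + R)" "- (R - 1) \<le> 1/10 * (1 + R)"
    using R2 order_trans[OF abs_ge_self] order_trans[OF abs_ge_minus_self] by blast+
  hence "9 * R \<le> 11" "9 \<le> 11 * R" by simp_all
  hence R1: "R \<ge> 1/2" "R \<le> 2" by linarith+
  thus "exp (v - (real n + 1/2) * e) \<ge> 1/2" by (simp add: R_def)
  have "\<bar>dptr e v - c (Suc n) * (R * T)\<bar> \<le> cell_err e * (1 + R) * T"
    using two_term(2)[OF e v] unfolding z TS T_def[symmetric] by (simp add: algebra_simps)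
  also have "\<dots> \<le> 1/10 * (1 + R) * T" using cell_err_bounds[OF e] Rp T by (intro mult_right_mono) auto
  also have "\<dots> < R * T" using R1 T by (simp add: mult_less_cancel_right)
  finally have "dptr e v \<noteq> 0"
    using T Rp by (auto simp: abs_mult c_abs)
  hence d: "deriv (pt c (of_real e)) (of_real v) \<noteq> 0" by (auto simp: dptr_def)
  show "zorder (pt c (of_real e)) (of_real v) = 1"
  proof (rule zorder_zero_eqI[of _ UNIV])
    show "pt c (of_real e) holomorphic_on UNIV" by (rule pt_holo) (use e0 in simp)
  qed (use d z pt_of_real[OF e0, of v] in auto)
  have r5: "exp (5::real) > 2" using exp_ge_add_one_self[of "5::real"] by simp
  have b: "v - (real n + 1/2) * e > -5" 
  proof (rule ccontr)
    assume "\<not> ?thesis"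
    hence "R \<le> exp (-5)" by (simp add: R_def)
    also have "\<dots> < 1/2" using r5 by (simp add: exp_minus field_simps)
    finally show False using R1 by simp
  qed
  have b': "v - (real n + 1/2) * e < 5"
  proof (rule ccontr)
    assume "\<not> ?thesis"
    hence "exp 5 \<le> R" by (simp add: R_def)
    thus False using R1 r5 by simp
  qed
  show "real n * e < v" "v < (real n + 1) * e" using b b' e by (auto simp: algebra_simps)
qed

text \<open>Up to sign, \<open>exp (- n x) * ptr c e x\<close> increases to the right of any zero in
  the cell: from there on the term \<open>n + 1\<close> is at least half the term \<open>n\<close>
  and governs the derivative.\<close>

lemma cell_unique:
  assumes e: "e \<ge> 10" and cc: "c (Suc n) = - c n"
    and v: "real n * e \<le> v" "v \<le> (real n + 1) * e" "ptr c e v = 0"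
    and w: "real n * e \<le> w" "w \<le> (real n + 1) * e" "ptr c e w = 0"
  shows "v = w"
proof -
  have False if v: "real n * e \<le> v" "v \<le> (real n + 1) * e" "ptr c e v = 0"
    and w: "real n * e \<le> w" "w \<le> (real n + 1) * e" "ptr c e w = 0" and vw: "v < w" for v w
  proof -
    have e0: "e > 0" using e by simp
    define g where "g x = c (Suc n) * (ptr c e x * exp (- real n * x))" for x
    have dg: "(g has_real_derivative c (Suc n) * (dptr e x - real n * ptr c e x) * exp (- real n * x)) (at x)" for x
      unfolding g_def by (auto intro!: derivative_eq_intros DERIV_ptr e0 simp: algebra_simps)
    have "g v < g w"
    proof (rule DERIV_pos_imp_increasing[OF vw])
      fix x assume x: "v \<le> x" "x \<le> w"
      have xc: "real n * e \<le> x" "x \<le> (real n + 1) * e" using x v w by auto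
      have "1/2 \<le> exp (v - (real n + 1/2) * e)" by (rule cell_zero(2)[OF e v(1,2) cc v(3)])
      also have "\<dots> \<le> exp (x - (real n + 1/2) * e)" using x by simp
      finally have "1/2 * pterm e x n \<le> pterm e x (Suc n)"
        unfolding pterm_ratio by (intro mult_right_mono) (auto simp: pterm_pos less_imp_le)
      moreover have "cell_err e * (pterm e x n + pterm e x (Suc n)) \<le> 1/10 * (pterm e x n + pterm e x (Suc n))"
        using cell_err_bounds[OF e] pterm_pos[of e x n] pterm_pos[of e x "Suc n"] by (intro mult_right_mono) auto
      moreover have "1/10 * (a + b) < b" if "1/2 * a \<le> b" "0 < b" for a b :: real using that by (simp add: field_simps)
      ultimately have "cell_err e * (pterm e x n + pterm e x (Suc n)) < pterm e x (Suc n)"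
        using pterm_pos[of e x "Suc n"] by (meson le_less_trans)
      hence "\<bar>dptr e x - real n * ptr c e x - c (Suc n) * pterm e x (Suc n)\<bar> < pterm e x (Suc n)"
        using two_term(2)[OF e xc] by linarith
      hence "c (Suc n) * (dptr e x - real n * ptr c e x) > 0"
        using c_cases[of "Suc n"] by (auto simp: abs_less_iff)
      thus "\<exists>y. (g has_real_derivative y) (at x) \<and> 0 < y" using dg[of x] by (blast intro: mult_pos_pos exp_gt_zero)
    qed
    thus False using v w by (simp add: g_def)
  qed
  thus ?thesis using v w by (metis linorder_neqE_linordered_idom)
qed

lemma cell_exists:
  assumes e: "e \<ge> 10" and cc: "c (Suc n) = - c n"
  shows "\<exists>v. real n * e < v \<and> v < (real n + 1) * e \<and> ptr c e v = 0"
proof -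
  have e0: "e > 0" using e by simp
  have s0: "c n * ptr c e (real n * e) > 0"
  proof -
    let ?v = "real n * e"
    have "pterm e ?v (Suc n) = exp (- e/2) * pterm e ?v n" unfolding pterm_ratio by (simp add: algebra_simps)
    moreover have "exp (- e/2) < 1/2" using cell_err_bounds(3)[OF e] by simp
    ultimately have "pterm e ?v (Suc n) \<le> 1/2 * pterm e ?v n" using pterm_pos[of e ?v n] by (simp add: mult_right_mono)
    moreover have "cell_err e * (pterm e ?v n + pterm e ?v (Suc n)) \<le> 1/10 * (pterm e ?v n + pterm e ?v (Suc n))"
      using cell_err_bounds[OF e] pterm_pos[of e ?v n] pterm_pos[of e ?v "Suc n"] by (intro mult_right_mono) auto
    moreover have "\<bar>ptr c e ?v - c n * pterm e ?v n - c (Suc n) * pterm e ?v (Suc n)\<bar> \<le> cell_err e * (pterm e ?v n + pterm e ?v (Suc n))"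
      by (rule two_term(1)[OF e]) (use e0 in \<open>auto simp: algebra_simps\<close>)
    ultimately show ?thesis
      by (intro two_term_sign(1)[OF _ _ c_cases cc pterm_pos pterm_pos]) (assumption | simp)+
  qed
  have s1: "c n * ptr c e ((real n + 1) * e) < 0"
  proof -
    let ?v = "(real n + 1) * e"
    have "pterm e ?v (Suc n) = exp (e/2) * pterm e ?v n" unfolding pterm_ratio by (simp add: algebra_simps)
    moreover have "exp (e/2) \<ge> 2" using e exp_ge_add_one_self[of "e/2"] by linarith
    ultimately have "pterm e ?v (Suc n) \<ge> 2 * pterm e ?v n" using pterm_pos[of e ?v n] by (simp add: mult_right_mono)
    moreover have "cell_err e * (pterm e ?v n + pterm e ?v (Suc n)) \<le> 1/10 * (pterm e ?v n + pterm e ?v (Suc n))"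
      using cell_err_bounds[OF e] pterm_pos[of e ?v n] pterm_pos[of e ?v "Suc n"] by (intro mult_right_mono) auto
    moreover have "\<bar>ptr c e ?v - c n * pterm e ?v n - c (Suc n) * pterm e ?v (Suc n)\<bar> \<le> cell_err e * (pterm e ?v n + pterm e ?v (Suc n))"
      by (rule two_term(1)[OF e]) (use e0 in \<open>auto simp: algebra_simps\<close>)
    ultimately show ?thesis
      by (intro two_term_sign(2)[OF _ _ c_cases cc pterm_pos pterm_pos]) (assumption | simp)+
  qed
  have lt: "real n * e < (real n + 1) * e" using e0 by (simp add: algebra_simps)
  have cont: "continuous_on {real n * e..(real n + 1) * e} (\<lambda>v. c n * ptr c e v)"
    by (intro continuous_intros) (use e0 in auto)
  obtain v where v: "real n * e \<le> v" "v \<le> (real n + 1) * e" "c n * ptr c e v = 0"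
    using IVT2'[of "\<lambda>v. c n * ptr c e v" "(real n + 1) * e" 0 "real n * e"] s0 s1 lt cont by auto
  moreover have "ptr c e v = 0" using v(3) c_cases[of n] by auto
  ultimately show ?thesis using cell_zero(4,5)[OF e v(1,2) cc] by blast
qed

section \<open>Persistence of simple zeros\<close>

lemma simple_zero_deriv:
  assumes e: "e > 0" and z: "zorder (pt c (of_real e)) (of_real v) = 1"
  shows "dptr e v \<noteq> 0"
proof -
  have "deriv (pt c (of_real e)) (of_real v) \<noteq> 0"
    using higher_deriv_zorder(2)[OF e, of 1 "of_real v"] z by simp
  moreover have "deriv (pt c (of_real e)) (of_real v) \<in> \<real>" using moment_real[OF e, of 1 v] by simp
  ultimately show ?thesis by (auto simp: dptr_def complex_is_Real_iff complex_eq_iff)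
qed

lemma ptr_tendsto_e: "e0 > 0 \<Longrightarrow> ((\<lambda>e. ptr c e v) \<longlongrightarrow> ptr c e0 v) (at e0)"
proof -
  assume "e0 > 0"
  moreover have "continuous_on {0<..} (\<lambda>e. ptr c e v)" by (intro continuous_intros) auto
  ultimately show ?thesis by (auto simp: continuous_on_eq_continuous_at isCont_def)
qed

text \<open>At a simple zero the function changes sign, and its signs at two points close by survive
  a small change of \<open>e\<close> in either direction.\<close>

lemma simple_zero_persists:
  assumes e0: "e0 > 0" and z: "zorder (pt c (of_real e0)) (of_real v) = 1" and d: "d > 0"
  shows "\<forall>\<^sub>F e in at e0. \<exists>x\<in>{v - d<..<v + d}. ptr c e x = 0"
proof -
  have v0: "ptr c e0 v = 0"
    using zorder_pt(2)[OF e0, of "of_real v"] z pt_of_real[OF e0, of v] by simp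
  define D where "D = dptr e0 v"
  have D: "D \<noteq> 0" "((\<lambda>x. D * ptr c e0 x) has_real_derivative D * D) (at v)"
    using simple_zero_deriv[OF e0 z] by (auto simp: D_def intro!: DERIV_cmult DERIV_ptr e0)
  hence "D * D > 0" by (simp add: zero_less_mult_iff) linarith
  then obtain d1 where d1: "d1 > 0" "\<And>h. 0 < h \<Longrightarrow> h < d1 \<Longrightarrow> D * ptr c e0 v < D * ptr c e0 (v + h)"
    using DERIV_pos_inc_right[OF D(2)] by blast
  obtain d2 where d2: "d2 > 0" "\<And>h. 0 < h \<Longrightarrow> h < d2 \<Longrightarrow> D * ptr c e0 (v - h) < D * ptr c e0 v"
    using DERIV_pos_inc_left[OF D(2)] \<open>D * D > 0\<close> by blast
  define h where "h = min (min d1 d2) d / 2"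
  have h: "0 < h" "h < d1" "h < d2" "h < d" using d1(1) d2(1) d by (auto simp: h_def min_def)
  have p: "D * ptr c e0 (v + h) > 0" "D * ptr c e0 (v - h) < 0"
    using d1(2)[OF h(1,2)] d2(2)[OF h(1,3)] v0 by auto
  have t: "((\<lambda>e. D * ptr c e (v + h)) \<longlongrightarrow> D * ptr c e0 (v + h)) (at e0)"
    "((\<lambda>e. D * ptr c e (v - h)) \<longlongrightarrow> D * ptr c e0 (v - h)) (at e0)"
    by (intro tendsto_mult_left ptr_tendsto_e e0)+
  note order_tendstoD(1)[OF t(1) p(1)] order_tendstoD(2)[OF t(2) p(2)]
  moreover have "\<forall>\<^sub>F e in at e0. e > 0" using e0 order_tendstoD(1)[OF tendsto_ident_at] by blast
  ultimately show ?thesis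
  proof eventually_elim
    case (elim e)
    have "continuous_on {v - h..v + h} (\<lambda>x. D * ptr c e x)" by (intro continuous_intros) (use elim in auto)
    then obtain x where "v - h \<le> x" "x \<le> v + h" "D * ptr c e x = 0"
      using IVT'[of "\<lambda>x. D * ptr c e x" "v - h" 0 "v + h"] elim h by auto
    thus ?case using D(1) h by (intro bexI[of _ x]) auto
  qed
qed

end

section \<open>Collision of the two zeros of a window\<close>

context zero_window begin

definition zeros :: "real \<Rightarrow> real set" where "zeros e = {v \<in> {l e..r e}. ptr c e v = 0}"

lemma finite_zeros: "e > 0 \<Longrightarrow> finite (zeros e)"
  unfolding zeros_def by (rule finite_zeros_ptr)

lemma Z_eq_sum: "Z e = (\<Sum>v\<in>zeros e. nat (zorder (pt c (of_real e)) (of_real v)))"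
  unfolding zcount_def zeros_def by (rule sum.cong) auto

lemma card_zeros_le: "e > 0 \<Longrightarrow> card (zeros e) \<le> Z e"
  unfolding zeros_def by (rule card_le_zcount[where l = "l e" and r = "r e"]) auto

lemma zeros_simple:
  assumes e: "e > 0" and eq: "card (zeros e) = Z e" and v: "v \<in> zeros e"
  shows "zorder (pt c (of_real e)) (of_real v) = 1"
proof -
  let ?f = "\<lambda>v. nat (zorder (pt c (of_real e)) (of_real v))"
  have ge: "1 \<le> ?f v" if "v \<in> zeros e" for v
    using zorder_ge_1[OF e] that by (auto simp: zeros_def)
  have "?f v = 1"
  proof (rule ccontr)
    assume "?f v \<noteq> 1"
    hence "1 < ?f v" using ge[OF v] by linarith
    hence "(\<Sum>v\<in>zeros e. 1) < (\<Sum>v\<in>zeros e. ?f v)"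
      by (intro sum_strict_mono_ex1 finite_zeros[OF e]) (use ge v in auto)
    thus False using eq by (simp add: Z_eq_sum)
  qed
  thus ?thesis by simp
qed

lemma zeros_interior: "e > 0 \<Longrightarrow> v \<in> zeros e \<Longrightarrow> l e < v \<and> v < r e"
  using nz_l[of e] nz_r[of e] by (auto simp: zeros_def le_less)

lemma window_ev:
  assumes e: "e > 0" and v: "l e < v" "v < r e"
  shows "\<exists>d>0. \<forall>\<^sub>F x in at e. {v - d<..<v + d} \<subseteq> {l x..r x}"
proof -
  define d where "d = min (v - l e) (r e - v) / 2"
  have d: "d > 0" "l e < v - d" "v + d < r e" using v by (auto simp: d_def min_def field_simps)
  have "(l \<longlongrightarrow> l e) (at e)" "(r \<longlongrightarrow> r e) (at e)"
    using cont_l cont_r e by (auto simp: continuous_on_eq_continuous_at isCont_def)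
  hence "\<forall>\<^sub>F x in at e. l x < v - d" "\<forall>\<^sub>F x in at e. v + d < r x"
    using d by (auto intro: order_tendstoD)
  hence "\<forall>\<^sub>F x in at e. {v - d<..<v + d} \<subseteq> {l x..r x}" by eventually_elim auto
  thus ?thesis using d by blast
qed

lemma simple_zero_near:
  assumes e: "e > 0" and v: "v \<in> zeros e" "zorder (pt c (of_real e)) (of_real v) = 1" and d: "d > 0"
  shows "\<forall>\<^sub>F x in at e. \<exists>w\<in>zeros x. \<bar>w - v\<bar> < d"
proof -
  obtain d' where d': "d' > 0" "\<forall>\<^sub>F x in at e. {v - d'<..<v + d'} \<subseteq> {l x..r x}"
    using window_ev[OF e] zeros_interior[OF e v(1)] by blast
  have "\<forall>\<^sub>F x in at e. \<exists>w\<in>{v - min d d'<..<v + min d d'}. ptr c x w = 0"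
    by (rule simple_zero_persists[OF e v(2)]) (use d d' in auto)
  with d'(2) show ?thesis
  proof eventually_elim
    case (elim x)
    then obtain w where w: "w \<in> {v - min d d'<..<v + min d d'}" "ptr c x w = 0" by blast
    hence "w \<in> {v - d'<..<v + d'}" "\<bar>w - v\<bar> < d" by (auto simp: min_def split: if_splits)
    moreover from this have "w \<in> zeros x" using w(2) elim(1) by (auto simp: zeros_def)
    ultimately show ?case by blast
  qed
qed

text \<open>Let \<open>b\<close> be the supremum of the times from \<open>e1\<close> on without two
  distinct zeros. By upper semicontinuity the count at \<open>b\<close> is still 2. If the two zeros
  were distinct they would be simple and persist on both sides of \<open>b\<close>, against the
  choice of \<open>b\<close>; hence they coincide.\<close>

lemma double_zero:
  assumes hi: "\<And>e. e \<ge> E \<Longrightarrow> card (zeros e) = 2 \<and> Z e = 2" and e1: "0 < e1" "Z e1 = 0"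
  obtains b v where "b > e1" "zeros b = {v}" "zorder (pt c (of_real b)) (of_real v) = 2"
    "\<forall>e>b. card (zeros e) = 2 \<and> Z e = 2"
proof -
  have Zle: "Z e \<le> 2" if "e > 0" for e
    using Z_mono[of e "max e E"] hi[of "max e E"] that by simp
  define D where "D = {e. e \<ge> e1 \<and> card (zeros e) \<noteq> 2}"
  have "card (zeros e1) = 0" using card_zeros_le[OF e1(1)] e1 by simp
  hence e1D: "e1 \<in> D" by (simp add: D_def)
  have bdd: "bdd_above D" using hi by (intro bdd_aboveI[of _ E]) (auto simp: D_def intro: ccontr)
  define b where "b = Sup D"
  have be1: "e1 \<le> b" unfolding b_def by (rule cSup_upper[OF e1D bdd])
  have b0: "b > 0" using be1 e1 by simp
  have up: "card (zeros e) = 2 \<and> Z e = 2" if "e > b" for e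
  proof -
    have "e \<notin> D" using that cSup_upper[OF _ bdd, of e] by (auto simp: b_def)
    hence "card (zeros e) = 2" using that be1 by (simp add: D_def)
    thus ?thesis using Zle[of e] card_zeros_le[of e] that b0 by simp
  qed
  have "\<forall>\<^sub>F x in at_right b. Z x \<le> Z b" using Z_usc[OF b0] by (simp add: eventually_at_split)
  moreover have "\<forall>\<^sub>F x in at_right b. x > b" by (simp add: eventually_at_right_less)
  ultimately have "\<forall>\<^sub>F x in at_right b. 2 \<le> Z b" by eventually_elim (use up in force)
  hence "2 \<le> Z b" by simp
  hence Zb: "Z b = 2" using Zle[OF b0] by simp
  have bgt: "b > e1" using be1 Zb e1 by (cases "b = e1") auto
  have card_b: "card (zeros b) \<noteq> 2"
  proof
    assume c2: "card (zeros b) = 2"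
    then obtain v1 v2 where v: "zeros b = {v1, v2}" "v1 \<noteq> v2" by (auto simp: card_2_iff)
    have s: "zorder (pt c (of_real b)) (of_real v1) = 1" "zorder (pt c (of_real b)) (of_real v2) = 1"
      using zeros_simple[OF b0] c2 Zb v by auto
    define d where "d = \<bar>v1 - v2\<bar> / 2"
    have d: "d > 0" using v by (simp add: d_def)
    have "\<forall>\<^sub>F x in at b. \<exists>w\<in>zeros x. \<bar>w - v1\<bar> < d" "\<forall>\<^sub>F x in at b. \<exists>w\<in>zeros x. \<bar>w - v2\<bar> < d"
      using simple_zero_near[OF b0 _ _ d] v s by auto
    moreover have "\<forall>\<^sub>F x in at b. x > e1" using bgt order_tendstoD(1)[OF tendsto_ident_at] by blast
    ultimately have "\<forall>\<^sub>F x in at b. x \<notin> D"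
    proof eventually_elim
      case (elim x)
      then obtain w1 w2 where w: "w1 \<in> zeros x" "\<bar>w1 - v1\<bar> < d" "w2 \<in> zeros x" "\<bar>w2 - v2\<bar> < d" by blast
      have "w1 \<noteq> w2"
      proof
        assume "w1 = w2"
        hence "\<bar>v1 - v2\<bar> < 2 * d" using w by linarith
        thus False by (simp add: d_def)
      qed
      hence "card {w1, w2} = 2" by simp
      moreover have "card {w1, w2} \<le> card (zeros x)"
        by (rule card_mono) (use w elim e1 finite_zeros in auto)
      moreover have "card (zeros x) \<le> 2" using card_zeros_le[of x] Zle[of x] elim e1 by simp
      ultimately show ?case by (simp add: D_def)
    qed
    then obtain \<delta> where \<delta>: "\<delta> > 0" "\<And>x. x \<noteq> b \<Longrightarrow> dist x b < \<delta> \<Longrightarrow> x \<notin> D"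
      by (auto simp: eventually_at)
    have "b - \<delta> < Sup D" using \<delta>(1) by (simp add: b_def)
    then obtain x where x: "x \<in> D" "b - \<delta> < x" using less_cSup_iff[of D "b - \<delta>"] e1D bdd by auto
    have "x \<le> b" unfolding b_def by (rule cSup_upper[OF x(1) bdd])
    moreover have "x \<noteq> b" using x(1) c2 by (auto simp: D_def)
    ultimately show False using \<delta>(2)[of x] x by (auto simp: dist_real_def)
  qed
  moreover have "card (zeros b) \<le> 2" using card_zeros_le[OF b0] Zb by simp
  moreover have "card (zeros b) \<noteq> 0"
    using Zb finite_zeros[OF b0] by (auto simp: Z_eq_sum)
  ultimately have "card (zeros b) = 1" by linarith
  then obtain v where v: "zeros b = {v}" by (auto simp: card_1_singleton_iff)
  have "nat (zorder (pt c (of_real b)) (of_real v)) = 2" using Zb by (simp add: Z_eq_sum v)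
  hence "zorder (pt c (of_real b)) (of_real v) = 2" by simp
  thus ?thesis using that[OF bgt v] up by blast
qed

text \<open>Away from \<open>v\<close> the function at time \<open>b\<close> is bounded below in
  modulus on a compact set slightly larger than the window, and at nearby times it differs from that
  by less than the bound.\<close>

lemma zeros_converge:
  assumes b: "b > 0" and v: "zeros b = {v}" and d: "d > 0"
  shows "\<forall>\<^sub>F x in at b. \<forall>w\<in>zeros x. \<bar>w - v\<bar> < d"
proof -
  obtain dd where dd: "dd > 0" "l b + dd < r b - dd"
    "zcount b {l b - dd..r b + dd} = Z b" "zcount b {l b + dd..r b - dd} = Z b"
    "\<forall>x. \<bar>x - l b\<bar> \<le> dd \<longrightarrow> ptr c b x \<noteq> 0" "\<forall>x. \<bar>x - r b\<bar> \<le> dd \<longrightarrow> ptr c b x \<noteq> 0"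
    "\<forall>\<^sub>F x in at b. \<bar>l x - l b\<bar> < dd \<and> \<bar>r x - r b\<bar> < dd"
    by (rule window_nbhd[OF b])
  define K where "K = {l b - dd..r b + dd} - {v - d<..<v + d}"
  have cK: "compact K" unfolding K_def by (intro compact_diff) auto
  have nzK: "ptr c b x \<noteq> 0" if x: "x \<in> K" for x
  proof
    assume 0: "ptr c b x = 0"
    have "x \<in> {l b..r b}"
    proof (rule ccontr)
      assume "x \<notin> {l b..r b}"
      hence "\<bar>x - l b\<bar> \<le> dd \<or> \<bar>x - r b\<bar> \<le> dd" using x by (auto simp: K_def)
      thus False using dd(5,6) 0 by blast
    qed
    hence "x \<in> zeros b" using 0 by (simp add: zeros_def)
    thus False using x v d by (auto simp: K_def)
  qed
  have "\<exists>m>0. \<forall>x\<in>K. m \<le> \<bar>ptr c b x\<bar>"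
  proof (cases "K = {}")
    case True thus ?thesis by (auto intro: exI[of _ 1])
  next
    case False
    have "continuous_on K (\<lambda>x. \<bar>ptr c b x\<bar>)" by (intro continuous_intros) (use b in auto)
    then obtain x0 where "x0 \<in> K" "\<forall>x\<in>K. \<bar>ptr c b x0\<bar> \<le> \<bar>ptr c b x\<bar>"
      using continuous_attains_inf[OF cK False] by blast
    thus ?thesis using nzK by (intro exI[of _ "\<bar>ptr c b x0\<bar>"]) auto
  qed
  then obtain m where m: "m > 0" "\<And>x. x \<in> K \<Longrightarrow> m \<le> \<bar>ptr c b x\<bar>" by blast
  have "compact (of_real ` K :: complex set)" by (intro compact_continuous_image cK continuous_intros)
  hence "\<forall>\<^sub>F e in at b. \<forall>w\<in>of_real ` K. norm (pt c (of_real e) w - pt c (of_real b) w) < m"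
    by (rule pt_close[OF b _ m(1)])
  moreover have "\<forall>\<^sub>F e in at b. e > 0" using b order_tendstoD(1)[OF tendsto_ident_at] by blast
  ultimately show ?thesis using dd(7)
  proof eventually_elim
    case (elim x)
    show ?case
    proof (rule ballI, rule ccontr)
      fix w assume w: "w \<in> zeros x" and nw: "\<not> \<bar>w - v\<bar> < d"
      have "w \<in> K" using w nw elim(3) by (auto simp: K_def zeros_def)
      hence "norm (pt c (of_real x) (of_real w) - pt c (of_real b) (of_real w)) < m" using elim(1) by blast
      moreover have "pt c (of_real x) (of_real w) = 0" using w pt_of_real[OF elim(2), of w] by (simp add: zeros_def)
      ultimately have "\<bar>ptr c b w\<bar> < m" by (simp add: pt_of_real[OF b])
      thus False using m(2)[OF \<open>w \<in> K\<close>] by simp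
    qed
  qed
qed

text \<open>After \<open>b\<close> each of the two simple zeros persists on its own, so the order is
  kept and minimum and maximum are continuous; at \<open>b\<close> both are squeezed to
  \<open>v\<close>.\<close>

lemma branches_continuous:
  assumes b: "b > 0" and v: "zeros b = {v}" and up: "\<forall>e>b. card (zeros e) = 2 \<and> Z e = 2"
  shows "continuous_on {b..} (\<lambda>e. Min (zeros e))" "continuous_on {b..} (\<lambda>e. Max (zeros e))"
proof -
  have ev: "\<forall>\<^sub>F x in at e within {b..}. \<bar>Min (zeros x) - Min (zeros e)\<bar> < d \<and> \<bar>Max (zeros x) - Max (zeros e)\<bar> < d"
    if e: "e \<ge> b" and d: "d > 0" for e d
  proof -
    have pos: "\<forall>\<^sub>F x in at e within {b..}. x \<ge> b"
      by (auto simp: eventually_at_filter)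
    have sub: "eventually P (at e within {b..})" if "eventually P (at e)" for P
      using that by (rule filter_leD[OF at_le, rotated]) simp
    show ?thesis
    proof (cases "e = b")
      case True
      have "\<forall>\<^sub>F x in at e within {b..}. \<forall>w\<in>zeros x. \<bar>w - v\<bar> < d"
        using sub zeros_converge[OF b v d] True by blast
      with pos show ?thesis
      proof eventually_elim
        case (elim x)
        have "zeros x \<noteq> {}"
        proof (cases "x = b")
          case False
          hence "card (zeros x) = 2" using up elim(1) by simp
          thus ?thesis by auto
        qed (simp add: v)
        hence "Min (zeros x) \<in> zeros x" "Max (zeros x) \<in> zeros x"
          using finite_zeros[of x] elim b by auto
        thus ?case using elim(2) True v by auto
      qed
    next
      case False
      hence eb: "e > b" "e > 0" using e b by auto
      obtain v1 v2 where v12: "zeros e = {v1, v2}" "v1 < v2"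
        using up eb(1) by (metis card_2_iff doubleton_eq_iff linorder_less_linear)
      have s: "zorder (pt c (of_real e)) (of_real v1) = 1" "zorder (pt c (of_real e)) (of_real v2) = 1"
        using zeros_simple[OF eb(2)] up eb v12 by auto
      define d' where "d' = min d ((v2 - v1) / 2)"
      have "d' \<le> (v2 - v1) / 2" unfolding d'_def by (rule min.cobounded2)
      hence d': "d' > 0" "d' \<le> d" "2 * d' \<le> v2 - v1" using d v12 by (auto simp: d'_def)
      have "\<forall>\<^sub>F x in at e. \<exists>w\<in>zeros x. \<bar>w - v1\<bar> < d'" "\<forall>\<^sub>F x in at e. \<exists>w\<in>zeros x. \<bar>w - v2\<bar> < d'"
        using simple_zero_near[OF eb(2) _ _ d'(1)] v12 s by auto
      moreover have "\<forall>\<^sub>F x in at e. x > b" using eb order_tendstoD(1)[OF tendsto_ident_at] by blast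
      ultimately have "\<forall>\<^sub>F x in at e. \<bar>Min (zeros x) - Min (zeros e)\<bar> < d \<and> \<bar>Max (zeros x) - Max (zeros e)\<bar> < d"
      proof eventually_elim
        case (elim x)
        then obtain w1 w2 where w: "w1 \<in> zeros x" "\<bar>w1 - v1\<bar> < d'" "w2 \<in> zeros x" "\<bar>w2 - v2\<bar> < d'" by blast
        have lt: "w1 < w2" using w d' by linarith
        have "zeros x = {w1, w2}"
          by (rule card_seteq[symmetric]) (use w lt up elim finite_zeros[of x] b in auto)
        hence "Min (zeros x) = w1" "Max (zeros x) = w2" using lt by auto
        moreover have "Min (zeros e) = v1" "Max (zeros e) = v2" using v12 by auto
        ultimately show ?case using w d' by auto
      qed
      thus ?thesis by (rule sub)
    qed
  qed
  have mn: "\<forall>\<^sub>F x in at e within {b..}. \<bar>Min (zeros x) - Min (zeros e)\<bar> < d"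
    and mx: "\<forall>\<^sub>F x in at e within {b..}. \<bar>Max (zeros x) - Max (zeros e)\<bar> < d" if "e \<ge> b" "d > 0" for e d
    by (rule eventually_mono[OF ev[OF that]], blast)+
  show "continuous_on {b..} (\<lambda>e. Min (zeros e))"
    unfolding continuous_on_def tendsto_iff dist_real_def using mn by blast
  show "continuous_on {b..} (\<lambda>e. Max (zeros e))"
    unfolding continuous_on_def tendsto_iff dist_real_def using mx by blast
qed

end

section \<open>Zeros as the modulus of q tends to 1\<close>

lemma at_right_0_pos: "\<forall>\<^sub>F e in at_right (0::real). 0 < e \<and> e < d" if "d > 0"
  using that by (auto simp: eventually_at_right_field intro!: exI[of _ d])

text \<open>The lower bound for the theta series carries a factor
  \<open>(1 - exp (- e/2))^2\<close>, of order \<open>e^2\<close>; an exponential gain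
  \<open>exp (a / e)\<close> has to beat it.\<close>

lemma exp_over_square_at_top:
  assumes a: "a > 0"
  shows "filterlim (\<lambda>e::real. e^2 * exp (a / e)) at_top (at_right 0)"
proof -
  have "filterlim (\<lambda>e::real. (a^3/64) * (a * inverse e)) at_top (at_right 0)"
    using a by (intro filterlim_tendsto_pos_mult_at_top[OF tendsto_const _ filterlim_tendsto_pos_mult_at_top[OF tendsto_const _ filterlim_inverse_at_top_right]]) auto
  moreover have "\<forall>\<^sub>F e in at_right 0. (a^3/64) * (a * inverse e) \<le> e^2 * exp (a / e)"
    using at_right_0_pos[of 1, simplified]
  proof eventually_elim
    case (elim e)
    define z where "z = a / e"
    have z: "z > 0" using a elim by (simp add: z_def)
    have "z^4 / 64 = ((z/2)^2 / 2)^2" by (simp add: power2_eq_square power4_eq_xxxx)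
    also have "\<dots> \<le> exp (z/2) ^ 2"
      using exp_lower_Taylor_quadratic[of "z/2"] z by (intro power_mono) auto
    also have "\<dots> = exp z" by (simp add: power2_eq_square flip: exp_add)
    finally have "z^4 / 64 \<le> exp z" .
    hence "e^2 * (z^4 / 64) \<le> e^2 * exp z" by (intro mult_left_mono) auto
    moreover have "a^3/64 * (a * inverse e) \<le> e^2 * (z^4 / 64)"
    proof -
      have "e^2 * (z^4 / 64) = a^4 / (64 * e^2)" using elim by (simp add: z_def field_simps power2_eq_square power4_eq_xxxx)
      also have "\<dots> \<ge> a^4 / (64 * e)"
        using elim a by (intro divide_left_mono) (auto simp: power2_eq_square mult_le_cancel_left1)
      moreover have "a^4 / (64 * e) = a^3/64 * (a * inverse e)" using elim by (simp add: field_simps power4_eq_xxxx power3_eq_cube)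
      ultimately show ?thesis by linarith
    qed
    ultimately show ?case by (simp add: z_def)
  qed
  ultimately show ?thesis by (rule filterlim_at_top_mono)
qed

lemma exp_neg_over_tendsto:
  assumes "a > 0"
  shows "((\<lambda>e::real. exp (- (a / e))) \<longlongrightarrow> 0) (at_right 0)"
proof -
  have "filterlim (\<lambda>e::real. a * inverse e) at_top (at_right 0)"
    using assms by (intro filterlim_tendsto_pos_mult_at_top[OF tendsto_const _ filterlim_inverse_at_top_right]) auto
  hence "filterlim (\<lambda>e::real. - (a / e)) at_bot (at_right 0)"
    by (simp add: filterlim_uminus_at_bot divide_inverse)
  thus ?thesis by (rule filterlim_compose[OF exp_at_bot])
qed

context sign_seq begin

lemma ptr_abs_le:
  assumes e: "e > 0" and v: "v < 0"
  shows "\<bar>ptr c e v\<bar> \<le> 1 / (1 - exp v)"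
proof -
  have "\<bar>ptr c e v\<bar> \<le> (\<Sum>j. exp v ^ j)"
    unfolding ptr_def real_norm_def[symmetric]
  proof (rule norm_suminf_le)
    fix j
    have "exp (real j * v - e * (real j)^2 / 2) \<le> exp (real j * v)" using e by simp
    thus "norm (c j * exp (real j * v - e * (real j)^2 / 2)) \<le> exp v ^ j"
      by (simp add: abs_mult c_abs exp_of_nat_mult)
  qed (use v in \<open>auto intro: summable_geometric\<close>)
  also have "\<dots> = 1 / (1 - exp v)" by (rule suminf_geometric) (use v in simp)
  finally show ?thesis .
qed

text \<open>With \<open>y = exp (v + e/2)\<close> the term of index \<open>j\<close> is
  \<open>y ^ j\<close> times \<open>exp (- e j (j + 1) / 2)\<close>, so for
  \<open>y \<le> r1 < 1\<close> the deviation from the power series is at most \<open>e * C\<close>.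
  Compactness of \<open>{r0..r1}\<close> makes the positive lower bound uniform.\<close>

lemma ptr_uniform_limit:
  assumes r: "0 < r0" "r0 \<le> r1" "r1 < 1" and pos: "\<And>y. 0 < y \<Longrightarrow> y < 1 \<Longrightarrow> (\<Sum>j. c j * y^j) > 0"
  shows "\<exists>b>0. \<forall>\<^sub>F e in at_right 0. \<forall>v. r0 \<le> exp (v + e/2) \<and> exp (v + e/2) \<le> r1 \<longrightarrow> ptr c e v \<ge> b"
proof -
  have sm: "summable (\<lambda>j. c j * y^j)" if "\<bar>y\<bar> < 1" for y :: real
    by (rule summable_comparison_test'[OF summable_geometric[of "\<bar>y\<bar>"]]) (use that in \<open>auto simp: abs_mult c_abs power_abs\<close>)
  have "continuous_on {r0..r1} (\<lambda>y. \<Sum>j. c j * y^j)"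
  proof (rule continuous_at_imp_continuous_on, rule ballI)
    fix y assume "y \<in> {r0..r1}"
    thus "isCont (\<lambda>y. \<Sum>j. c j * y^j) y"
      using r by (intro isCont_powser[of c "(1 + r1)/2"] sm) auto
  qed
  then obtain y0 where y0: "y0 \<in> {r0..r1}" "\<forall>y\<in>{r0..r1}. (\<Sum>j. c j * y0^j) \<le> (\<Sum>j. c j * y^j)"
    using continuous_attains_inf[of "{r0..r1}"] r by fastforce
  define b where "b = (\<Sum>j. c j * y0^j) / 2"
  have b: "b > 0" using pos[of y0] y0 r by (simp add: b_def)
  have sm2: "summable (\<lambda>j. real (Suc j) * real (Suc (Suc j)) * r1 ^ j)"
  proof -
    have "summable (\<lambda>n. diffs (diffs (\<lambda>n. 1 :: real)) n * r1^n)"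
    proof (rule termdiff_converges[of _ 1])
      fix x :: real assume "norm x < 1"
      thus "summable (\<lambda>n. diffs (\<lambda>n. 1) n * x^n)"
        by (intro termdiff_converges[of _ 1]) (auto intro: summable_geometric)
    qed (use r in auto)
    thus ?thesis by (simp add: diffs_def mult_ac)
  qed
  define C where "C = (\<Sum>j. real (Suc j) * real (Suc (Suc j)) * r1 ^ j)"
  have "C \<ge> 0" unfolding C_def by (intro suminf_nonneg sm2) (use r in auto)
  have diff: "\<bar>ptr c e v - (\<Sum>j. c j * y^j)\<bar> \<le> e * C"
    if e: "e > 0" and y: "y = exp (v + e/2)" "y \<le> r1" for e v y
  proof -
    have yp: "y > 0" using y by simp
    have tm: "exp (real j * v - e * (real j)^2 / 2) = exp (- (e * (real j * real (Suc j) / 2))) * y^j" for j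
      unfolding y(1) exp_of_nat_mult[symmetric] exp_add[symmetric]
      by (rule arg_cong[of _ _ exp]) (simp add: field_simps power2_eq_square)
    have "ptr c e v - (\<Sum>j. c j * y^j) = (\<Sum>j. c j * exp (real j * v - e * (real j)^2 / 2) - c j * y^j)"
    proof -
      have "\<bar>y\<bar> < 1" using y(2) yp r by linarith
      thus ?thesis unfolding ptr_def by (intro suminf_diff summable_ptr e sm)
    qed
    also have "norm \<dots> \<le> (\<Sum>j. e * (real (Suc j) * real (Suc (Suc j)) * r1 ^ j))"
    proof (rule norm_suminf_le)
      show "summable (\<lambda>j. e * (real (Suc j) * real (Suc (Suc j)) * r1 ^ j))" by (intro summable_mult sm2)
      fix j
      define s where "s = e * (real j * real (Suc j) / 2)"
      have s: "0 \<le> s" "s \<le> e * (real (Suc j) * real (Suc (Suc j)))"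
        using e by (auto simp: s_def intro!: mult_left_mono mult_mono)
      have "\<bar>exp (- s) - 1\<bar> \<le> s" using exp_ge_add_one_self[of "- s"] s by simp
      hence "\<bar>exp (- s) - 1\<bar> * y^j \<le> (e * (real (Suc j) * real (Suc (Suc j)))) * r1^j"
        using s y yp by (intro mult_mono power_mono) auto
      moreover have "norm (c j * exp (real j * v - e * (real j)^2 / 2) - c j * y^j) = \<bar>exp (- s) - 1\<bar> * y^j"
      proof -
        have "c j * exp (real j * v - e * (real j)^2 / 2) - c j * y^j = c j * ((exp (- s) - 1) * y^j)"
          unfolding tm s_def by (simp add: algebra_simps)
        thus ?thesis using yp by (simp add: abs_mult c_abs)
      qed
      ultimately show "norm (c j * exp (real j * v - e * (real j)^2 / 2) - c j * y^j) \<le> e * (real (Suc j) * real (Suc (Suc j)) * r1 ^ j)"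
        by (simp add: mult.assoc)
    qed
    also have "\<dots> = e * C" unfolding C_def by (rule suminf_mult[OF sm2])
    finally show ?thesis by simp
  qed
  have bC: "b / (C + 1) > 0" using b \<open>C \<ge> 0\<close> by simp
  have "\<forall>\<^sub>F e in at_right 0. \<forall>v. r0 \<le> exp (v + e/2) \<and> exp (v + e/2) \<le> r1 \<longrightarrow> ptr c e v \<ge> b"
    using at_right_0_pos[OF bC]
  proof eventually_elim
    case (elim e)
    have "e * C \<le> e * (C + 1)" using elim by simp
    also have "\<dots> \<le> b" using elim \<open>C \<ge> 0\<close> by (simp add: field_simps)
    finally have eC: "e * C \<le> b" .
    show ?case
    proof (intro allI impI)
      fix v assume v: "r0 \<le> exp (v + e/2) \<and> exp (v + e/2) \<le> r1"
      have "2 * b \<le> (\<Sum>j. c j * exp (v + e/2)^j)" using y0(2) v by (auto simp: b_def)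
      thus "ptr c e v \<ge> b" using diff[of e "exp (v + e/2)" v] elim v eC by (auto simp: abs_le_iff)
    qed
  qed
  thus ?thesis using b by blast
qed

end

text \<open>\<open>Psi\<close> is the two-sided theta series, \<open>(d k + o1) e\<close> are the grid points at which its sign
  alternates, and the grid points of index \<open>2 s + kap\<close> bound the windows. The two zeros of the window
  number \<open>s\<close> lie, for large \<open>e\<close>, between \<open>n e\<close> and \<open>(n + 1) e\<close> with \<open>n = n1 s\<close> and \<open>n = n2 s\<close>.\<close>
locale theta_pattern = sign_seq c for c +
  fixes d :: nat and o1 :: real and al :: real and vs :: real and kap :: nat
    and Psi :: "real \<Rightarrow> real \<Rightarrow> real" and n1 n2 :: "nat \<Rightarrow> nat"
  assumes d: "d \<ge> 1" and al: "al > 3/2" and vs: "\<bar>vs\<bar> = 1" and o1: "\<bar>o1\<bar> \<le> 1/2"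
    and split: "e > 0 \<Longrightarrow> ptr c e v = Psi e v + vs * exp (- e/2 - v) * ptr c e (- v - e)"
    and Psi_grid: "e > 0 \<Longrightarrow> Psi e ((real d * real k + o1) * e) =
       (-1)^k * exp ((((real d * real k + o1) * e)^2 - (o1 * e)^2) / (2 * e)) * Psi e (o1 * e)"
    and Psi_lower: "e > 0 \<Longrightarrow> (1 - exp (- e/2))^2 * exp (- (al^2 / (2 * e))) \<le> Psi e (o1 * e)"
    and Psi_upper: "\<eta> > 0 \<Longrightarrow> \<forall>\<^sub>F e in at_right 0. \<forall>v\<ge>e. \<bar>Psi e v\<bar> \<le> exp ((v^2 - al^2 + \<eta>) / (2 * e))"
    and barrier: "e > 0 \<Longrightarrow> 0 < (-1)^kap * ptr c e ((real d * real (2 * s + kap) + o1) * e)"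
    and left_pos: "e > 0 \<Longrightarrow> v \<le> -1 \<Longrightarrow> ptr c e v > 0"
    and low: "e > 0 \<Longrightarrow> zcount e {-1..(real d * real kap + o1) * e} \<le> 1"
    and limit_pos: "0 < y \<Longrightarrow> y < 1 \<Longrightarrow> (\<Sum>j. c j * y^j) > 0"
    and cs: "real d * real (2 * s + kap) + o1 < real n + 1 \<Longrightarrow> real n < real d * real (2 * s + 2 + kap) + o1 \<Longrightarrow>
             n \<noteq> n1 s \<Longrightarrow> n \<noteq> n2 s \<Longrightarrow> c (Suc n) = c n"
    and cd1: "c (Suc (n1 s)) = - c (n1 s)" and cd2: "c (Suc (n2 s)) = - c (n2 s)" and n12: "n1 s < n2 s"
    and n1_ge: "real d * real (2 * s + kap) + o1 \<le> real (n1 s)"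
    and n2_le: "real (n2 s) + 1 \<le> real d * real (2 * s + 2 + kap) + o1"
    and g_nonneg: "real d * real kap + o1 \<ge> 0"
begin

section \<open>Windows between grid points and the zeros they hold\<close>

definition grid :: "nat \<Rightarrow> real \<Rightarrow> real" where "grid k e = (real d * real k + o1) * e"

lemma grid_mono: "e > 0 \<Longrightarrow> k \<le> m \<Longrightarrow> grid k e \<le> grid m e"
  unfolding grid_def by (intro mult_right_mono add_right_mono mult_left_mono) auto

lemma barrier': "e > 0 \<Longrightarrow> 0 < (-1)^kap * ptr c e (grid (2 * s + kap) e)"
  unfolding grid_def by (rule barrier)

lemma barrier_nz: "e > 0 \<Longrightarrow> ptr c e (grid (2 * s + kap) e) \<noteq> 0"
  using barrier'[of e s] by auto

definition lw :: "nat \<Rightarrow> real \<Rightarrow> real" where "lw s e = grid (2 * s + kap) e"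

lemma lw_eq: "lw s e = (real d * real (2 * s + kap) + o1) * e"
  by (simp add: lw_def grid_def)

lemma lw_Suc_eq: "lw (Suc s) e = (real d * real (2 * s + 2 + kap) + o1) * e"
  by (simp add: lw_def grid_def)

lemma lw_Suc: "lw (Suc s) e = lw s e + 2 * real d * e"
  by (simp add: lw_def grid_def algebra_simps)

lemma lw_mono: "e > 0 \<Longrightarrow> s \<le> s' \<Longrightarrow> lw s e \<le> lw s' e"
  unfolding lw_def by (rule grid_mono) auto

lemma lw_nz: "e > 0 \<Longrightarrow> ptr c e (lw s e) \<noteq> 0"
  unfolding lw_def by (rule barrier_nz)

lemma window: "zero_window c (lw s) (lw (Suc s))"
proof unfold_locales
  fix e :: real assume e: "e > 0"
  show "lw s e < lw (Suc s) e" using e d by (simp add: lw_Suc)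
qed (auto simp: lw_nz, auto simp: lw_eq intro!: continuous_intros)

text \<open>For large \<open>e\<close> zeros lie only in cells whose two dominant terms have
  opposite signs, one in each. The hypotheses on \<open>n1\<close> and \<open>n2\<close> say that a
  window meets exactly two such cells.\<close>

lemma window_initial:
  assumes e: "e \<ge> 10"
  obtains v1 v2 where "zero_window.zeros c (lw s) (lw (Suc s)) e = {v1, v2}"
    "real (n1 s) * e < v1" "v1 < (real (n1 s) + 1) * e" "real (n2 s) * e < v2" "v2 < (real (n2 s) + 1) * e"
    "v1 < v2" "zorder (pt c (of_real e)) (of_real v1) = 1" "zorder (pt c (of_real e)) (of_real v2) = 1"
proof -
  interpret zero_window c "lw s" "lw (Suc s)" by (rule window)
  have e0: "e > 0" using e by simp
  obtain v1 where v1: "real (n1 s) * e < v1" "v1 < (real (n1 s) + 1) * e" "ptr c e v1 = 0"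
    using cell_exists[OF e cd1] by blast
  obtain v2 where v2: "real (n2 s) * e < v2" "v2 < (real (n2 s) + 1) * e" "ptr c e v2 = 0"
    using cell_exists[OF e cd2] by blast
  have "real (n1 s) + 1 \<le> real (n2 s)" using n12[of s] by simp
  hence "(real (n1 s) + 1) * e \<le> real (n2 s) * e" using e0 by (intro mult_right_mono) auto
  hence v12: "v1 < v2" using v1 v2 by linarith
  have a: "lw s e \<le> real (n1 s) * e" unfolding lw_eq using n1_ge[of s] e0 by (intro mult_right_mono) auto
  have b: "(real (n2 s) + 1) * e \<le> lw (Suc s) e" unfolding lw_Suc_eq using n2_le[of s] e0 by (intro mult_right_mono) auto
  have "zeros e = {v1, v2}"
  proof (intro equalityI subsetI)
    fix v assume "v \<in> {v1, v2}"
    thus "v \<in> zeros e" using v1 v2 v12 a b by (auto simp: zeros_def)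
  next
    fix v assume v: "v \<in> zeros e"
    hence vi: "lw s e < v" "v < lw (Suc s) e" "ptr c e v = 0"
      using zeros_interior[OF e0 v] by (auto simp: zeros_def)
    have "real d * real (2 * s + kap) + o1 \<ge> real d * real kap + o1" by (simp add: mult_left_mono)
    hence "lw s e \<ge> 0" unfolding lw_eq using g_nonneg e0 by (intro mult_nonneg_nonneg) auto
    hence vp: "v > 0" using vi by simp
    define n where "n = nat \<lfloor>v / e\<rfloor>"
    have n: "real n \<le> v / e" "v / e < real n + 1" using vp e0 by (auto simp: n_def of_nat_nat)
    hence nv: "real n * e \<le> v" "v \<le> (real n + 1) * e" using e0 by (auto simp: field_simps)
    have "(real d * real (2 * s + kap) + o1) * e < v" using vi(1) by (simp only: lw_eq)
    hence "real d * real (2 * s + kap) + o1 < v / e" using e0 by (simp add: field_simps)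
    hence c1: "real d * real (2 * s + kap) + o1 < real n + 1" using n by linarith
    have "v < (real d * real (2 * s + 2 + kap) + o1) * e" using vi(2) by (simp only: lw_Suc_eq)
    hence "v / e < real d * real (2 * s + 2 + kap) + o1" using e0 by (simp add: field_simps)
    hence c2: "real n < real d * real (2 * s + 2 + kap) + o1" using n by linarith
    have "n = n1 s \<or> n = n2 s" using cs[OF c1 c2] cell_same[OF e nv] vi(3) by blast
    thus "v \<in> {v1, v2}"
    proof
      assume "n = n1 s"
      thus ?thesis using cell_unique[OF e cd1[of s], of v v1] nv vi v1 by simp
    next
      assume "n = n2 s"
      thus ?thesis using cell_unique[OF e cd2[of s], of v v2] nv vi v2 by simp
    qed
  qed
  thus ?thesis
    using that v1 v2 v12 cell_zero(3)[OF e _ _ cd1[of s], of v1] cell_zero(3)[OF e _ _ cd2[of s], of v2] by simp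
qed

lemma window_hi: "e \<ge> 10 \<Longrightarrow> card (zero_window.zeros c (lw s) (lw (Suc s)) e) = 2 \<and> zcount e {lw s e..lw (Suc s) e} = 2"
proof -
  assume e: "e \<ge> 10"
  interpret zero_window c "lw s" "lw (Suc s)" by (rule window)
  obtain v1 v2 where v: "zeros e = {v1, v2}" "v1 < v2"
    "zorder (pt c (of_real e)) (of_real v1) = 1" "zorder (pt c (of_real e)) (of_real v2) = 1"
    by (rule window_initial[OF e, of s]) 
  thus ?thesis by (simp add: Z_eq_sum)
qed

text \<open>Any time lies below some time that is at least 10, where the window holds exactly two
  zeros.\<close>

lemma window_le: "e > 0 \<Longrightarrow> zcount e {lw s e..lw (Suc s) e} \<le> 2"
proof -
  assume e: "e > 0"
  interpret zero_window c "lw s" "lw (Suc s)" by (rule window)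
  show ?thesis using Z_mono[of e "max e 10"] window_hi[of "max e 10" s] e by simp
qed

lemma windows_le: "e > 0 \<Longrightarrow> zcount e {lw s e..lw (s + m) e} \<le> 2 * m + 2"
proof -
  assume e: "e > 0"
  have "zcount e {lw s e..lw (s + Suc m) e} \<le> 2 * Suc m" for m
  proof (induction m)
    case 0 thus ?case using window_le[OF e, of s] by simp
  next
    case (Suc m)
    have "{lw s e..lw (s + Suc (Suc m)) e} \<subseteq> {lw s e..lw (s + Suc m) e} \<union> {lw (s + Suc m) e..lw (Suc (s + Suc m)) e}"
      by auto
    hence "zcount e {lw s e..lw (s + Suc (Suc m)) e} \<le> zcount e ({lw s e..lw (s + Suc m) e} \<union> {lw (s + Suc m) e..lw (Suc (s + Suc m)) e})"
      by (rule zcount_mono[OF e, where l = "lw s e" and r = "lw (s + Suc (Suc m)) e"])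
         (auto intro: order_trans[OF lw_mono[OF e]] order_trans[OF _ lw_mono[OF e]])
    also have "\<dots> \<le> zcount e {lw s e..lw (s + Suc m) e} + zcount e {lw (s + Suc m) e..lw (Suc (s + Suc m)) e}"
      by (rule zcount_Un_le[OF e, where l = "lw s e" and r = "lw (s + Suc (Suc m)) e"])
         (auto intro: order_trans[OF lw_mono[OF e]] order_trans[OF _ lw_mono[OF e]])
    also have "\<dots> \<le> 2 * Suc m + 2" using Suc.IH window_le[OF e, of "s + Suc m"] by linarith
    finally show ?case by simp
  qed
  note * = this
  have "zcount e {lw s e..lw (s + m) e} \<le> zcount e {lw s e..lw (s + Suc m) e}"
    by (rule zcount_mono[OF e, where l = "lw s e" and r = "lw (s + Suc m) e"])
       (auto intro: order_trans[OF _ lw_mono[OF e]])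
  thus ?thesis using *[of m] by simp
qed

text \<open>A window has length \<open>2 * d * e\<close> and holds at most two zeros. Rounding both
  ends outwards to window ends costs fewer than two windows, that is 4 zeros, and
  \<open>windows_le\<close> adds 2 more: hence the 6.\<close>

lemma zcount_upper:
  assumes e: "e > 0" and x: "lw 0 e \<le> x" "x \<le> y"
  shows "real (zcount e {x..y}) \<le> (y - x) / (real d * e) + 6"
proof -
  define t where "t z = (z - lw 0 e) / (2 * real d * e)" for z
  have de: "2 * real d * e > 0" using e d by simp
  have tD: "t z * (2 * real d * e) = z - lw 0 e" for z
    unfolding t_def using de by (metis less_irrefl nonzero_eq_divide_eq)
  have tx: "0 \<le> t x" "t x \<le> t y" using x de by (auto simp: t_def divide_right_mono)
  define s where "s = nat \<lfloor>t x\<rfloor>"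
  define m where "m = nat (\<lceil>t y\<rceil>) - s"
  have s: "real s \<le> t x" "t x < real s + 1" using tx by (auto simp: s_def of_nat_nat)
  have "real (nat \<lceil>t y\<rceil>) = of_int \<lceil>t y\<rceil>" using tx by (simp add: of_nat_nat)
  hence u: "t y \<le> real (nat \<lceil>t y\<rceil>)" "real (nat \<lceil>t y\<rceil>) < t y + 1" by linarith+
  have "real s \<le> real (nat \<lceil>t y\<rceil>)" using s u tx by linarith
  hence sm: "s + m = nat \<lceil>t y\<rceil>" by (simp add: m_def)
  have lwt: "lw k e = lw 0 e + real k * (2 * real d * e)" for k
    by (simp add: lw_def grid_def algebra_simps)
  have "lw s e \<le> x"
  proof -
    have "real s * (2 * real d * e) \<le> t x * (2 * real d * e)" using s de by (intro mult_right_mono) auto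
    also have "\<dots> = x - lw 0 e" by (rule tD)
    finally show ?thesis unfolding lwt[of s] by linarith
  qed
  moreover have "y \<le> lw (s + m) e"
  proof -
    have "t y * (2 * real d * e) \<le> real (s + m) * (2 * real d * e)" using u sm de by (intro mult_right_mono) auto
    moreover have "t y * (2 * real d * e) = y - lw 0 e" by (rule tD)
    ultimately show ?thesis unfolding lwt[of "s + m"] by linarith
  qed
  ultimately have "zcount e {x..y} \<le> zcount e {lw s e..lw (s + m) e}"
    by (intro zcount_mono[OF e, where l = "lw s e" and r = "lw (s + m) e"]) auto
  also have "\<dots> \<le> 2 * m + 2" by (rule windows_le[OF e])
  finally have "real (zcount e {x..y}) \<le> 2 * real m + 2" by linarith
  moreover have "real s + real m = real (nat \<lceil>t y\<rceil>)" using sm by (metis of_nat_add)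
  hence "real m < t y - t x + 2" using s u by linarith
  moreover have "2 * (t y - t x) = (y - x) / (real d * e)"
  proof -
    have "t y - t x = ((y - lw 0 e) - (x - lw 0 e)) / (2 * real d * e)" by (simp only: t_def diff_divide_distrib)
    also have "\<dots> = (y - x) / (real d * e) / 2" by simp
    finally have eq: "t y - t x = (y - x) / (real d * e) / 2" .
    have "2 * (q / 2) = q" for q :: real by simp
    thus ?thesis unfolding eq .
  qed
  ultimately show ?thesis unfolding right_diff_distrib by linarith
qed

text \<open>At a zero the theta series would equal the reflected term up to sign. The latter stays
  above a positive constant, because its argument is negative and the limiting power series is
  positive, while for \<open>v < al\<close> the former is exponentially small.\<close>

lemma no_zeros:
  assumes xy: "0 < x" "x \<le> y" "y < al"
  shows "\<forall>\<^sub>F e in at_right 0. \<forall>v\<in>{x..y}. ptr c e v \<noteq> 0"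
proof -
  obtain b where b: "b > 0" and evb: "\<forall>\<^sub>F e in at_right 0. \<forall>v. exp (- y - 1) \<le> exp (v + e/2) \<and> exp (v + e/2) \<le> exp (- x) \<longrightarrow> ptr c e v \<ge> b"
    using ptr_uniform_limit[of "exp (- y - 1)" "exp (- x)"] limit_pos xy by auto
  \<comment> \<open>Half of the gap, so that the exponent \<open>v^2 - al^2 + \<eta>\<close> is
    still at most \<open>- \<eta>\<close>.\<close>
  define \<eta> where "\<eta> = (al^2 - y^2) / 2"
  have "y^2 < al^2" using xy by (intro power_strict_mono) auto
  hence eta: "\<eta> > 0" by (simp add: \<eta>_def)
  have "((\<lambda>e::real. exp (- (\<eta> / 2 / e))) \<longlongrightarrow> 0) (at_right 0)"
    using eta by (intro exp_neg_over_tendsto) simp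
  hence evx: "\<forall>\<^sub>F e in at_right (0::real). exp (- (\<eta> / 2 / e)) < exp (- 1 - y) * b"
    by (rule order_tendstoD) (use b in simp)
  have mx: "min 1 x > 0" using xy by simp
  show ?thesis
    using evb Psi_upper[OF eta] evx at_right_0_pos[OF mx]
  proof (eventually_elim, safe)
    fix e v assume 1: "\<forall>v. exp (- y - 1) \<le> exp (v + e/2) \<and> exp (v + e/2) \<le> exp (- x) \<longrightarrow> ptr c e v \<ge> b"
      and 2: "\<forall>v\<ge>e. \<bar>Psi e v\<bar> \<le> exp ((v^2 - al^2 + \<eta>) / (2 * e))"
      and 3: "exp (- (\<eta> / 2 / e)) < exp (- 1 - y) * b" and e: "0 < e" "e < min 1 x"
      and v: "v \<in> {x..y}" and z: "ptr c e v = 0"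
    have "ptr c e (- v - e) \<ge> b" using 1[rule_format, of "- v - e"] e v by auto
    hence "exp (- 1 - y) * b \<le> exp (- e/2 - v) * ptr c e (- v - e)"
      using b e v by (intro mult_mono) auto
    also have "\<dots> = \<bar>vs * exp (- e/2 - v) * ptr c e (- v - e)\<bar>"
      using \<open>ptr c e (- v - e) \<ge> b\<close> b vs by (simp add: abs_mult)
    also have "vs * exp (- e/2 - v) * ptr c e (- v - e) = - Psi e v" using split[OF e(1), of v] z by linarith
    also have "\<bar>- Psi e v\<bar> \<le> exp ((v^2 - al^2 + \<eta>) / (2 * e))" using 2 v e by simp
    also have "\<dots> \<le> exp (- (\<eta> / 2 / e))"
    proof -
      have "v^2 \<le> y^2" using v xy by (intro power_mono) auto
      moreover have "2 * \<eta> = al^2 - y^2" by (simp add: \<eta>_def)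
      ultimately have "v^2 - al^2 + \<eta> \<le> - \<eta>" by linarith
      hence "(v^2 - al^2 + \<eta>) / (2 * e) \<le> (- \<eta>) / (2 * e)" using e by (intro divide_right_mono) auto
      thus ?thesis by simp
    qed
    finally show False using 3 by simp
  qed
qed

text \<open>The reflected term has argument at most \<open>- x\<close>, so a geometric series bounds
  it, whereas the theta series has an explicit lower bound at grid points.\<close>

lemma grid_value:
  assumes e: "e > 0" and x: "x > 0" "x \<le> grid k e"
  shows "exp (((grid k e)^2 - (o1 * e)^2) / (2 * e)) * ((1 - exp (- e/2))^2 * exp (- (al^2 / (2 * e)))) - 1 / (1 - exp (- x))
    \<le> (-1)^k * ptr c e (grid k e)"
proof -
  define v where "v = grid k e"
  have v: "x \<le> v" "v > 0" using x by (auto simp: v_def)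
  have "\<bar>ptr c e (- v - e)\<bar> \<le> 1 / (1 - exp (- v - e))" by (rule ptr_abs_le[OF e]) (use v e in auto)
  also have "\<dots> \<le> 1 / (1 - exp (- x))" using v e x by (intro divide_left_mono mult_pos_pos) auto
  finally have "exp (- e/2 - v) * \<bar>ptr c e (- v - e)\<bar> \<le> 1 * (1 / (1 - exp (- x)))"
    using e v by (intro mult_mono) auto
  moreover have "\<bar>(-1)^k * (vs * exp (- e/2 - v) * ptr c e (- v - e))\<bar> = exp (- e/2 - v) * \<bar>ptr c e (- v - e)\<bar>"
    using vs by (simp add: abs_mult power_abs)
  ultimately have 1: "\<bar>(-1)^k * (vs * exp (- e/2 - v) * ptr c e (- v - e))\<bar> \<le> 1 / (1 - exp (- x))" by simp
  have "(-1)^k * Psi e v = ((-1)^k * (-1)^k) * (exp ((v^2 - (o1 * e)^2) / (2 * e)) * Psi e (o1 * e))"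
    using Psi_grid[OF e, of k] by (simp add: v_def grid_def)
  also have "\<dots> = exp ((v^2 - (o1 * e)^2) / (2 * e)) * Psi e (o1 * e)" by (simp flip: power_mult_distrib)
  also have "\<dots> \<ge> exp ((v^2 - (o1 * e)^2) / (2 * e)) * ((1 - exp (- e/2))^2 * exp (- (al^2 / (2 * e))))"
    by (intro mult_left_mono Psi_lower e) auto
  finally have 2: "(-1)^k * Psi e v \<ge> exp ((v^2 - (o1 * e)^2) / (2 * e)) * ((1 - exp (- e/2))^2 * exp (- (al^2 / (2 * e))))" .
  have "(-1)^k * ptr c e v = (-1)^k * Psi e v + (-1)^k * (vs * exp (- e/2 - v) * ptr c e (- v - e))"
    using split[OF e, of v] by (simp add: distrib_left)
  thus ?thesis using 1 2 unfolding v_def[symmetric] by linarith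
qed

text \<open>Beyond \<open>al\<close> the exponent of the theta series exceeds
  \<open>a / e - 1\<close> with \<open>a > 0\<close>; this outweighs the factor \<open>e^2\<close>
  in the lower bound and the bounded reflected term.\<close>

lemma grid_sign:
  assumes x: "x > al"
  shows "\<forall>\<^sub>F e in at_right 0. \<forall>k. x \<le> grid k e \<longrightarrow> (-1)^k * ptr c e (grid k e) > 0"
proof -
  define a where "a = (x^2 - al^2) / 2"
  have "al^2 < x^2" using x al by (intro power_strict_mono) auto
  hence a: "a > 0" by (simp add: a_def)
  have x0: "x > 0" using x al by simp
  define M where "M = 16 * exp 1 * (1 / (1 - exp (- x)))"
  have "\<forall>\<^sub>F e in at_right 0. M < e^2 * exp (a / e)"
    using exp_over_square_at_top[OF a] unfolding filterlim_at_top_dense by blast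
  thus ?thesis using at_right_0_pos[of 1, simplified]
  proof (eventually_elim, safe)
    fix e k assume M: "M < e^2 * exp (a / e)" and e: "0 < e" "e < 1" and k: "x \<le> grid k e"
    define v where "v = grid k e"
    have "e/4 \<le> 1 - exp (- e/2)"
    proof -
      have "1 + e/2 \<le> exp (e/2)" by (rule exp_ge_add_one_self)
      hence "exp (- e/2) \<le> 1 / (1 + e/2)" using e by (simp add: exp_minus field_simps)
      also have "\<dots> \<le> 1 - e/4" using e by (simp add: field_simps power2_eq_square)
      finally show ?thesis by simp
    qed
    hence 1: "(e/4)^2 \<le> (1 - exp (- e/2))^2" using e by (intro power_mono) auto
    have "x^2 \<le> v^2" using k x0 by (intro power_mono) (auto simp: v_def)
    \<comment> \<open>The offset of the grid costs only a factor \<open>exp 1\<close>.\<close>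
    moreover have "(o1 * e)^2 \<le> 2 * e"
    proof -
      have "\<bar>o1 * e\<bar> \<le> 1 * e" using o1 e by (simp add: abs_mult)
      hence "(o1 * e)^2 \<le> e^2" using e by (simp add: abs_le_square_iff[symmetric])
      also have "\<dots> \<le> 2 * e" using e by (simp add: power2_eq_square)
      finally show ?thesis .
    qed
    ultimately have "(x^2 - 2 * e - al^2) / (2 * e) \<le> (v^2 - (o1 * e)^2 - al^2) / (2 * e)"
      using e by (intro divide_right_mono) auto
    moreover have "(x^2 - 2 * e - al^2) / (2 * e) = a / e - 1" using e by (simp add: a_def field_simps)
    moreover have "(v^2 - (o1 * e)^2 - al^2) / (2 * e) = (v^2 - (o1 * e)^2) / (2 * e) + - (al^2 / (2 * e))"
      by (simp add: diff_divide_distrib)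
    ultimately have "exp (a / e - 1) \<le> exp ((v^2 - (o1 * e)^2) / (2 * e)) * exp (- (al^2 / (2 * e)))"
      by (simp flip: exp_add)
    hence "(e/4)^2 * exp (a / e - 1) \<le> (1 - exp (- e/2))^2 * (exp ((v^2 - (o1 * e)^2) / (2 * e)) * exp (- (al^2 / (2 * e))))"
      using 1 by (intro mult_mono) auto
    moreover have "1 / (1 - exp (- x)) < (e/4)^2 * exp (a / e - 1)"
    proof -
      have "(e/4)^2 * exp (a / e - 1) = e^2 * exp (a / e) / (16 * exp 1)" by (simp add: exp_diff power2_eq_square)
      moreover have "1 / (1 - exp (- x)) = M / (16 * exp 1)" by (simp add: M_def)
      ultimately show ?thesis using M by (simp add: divide_strict_right_mono)
    qed
    ultimately show "(-1)^k * ptr c e (grid k e) > 0"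
      using grid_value[OF e(1) x0 k] by (simp add: v_def mult_ac)
  qed
qed

text \<open>Here \<open>e\<close> stays away from 0 and the index grows instead: the exponent is at
  least \<open>k * h / 2\<close>. It keeps the two zeros of a far window apart as long as
  \<open>e \<ge> h\<close>.\<close>

lemma grid_sign_uniform:
  assumes h: "h > 0"
  shows "\<exists>K. \<forall>k\<ge>K. \<forall>e\<ge>h. (-1)^k * ptr c e (grid k e) > 0"
proof -
  define x where "x = h/2"
  define A where "A = (1 - exp (- h/2))^2"
  have A: "A > 0" using h by (simp add: A_def)
  define M where "M = ln (1 / (1 - exp (- x)) / A) + al^2 / (2 * h) + 1"
  obtain K where K: "real K \<ge> 2 * M / h + 2" using real_arch_simple by blast
  have "(-1)^k * ptr c e (grid k e) > 0" if k: "k \<ge> max K 2" and e: "e \<ge> h" for k e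
  proof -
    have e0: "e > 0" using e h by simp
    have dk: "real d * real k \<ge> real k" using d by (simp add: mult_le_cancel_right1)
    have o1': "- (1/2) \<le> o1" using o1 by (simp add: abs_le_iff)
    have k2: "real k \<ge> 2" using k by simp
    have dko: "1/2 \<le> real d * real k + o1" "1 \<le> real d * real k + 2 * o1" using dk k2 o1' by linarith+
    have "(1/2) * e \<le> (real d * real k + o1) * e"
      using dko(1) e0 by (intro mult_right_mono) auto
    hence gx: "x \<le> grid k e" using e by (simp add: grid_def x_def)
    have "(grid k e)^2 - (o1 * e)^2 = (real d * real k) * (real d * real k + 2 * o1) * e^2"
      by (simp add: grid_def power2_eq_square algebra_simps)
    hence "((grid k e)^2 - (o1 * e)^2) / (2 * e) = (real d * real k) * (real d * real k + 2 * o1) * e / 2"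
      using e0 by (simp add: power2_eq_square)
    moreover have "real k * 1 \<le> (real d * real k) * (real d * real k + 2 * o1)"
      using dk dko(2) by (intro mult_mono) auto
    hence "real k * h \<le> (real d * real k) * (real d * real k + 2 * o1) * e"
      using e h by (intro mult_mono) auto
    ultimately have "real k * h / 2 \<le> ((grid k e)^2 - (o1 * e)^2) / (2 * e)" by simp
    moreover have "al^2 / (2 * e) \<le> al^2 / (2 * h)" using e h by (intro divide_left_mono) auto
    moreover have "M \<le> real k * h / 2"
    proof -
      have "2 * M / h \<le> real k" using K k by linarith
      thus ?thesis using h by (simp add: field_simps)
    qed
    ultimately have "ln (1 / (1 - exp (- x)) / A) < ((grid k e)^2 - (o1 * e)^2) / (2 * e) + - (al^2 / (2 * e))"
      using M_def by linarith
    hence "1 / (1 - exp (- x)) / A < exp (((grid k e)^2 - (o1 * e)^2) / (2 * e)) * exp (- (al^2 / (2 * e)))"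
      using A h by (subst (asm) exp_less_cancel_iff[symmetric], subst (asm) exp_ln) (auto simp: x_def simp flip: exp_add)
    hence "1 / (1 - exp (- x)) < A * (exp (((grid k e)^2 - (o1 * e)^2) / (2 * e)) * exp (- (al^2 / (2 * e))))"
      using A by (simp only: pos_divide_less_eq mult.commute[of A])
    also have "\<dots> \<le> (1 - exp (- e/2))^2 * (exp (((grid k e)^2 - (o1 * e)^2) / (2 * e)) * exp (- (al^2 / (2 * e))))"
      unfolding A_def using e h by (intro mult_right_mono power_mono) auto
    finally show ?thesis using grid_value[OF e0 _ gx] h by (simp add: x_def mult_ac)
  qed
  thus ?thesis by blast
qed

text \<open>One zero between consecutive grid points, which are \<open>d * e\<close> apart; rounding
  \<open>x\<close> and \<open>y\<close> inwards to the grid costs fewer than two steps.\<close>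

lemma zeros_lower:
  assumes xy: "al < x" "x < y"
  shows "\<forall>\<^sub>F e in at_right 0. (y - x) / (real d * e) - 2 \<le> real (card {v \<in> {x..y}. ptr c e v = 0})"
proof -
  have p: "x / 2 > 0" "(y - x) / (2 * real d) > 0" using xy al d by auto
  show ?thesis
    using grid_sign[OF xy(1)] at_right_0_pos[OF p(1)] at_right_0_pos[OF p(2)]
  proof eventually_elim
    case (elim e)
    have e: "e > 0" using elim by simp
    have de: "real d * e > 0" using e d by simp
    define t where "t z = (z - o1 * e) / (real d * e)" for z
    have tD: "t z * (real d * e) = z - o1 * e" for z
      unfolding t_def using de by (metis less_irrefl nonzero_eq_divide_eq)
    have gk: "grid k e = real k * (real d * e) + o1 * e" for k by (simp add: grid_def algebra_simps)
    have "\<bar>o1 * e\<bar> \<le> 1 * e" unfolding abs_mult using o1 e by (intro mult_mono) auto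
    hence tx: "t x \<ge> 0" using elim(2) de xy al unfolding t_def by (intro divide_nonneg_pos) auto
    have tyx: "t y - t x = (y - x) / (real d * e)" by (simp add: t_def diff_divide_distrib)
    have "2 * (real d * e) < y - x" using elim(3) d by (simp add: field_simps)
    hence "2 < (y - x) / (real d * e)" using de by (simp add: less_divide_eq)
    hence t2: "t y - t x > 2" using tyx by simp
    define k0 where "k0 = nat \<lceil>t x\<rceil>"
    define k1 where "k1 = nat \<lfloor>t y\<rfloor>"
    have "real k0 = of_int \<lceil>t x\<rceil>" "real k1 = of_int \<lfloor>t y\<rfloor>" using tx t2 by (auto simp: k0_def k1_def of_nat_nat)
    hence k: "t x \<le> real k0" "real k0 < t x + 1" "real k1 \<le> t y" "t y < real k1 + 1" by linarith+
    hence "real k0 \<le> real k1" using t2 by linarith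
    hence k01: "k0 \<le> k1" by simp
    have gx: "x \<le> grid k0 e"
    proof -
      have "t x * (real d * e) \<le> real k0 * (real d * e)" using k de by (intro mult_right_mono) auto
      thus ?thesis unfolding gk tD by linarith
    qed
    have gy: "grid k1 e \<le> y"
    proof -
      have "real k1 * (real d * e) \<le> t y * (real d * e)" using k de by (intro mult_right_mono) auto
      thus ?thesis unfolding gk tD by linarith
    qed
    define n where "n = k1 - k0"
    have "\<exists>S. S \<subseteq> {grid (k0 + 0) e<..<grid (k0 + n) e} \<and> finite S \<and> card S = n \<and> (\<forall>v\<in>S. ptr c e v = 0)"
    proof (rule alternation_zeros[of "\<lambda>i. grid (k0 + i) e" n "ptr c e" "(-1)^k0"])
      show "continuous_on {grid (k0 + 0) e..grid (k0 + n) e} (ptr c e)" by (intro continuous_intros) (use e in auto)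
      show "grid (k0 + i) e < grid (k0 + Suc i) e" for i unfolding gk using de by (simp add: algebra_simps)
      fix i
      have "x \<le> grid (k0 + i) e" using gx grid_mono[OF e, of k0 "k0 + i"] by simp
      hence "(-1)^(k0 + i) * ptr c e (grid (k0 + i) e) > 0" using elim(1) by blast
      thus "(-1)^i * (-1)^k0 * ptr c e (grid (k0 + i) e) > 0" by (simp add: power_add mult_ac)
    qed
    then obtain S where S: "S \<subseteq> {grid k0 e<..<grid k1 e}" "finite S" "card S = n" "\<forall>v\<in>S. ptr c e v = 0"
      using k01 by (auto simp: n_def)
    have "card S \<le> card {v \<in> {x..y}. ptr c e v = 0}"
      by (rule card_mono[OF finite_zeros_ptr[OF e]]) (use S gx gy in force)
    hence "real n \<le> real (card {v \<in> {x..y}. ptr c e v = 0})" using S by simp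
    moreover have "real n = real k1 - real k0" using k01 by (simp add: n_def of_nat_diff)
    ultimately show ?case using k tyx by linarith
  qed
qed

section \<open>Limits of the counts\<close>

lemma lw0_ev: "p > 0 \<Longrightarrow> \<forall>\<^sub>F e in at_right 0. lw 0 e < p"
proof -
  assume "p > 0"
  have "((\<lambda>e. lw 0 e) \<longlongrightarrow> lw 0 0) (at_right 0)" unfolding lw_eq by (intro tendsto_intros)
  thus ?thesis by (rule order_tendstoD) (use \<open>p > 0\<close> in \<open>simp add: lw_eq\<close>)
qed

text \<open>Two zeros per window of length \<open>2 * d * e\<close> from above and one zero per grid
  step \<open>d * e\<close> from below give the same density. The shift by \<open>e/2\<close> is the
  one between \<open>v\<close> and the logarithm of the modulus of the zero of theta.\<close>

lemma zcount_limit: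
  assumes L: "L \<ge> al"
  shows "((\<lambda>e. e * real (zcount e {al - e/2..L - e/2})) \<longlongrightarrow> (L - al) / real d) (at_right 0)"
proof (rule order_tendstoI)
  fix a assume a: "(L - al) / real d < a"
  define p where "p = (a - (L - al) / real d) / 6"
  have p: "p > 0" using a by (simp add: p_def)
  show "\<forall>\<^sub>F e in at_right 0. e * real (zcount e {al - e/2..L - e/2}) < a"
    using at_right_0_pos[OF p] at_right_0_pos[of 1, simplified] lw0_ev[of 1, simplified]
  proof eventually_elim
    case (elim e)
    have "real (zcount e {al - e/2..L - e/2}) \<le> (L - e/2 - (al - e/2)) / (real d * e) + 6"
      by (rule zcount_upper) (use elim L al in auto)
    hence "e * real (zcount e {al - e/2..L - e/2}) \<le> e * ((L - al) / (real d * e) + 6)"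
      using elim by (intro mult_left_mono) auto
    also have "\<dots> = (L - al) / real d + 6 * e" using elim by (simp add: distrib_left)
    also have "\<dots> < a" using elim by (simp add: p_def)
    finally show ?case .
  qed
next
  fix a assume a: "a < (L - al) / real d"
  have d0: "real d > 0" using d by simp
  show "\<forall>\<^sub>F e in at_right 0. a < e * real (zcount e {al - e/2..L - e/2})"
  proof (cases "L = al \<or> a < 0")
    case True
    hence "a < 0" using a by auto
    thus ?thesis using at_right_0_pos[of 1, simplified]
      by (auto elim!: eventually_mono intro: less_le_trans[of a 0])
  next
    case False
    hence L': "L > al" using L by simp
    define q where "q = ((L - al) / real d - a)"
    have q: "q > 0" using a by (simp add: q_def)
    \<comment> \<open>The lower bound needs to stay strictly beyond \<open>al\<close> and inside the
      moving ends; the second entry keeps the loss below half of the gap \<open>q\<close>.\<close>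
    define \<delta> where "\<delta> = min ((L - al) / 4) (q * real d / 4)"
    have dl: "\<delta> > 0" using L' q d0 by (simp add: \<delta>_def)
    have "\<delta> \<le> (L - al) / 4" "\<delta> \<le> q * real d / 4"
      unfolding \<delta>_def by (rule min.cobounded1, rule min.cobounded2)
    hence dl2: "4 * \<delta> \<le> L - al" "2 * \<delta> / real d \<le> q / 2" using d0 by (auto simp: field_simps)
    have q8: "q/8 > 0" using q by simp
    have "\<forall>\<^sub>F e in at_right 0. (L - \<delta> - (al + \<delta>)) / (real d * e) - 2 \<le> real (card {v \<in> {al + \<delta>..L - \<delta>}. ptr c e v = 0})"
      by (rule zeros_lower) (use dl dl2 in auto)
    thus ?thesis using at_right_0_pos[OF dl] at_right_0_pos[OF q8]
    proof eventually_elim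
      case (elim e)
      have "card {v \<in> {al + \<delta>..L - \<delta>}. ptr c e v = 0} \<le> zcount e {al + \<delta>..L - \<delta>}"
        by (rule card_le_zcount[where l = "al + \<delta>" and r = "L - \<delta>"]) (use elim in auto)
      also have "\<dots> \<le> zcount e {al - e/2..L - e/2}"
        by (rule zcount_mono[where l = "al - e/2" and r = "L - e/2"]) (use elim dl in auto)
      finally have "(L - \<delta> - (al + \<delta>)) / (real d * e) - 2 \<le> real (zcount e {al - e/2..L - e/2})"
        using elim(1) by linarith
      hence "e * ((L - \<delta> - (al + \<delta>)) / (real d * e) - 2) \<le> e * real (zcount e {al - e/2..L - e/2})"
        using elim by (intro mult_left_mono) auto
      moreover have "e * ((L - \<delta> - (al + \<delta>)) / (real d * e) - 2) = (L - al) / real d - 2 * \<delta> / real d - 2 * e"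
        using elim d0 by (simp add: field_simps)
      moreover have "(L - al) / real d - 2 * \<delta> / real d - 2 * e > a" using dl2 elim(3) q by (simp add: q_def)
      ultimately show ?case by linarith
    qed
  qed
qed

lemma zcount_left: "e > 0 \<Longrightarrow> zcount e {..y} = zcount e {-1..y}"
proof (rule zcount_cong)
  fix v assume "e > 0" "ptr c e v = 0"
  hence "\<not> v \<le> -1" using left_pos[of e v] by fastforce
  thus "(v \<in> {..y}) = (v \<in> {-1..y})" by auto
qed

text \<open>There is at most one zero below the windows and none in the middle stretch. The short
  intervals next to 0 and to \<open>al\<close>, of length at most \<delta>, hold at most
  \<open>\<delta> / e + 6\<close> zeros each.\<close>

lemma zcount_small: "((\<lambda>e. e * real (zcount e {..al - e/2})) \<longlongrightarrow> 0) (at_right 0)"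
proof (rule order_tendstoI)
  fix a :: real assume "a < 0"
  thus "\<forall>\<^sub>F e in at_right 0. a < e * real (zcount e {..al - e/2})"
    using at_right_0_pos[of 1, simplified] by (auto elim!: eventually_mono intro: less_le_trans[of a 0])
next
  fix a :: real assume a: "a > 0"
  define \<delta> where "\<delta> = min (a/8) (1/2)"
  have dl: "\<delta> > 0" "\<delta> \<le> 1/2" "8 * \<delta> \<le> a" using a by (auto simp: \<delta>_def min_def)
  \<comment> \<open>The three pieces contribute the constant \<open>1 + 6 + 6 = 13\<close>; with
    \<open>e < a / 26\<close> it costs less than \<open>a / 2\<close>.\<close>
  have a26: "a / 26 > 0" using a by simp
  have "\<forall>\<^sub>F e in at_right 0. \<forall>v\<in>{\<delta>..al - \<delta>}. ptr c e v \<noteq> 0"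
    by (rule no_zeros) (use dl al in auto)
  thus "\<forall>\<^sub>F e in at_right 0. e * real (zcount e {..al - e/2}) < a"
    using at_right_0_pos[OF a26] lw0_ev[OF dl(1)] at_right_0_pos[of 1, simplified]
  proof eventually_elim
    case (elim e)
    have e: "e > 0" using elim by simp
    let ?A = "{-1..lw 0 e}" and ?B = "{lw 0 e..\<delta>}" and ?C = "{al - \<delta>..al}"
    have lw0: "lw 0 e \<ge> 0" unfolding lw_eq using g_nonneg e by simp
    have "zcount e {..al - e/2} = zcount e {-1..al - e/2}" by (rule zcount_left[OF e])
    also have "\<dots> = zcount e ((?A \<union> ?B \<union> ?C) \<inter> {-1..al - e/2})"
    proof (rule zcount_cong)
      fix v assume "ptr c e v = 0"
      hence "v \<notin> {\<delta>..al - \<delta>}" using elim(1) by blast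
      thus "(v \<in> {-1..al - e/2}) = (v \<in> (?A \<union> ?B \<union> ?C) \<inter> {-1..al - e/2})" using e by auto
    qed
    also have "\<dots> \<le> zcount e (?A \<union> ?B \<union> ?C)"
      by (rule zcount_mono[where l = "-1" and r = al]) (use e elim dl al lw0 in auto)
    also have "\<dots> \<le> zcount e (?A \<union> ?B) + zcount e ?C"
      by (rule zcount_Un_le[where l = "-1" and r = al]) (use e elim dl al lw0 in auto)
    also have "zcount e (?A \<union> ?B) \<le> zcount e ?A + zcount e ?B"
      by (rule zcount_Un_le[where l = "-1" and r = al]) (use e elim dl al lw0 in auto)
    also have "zcount e ?A \<le> 1" using low[OF e] by (simp add: lw_eq)
    finally have "real (zcount e {..al - e/2}) \<le> 1 + real (zcount e ?B) + real (zcount e ?C)" by linarith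
    also have "real (zcount e ?B) \<le> (\<delta> - lw 0 e) / (real d * e) + 6"
      by (rule zcount_upper[OF e]) (use elim in auto)
    also have "(\<delta> - lw 0 e) / (real d * e) \<le> \<delta> / e"
      using lw0 d e dl by (intro frac_le) (auto simp: mult_le_cancel_right1)
    also have "real (zcount e ?C) \<le> (al - (al - \<delta>)) / (real d * e) + 6"
      by (rule zcount_upper[OF e]) (use elim dl al in auto)
    also have "(al - (al - \<delta>)) / (real d * e) \<le> \<delta> / e"
      using d e dl by (intro frac_le) (auto simp: mult_le_cancel_right1)
    finally have "real (zcount e {..al - e/2}) \<le> 13 + 2 * (\<delta> / e)" by simp
    hence "e * real (zcount e {..al - e/2}) \<le> e * (13 + 2 * (\<delta> / e))" using e by (intro mult_left_mono) auto
    also have "\<dots> = 13 * e + 2 * \<delta>" using e by (simp add: distrib_left)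
    also have "\<dots> < a" using elim dl a by simp
    finally show ?case .
  qed
qed

text \<open>As \<open>e\<close> decreases, a far window moves left and at some small time lies
  inside the zero-free interval below \<open>al\<close>, so its two zeros must have met before. They
  cannot have met at a time \<open>e \<ge> h\<close>, if the window is far enough to the
  right.\<close>

lemma spectral_window:
  assumes h: "h > 0"
  shows "\<exists>S. \<forall>s\<ge>S. \<exists>b v. 0 < b \<and> b < h \<and> zero_window.zeros c (lw s) (lw (Suc s)) b = {v} \<and>
     zorder (pt c (of_real b)) (of_real v) = 2 \<and>
     (\<forall>e>b. card (zero_window.zeros c (lw s) (lw (Suc s)) e) = 2 \<and> zcount e {lw s e..lw (Suc s) e} = 2)"
proof -
  have "\<forall>\<^sub>F e in at_right 0. \<forall>v\<in>{1/2..14/10}. ptr c e v \<noteq> 0" by (rule no_zeros) (use al in auto)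
  then obtain e0 where e0: "e0 > 0" "\<And>e v. 0 < e \<Longrightarrow> e < e0 \<Longrightarrow> v \<in> {1/2..14/10} \<Longrightarrow> ptr c e v \<noteq> 0"
    unfolding eventually_at_right_field by blast
  obtain K where K: "\<And>k e. k \<ge> K \<Longrightarrow> e \<ge> h \<Longrightarrow> (-1)^k * ptr c e (grid k e) > 0"
    using grid_sign_uniform[OF h] by blast
  obtain S0 where S0: "real S0 > 1 / e0" using reals_Archimedean2 by blast
  have "\<exists>b v. 0 < b \<and> b < h \<and> zero_window.zeros c (lw s) (lw (Suc s)) b = {v} \<and>
     zorder (pt c (of_real b)) (of_real v) = 2 \<and>
     (\<forall>e>b. card (zero_window.zeros c (lw s) (lw (Suc s)) e) = 2 \<and> zcount e {lw s e..lw (Suc s) e} = 2)"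
    if s: "s \<ge> max (max S0 K) 3" for s
  proof -
    interpret zero_window c "lw s" "lw (Suc s)" by (rule window)
    define N where "N = real (2 * s + kap + 1)"
    \<comment> \<open>At this time the middle grid point of the window, of index \<open>N\<close>,
      is within \<open>e1 / 2\<close> of 1; since \<open>N \<ge> 7\<close>, the window reaches at
      most 2/7 to either side of 1.\<close>
    define e1 where "e1 = 1 / (real d * N)"
    have N: "N \<ge> 7" "N > real S0" using s by (auto simp: N_def)
    have d0: "real d \<ge> 1" using d by simp
    have dN: "real d * N > 0" "real d * N \<ge> N" using d0 N by (auto simp: mult_le_cancel_right1)
    have e1: "e1 > 0" "e1 < e0"
    proof -
      show "e1 > 0" using dN by (simp add: e1_def)
      have "1 / e0 < real d * N" using S0 N dN by linarith
      thus "e1 < e0" using e0 dN by (simp add: e1_def field_simps)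
    qed
    have lo: "1/2 \<le> lw s e1" and up: "lw (Suc s) e1 \<le> 14/10"
    proof -
      have a: "lw s e1 = 1 - (real d - o1) / (real d * N)" "lw (Suc s) e1 = 1 + (real d + o1) / (real d * N)"
        using dN d0 N unfolding lw_eq lw_Suc_eq e1_def N_def by (simp_all add: field_simps)
      have "(real d - o1) / (real d * N) \<le> (2 * real d) / (real d * 7)" "(real d + o1) / (real d * N) \<le> (2 * real d) / (real d * 7)"
        using d0 N o1 by (intro frac_le mult_left_mono; auto simp: abs_le_iff)+
      moreover have "(2 * real d) / (real d * 7) = 2/7" using d0 by simp
      ultimately show "1/2 \<le> lw s e1" "lw (Suc s) e1 \<le> 14/10" using a by linarith+
    qed
    have "zeros e1 = {}" using e0(2)[OF e1] lo up by (auto simp: zeros_def)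
    hence Z1: "zcount e1 {lw s e1..lw (Suc s) e1} = 0" by (simp add: Z_eq_sum)
    obtain b v where b: "b > e1" "zeros b = {v}" "zorder (pt c (of_real b)) (of_real v) = 2"
      "\<forall>e>b. card (zeros e) = 2 \<and> zcount e {lw s e..lw (Suc s) e} = 2"
      using double_zero[OF window_hi e1(1) Z1] by blast
    have b0: "b > 0" using b(1) e1 by simp
    \<comment> \<open>Otherwise three consecutive grid points with alternating signs would separate
      two zeros, whereas at \<open>b\<close> there is only one.\<close>
    have "b < h"
    proof (rule ccontr)
      assume "\<not> b < h"
      define sg where "sg = ((-1)^kap :: real)"
      define m where "m = grid (2 * s + kap + 1) b"
      have neg: "sg * ptr c b m < 0"
        using K[of "2 * s + kap + 1" b] s \<open>\<not> b < h\<close> by (simp add: sg_def m_def power_add)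
      have pos: "sg * ptr c b (lw s b) > 0" "sg * ptr c b (lw (Suc s) b) > 0"
        using barrier'[OF b0, of s] barrier'[OF b0, of "Suc s"] by (simp_all add: sg_def lw_def)
      have m: "lw s b \<le> m" "m \<le> lw (Suc s) b" unfolding m_def lw_def by (intro grid_mono b0; simp)+
      have cont: "continuous_on A (\<lambda>x. sg * ptr c b x)" for A by (intro continuous_intros) (use b0 in auto)
      obtain z1 where z1: "lw s b \<le> z1" "z1 \<le> m" "sg * ptr c b z1 = 0"
        using IVT2'[of "\<lambda>x. sg * ptr c b x" m 0 "lw s b"] neg pos m cont by auto
      obtain z2 where z2: "m \<le> z2" "z2 \<le> lw (Suc s) b" "sg * ptr c b z2 = 0"
        using IVT'[of "\<lambda>x. sg * ptr c b x" m 0 "lw (Suc s) b"] neg pos m cont by auto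
      have "z1 \<in> zeros b" "z2 \<in> zeros b" using z1 z2 m by (auto simp: zeros_def sg_def)
      hence "z1 = v" "z2 = v" using b(2) by auto
      hence "m = z1" using z1 z2 by simp
      thus False using z1(3) neg by (metis less_irrefl)
    qed
    thus ?thesis using b b0 by blast
  qed
  thus ?thesis by blast
qed

end

section \<open>The three sign patterns\<close>

lemma (in sign_seq) ptr_pos_left:
  assumes e: "e > 0" and v: "v \<le> e/2 - 1" and c0: "c 0 = 1"
  shows "ptr c e v > 0"
proof -
  have "ptr c e v = (\<Sum>j. c (Suc j) * exp (real (Suc j) * v - e * (real (Suc j))^2 / 2)) + 1"
    unfolding ptr_def using suminf_split_head[OF summable_ptr[OF e, of v]] by (simp add: c0)
  moreover have "norm (\<Sum>j. c (Suc j) * exp (real (Suc j) * v - e * (real (Suc j))^2 / 2)) \<le> (\<Sum>j. exp (-1) * exp (-1) ^ j)"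
  proof (rule norm_suminf_le)
    fix j
    have "real (Suc j) \<le> (real (Suc j))^2" by (simp add: power2_eq_square)
    hence "e * real (Suc j) \<le> e * (real (Suc j))^2" using e by (intro mult_left_mono) auto
    moreover have "real (Suc j) * v \<le> real (Suc j) * (e/2 - 1)" using v by (intro mult_left_mono) auto
    moreover have "real (Suc j) * (e/2 - 1) = e * real (Suc j) / 2 - real (Suc j)" by (simp add: algebra_simps)
    ultimately have "real (Suc j) * v - e * (real (Suc j))^2 / 2 \<le> - real (Suc j)" by linarith
    hence "exp (real (Suc j) * v - e * (real (Suc j))^2 / 2) \<le> exp (- real (Suc j))" by simp
    also have "\<dots> = exp (-1) * exp (-1) ^ j"
      by (simp add: exp_of_nat_mult[symmetric] exp_add[symmetric])
    finally show "norm (c (Suc j) * exp (real (Suc j) * v - e * (real (Suc j))^2 / 2)) \<le> exp (-1) * exp (-1) ^ j"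
      by (simp add: abs_mult c_abs)
  qed (auto intro!: summable_mult summable_geometric)
  moreover have "(\<Sum>j. exp (-1) * exp (-1) ^ j) < (1::real)"
  proof -
    have "(\<Sum>j. exp (-1) * exp (-1 :: real) ^ j) = exp (-1) * (1 / (1 - exp (-1)))"
      by (subst suminf_mult) (auto intro!: summable_geometric simp: suminf_geometric)
    also have "\<dots> < 1"
    proof -
      have "exp (1::real) > 2" using exp_lower_Taylor_quadratic[of "1::real"] by simp
      hence "exp (-1 :: real) < 1/2" by (simp add: exp_minus field_simps)
      thus ?thesis by (simp add: field_simps)
    qed
    finally show ?thesis .
  qed
  ultimately show ?thesis by (simp add: abs_le_iff)
qed

lemma pterm_Suc_le: "e > 0 \<Longrightarrow> v \<le> e/2 \<Longrightarrow> pterm e v (Suc j) \<le> pterm e v j"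
  and pterm_Suc_less: "e > 0 \<Longrightarrow> v \<le> e/2 \<Longrightarrow> 0 < j \<Longrightarrow> pterm e v (Suc j) < pterm e v j"
proof -
  have *: "real (Suc j) * v - e * (real (Suc j))^2 / 2 = (real j * v - e * (real j)^2 / 2) + (v - e/2) - e * real j"
    by (simp add: power2_eq_square field_simps)
  show "pterm e v (Suc j) \<le> pterm e v j" if "e > 0" "v \<le> e/2"
  proof -
    have "e * real j \<ge> 0" using that by simp
    thus ?thesis unfolding pterm_def * exp_le_cancel_iff using that by linarith
  qed
  show "pterm e v (Suc j) < pterm e v j" if "e > 0" "v \<le> e/2" "0 < j"
  proof -
    have "e * real j > 0" using that by simp
    thus ?thesis unfolding pterm_def * exp_less_cancel_iff using that by linarith
  qed
qed

text \<open>For \<open>v \<le> e/2\<close> the terms decrease, so a sign pattern of period four with nonnegative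
  partial sums gives a positive value.\<close>
lemma (in sign_seq) ptr_pos_of_blocks:
  assumes e: "e > 0" and v: "v \<le> e/2"
    and blk: "\<And>i. c (4*i) = 1 \<and> ((c (4*i+1) = -1 \<and> c (4*i+2) = 1 \<and> c (4*i+3) = -1) \<or> (c (4*i+1) = 1 \<and> c (4*i+2) = -1 \<and> c (4*i+3) = -1))"
  shows "ptr c e v > 0"
proof -
  define f where "f j = c j * pterm e v j" for j
  have "f sums ptr c e v" unfolding f_def by (rule ptr_sums[OF e])
  hence s: "(\<lambda>n. sum f {n*4..<n*4+4}) sums ptr c e v" by (rule sums_group) simp
  have pos: "sum f {n*4..<n*4+4} > 0" for n
  proof -
    have "{n*4..<n*4+4} = {4*n, 4*n+1, 4*n+2, 4*n+3}" by auto
    hence eq: "sum f {n*4..<n*4+4} = f (4*n) + f (4*n+1) + f (4*n+2) + f (4*n+3)" by simp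
    have "pterm e v (4*n+1) \<le> pterm e v (4*n)" "pterm e v (4*n+2) < pterm e v (4*n+1)" "pterm e v (4*n+3) < pterm e v (4*n+2)"
      using pterm_Suc_le[OF e v, of "4*n"] pterm_Suc_less[OF e v, of "4*n+1"] pterm_Suc_less[OF e v, of "4*n+2"]
      by (simp_all add: eval_nat_numeral)
    thus ?thesis unfolding eq f_def using blk[of n] by auto
  qed
  have "0 < (\<Sum>n. sum f {n*4..<n*4+4})" using s pos by (intro suminf_pos) (auto simp: sums_iff)
  thus ?thesis using s by (simp add: sums_iff)
qed

text \<open>\<open>k\<close> is the sign of \<open>q\<close> and \<open>s\<close> the sign of
  \<open>z\<close>. The three cases are \<open>k = 1, s = -1\<close> and \<open>k = -1\<close> with
  \<open>s = -1\<close> or \<open>s = 1\<close>.\<close>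

definition pat :: "real \<Rightarrow> real \<Rightarrow> nat \<Rightarrow> real" where
  "pat k s j = k ^ (j * (j + 1) div 2) * s ^ j"

lemma pat_0 [simp]: "pat k s 0 = 1" by (simp add: pat_def)

lemma pat_Suc: "pat k s (Suc j) = k ^ Suc j * s * pat k s j"
proof -
  have "Suc j * (Suc j + 1) div 2 = j * (j + 1) div 2 + Suc j"
  proof -
    have "Suc j * (Suc j + 1) = j * (j + 1) + Suc j * 2" by simp
    thus ?thesis by (metis div_mult_self3 numeral_eq_Suc zero_neq_numeral add.commute)
  qed
  thus ?thesis by (simp add: pat_def power_add)
qed

lemma pat_alt: "pat 1 (-1) = alt" by (simp add: pat_def alt_def fun_eq_iff)

text \<open>For negative \<open>q\<close> the signs have period four, and the even and the odd
  indices alternate separately; \<open>t = - s\<close> is their relative sign.\<close>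

lemma pat_even_odd: "pat (-1) (- t) (2*i) = (-1)^i \<and> pat (-1) (- t) (Suc (2*i)) = t * (-1)^i" if "t * t = 1"
proof (induction i)
  case (Suc i)
  have "2 * Suc i = Suc (Suc (2*i))" by simp
  thus ?case using Suc that by (simp add: pat_Suc mult_ac)
qed (use that in \<open>simp add: pat_Suc\<close>)

lemma sign_seq_pat: "\<bar>k\<bar> = 1 \<Longrightarrow> \<bar>s\<bar> = 1 \<Longrightarrow> sign_seq (pat k s)"
  by standard (simp add: pat_def abs_mult power_abs)

text \<open>The two-sided theta series for negative \<open>q\<close>, split by the parity of the
  index: \<open>(2 i)^2 = 4 i^2\<close> turns each half into a value of \<open>psi\<close> with time
  \<open>4 e\<close>.\<close>

definition Psi2 :: "real \<Rightarrow> real \<Rightarrow> real \<Rightarrow> real" where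
  "Psi2 t e v = psi (4*e) (2 * v) + t * exp (v - e/2) * psi (4*e) (2 * v - 2*e)"

lemma ptr_pat_split:
  assumes t: "t * t = 1" and e: "e > 0"
  shows "ptr (pat (-1) (- t)) e v = ptr alt (4*e) (2 * v) + t * exp (v - e/2) * ptr alt (4*e) (2 * v - 2*e)"
proof -
  let ?c = "pat (-1) (- t)"
  have e4: "4 * e > 0" using e by simp
  have A: "(\<lambda>i. alt i * pterm (4*e) (2 * v) i) sums ptr alt (4*e) (2 * v)"
    by (rule alt.ptr_sums[OF e4])
  have B: "(\<lambda>i. t * exp (v - e/2) * (alt i * pterm (4*e) (2 * v - 2*e) i)) sums (t * exp (v - e/2) * ptr alt (4*e) (2 * v - 2*e))"
    by (rule sums_mult[OF alt.ptr_sums[OF e4]])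
  have "(\<lambda>n. if even n then alt (n div 2) * pterm (4*e) (2 * v) (n div 2)
      else t * exp (v - e/2) * (alt ((n - 1) div 2) * pterm (4*e) (2 * v - 2*e) ((n - 1) div 2)))
      sums (t * exp (v - e/2) * ptr alt (4*e) (2 * v - 2*e) + ptr alt (4*e) (2 * v))"
    by (rule sums_if[OF B A])
  moreover have "(if even n then alt (n div 2) * pterm (4*e) (2 * v) (n div 2)
      else t * exp (v - e/2) * (alt ((n - 1) div 2) * pterm (4*e) (2 * v - 2*e) ((n - 1) div 2))) = ?c n * pterm e v n" for n
  proof (cases "even n")
    case True
    then obtain i where n: "n = 2 * i" by (elim evenE)
    have "pterm (4*e) (2 * v) i = pterm e v (2*i)" unfolding pterm_def
      by (rule arg_cong[of _ _ exp]) (simp add: power2_eq_square)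
    thus ?thesis using pat_even_odd[OF t, of i] by (simp add: n alt_def)
  next
    case False
    then obtain i where n: "n = Suc (2 * i)" by (metis oddE Suc_eq_plus1)
    have "exp (v - e/2) * pterm (4*e) (2 * v - 2*e) i = pterm e v (Suc (2*i))" unfolding pterm_def exp_add[symmetric]
      by (rule arg_cong[of _ _ exp]) (simp add: power2_eq_square field_simps)
    hence "t * exp (v - e/2) * (alt i * pterm (4*e) (2 * v - 2*e) i) = t * alt i * pterm e v (Suc (2*i))"
      by (simp only: mult_ac)
    thus ?thesis using pat_even_odd[OF t, of i] by (simp add: n alt_def)
  qed
  ultimately have "(\<lambda>n. ?c n * pterm e v n) sums (t * exp (v - e/2) * ptr alt (4*e) (2 * v - 2*e) + ptr alt (4*e) (2 * v))"
    by simp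
  thus ?thesis unfolding ptr_def pterm_def by (simp add: sums_iff)
qed

text \<open>Reflection exchanges the parities: the negative indices in the even theta series make up
  the odd part of the reflected function, and those in the odd series its even part.\<close>

lemma pat_split:
  assumes t: "t * t = 1" and e: "e > 0"
  shows "ptr (pat (-1) (- t)) e v = Psi2 t e v + t * exp (- e/2 - v) * ptr (pat (-1) (- t)) e (- v - e)"
proof -
  let ?a = "ptr alt (4*e) (2 * (- v - e))" and ?b = "ptr alt (4*e) (2 * (- v - e) - 2*e)"
  have a: "- (2 * v - 2*e) - 4*e = 2 * (- v - e)" "- (2 * v) - 4*e = 2 * (- v - e) - 2*e" by simp_all
  have p1: "psi (4*e) (2 * v) = ptr alt (4*e) (2 * v) - exp (- (2*e) - 2 * v) * ?b"
    unfolding psi_def a(2) by simp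
  have p2: "psi (4*e) (2 * v - 2*e) = ptr alt (4*e) (2 * v - 2*e) - exp (- (2 * v)) * ?a"
    unfolding psi_def a(1) by simp
  have E1: "exp (v - e/2) * exp (- (2 * v)) = exp (- e/2 - v)" by (simp flip: exp_add)
  have E2: "exp (- e/2 - v) * exp ((- v - e) - e/2) = exp (- (2*e) - 2 * v)" by (simp flip: exp_add)
  have "t * exp (- e/2 - v) * (?a + t * exp ((- v - e) - e/2) * ?b) =
      t * exp (- e/2 - v) * ?a + (t * t) * (exp (- e/2 - v) * exp ((- v - e) - e/2)) * ?b"
    by (simp only: distrib_left mult_ac)
  also have "\<dots> = t * (exp (v - e/2) * exp (- (2 * v))) * ?a + exp (- (2*e) - 2 * v) * ?b"
    unfolding E1 E2 t by simp
  finally show ?thesis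
    unfolding ptr_pat_split[OF t e, of "- v - e"] unfolding ptr_pat_split[OF t e, of v] Psi2_def p1 p2
    by (simp add: algebra_simps)
qed

text \<open>A step of \<open>2 e\<close> in \<open>v\<close> shifts both arguments of
  \<open>psi (4 e)\<close> by one quasi-period \<open>4 e\<close>, and together with the prefactor
  \<open>exp (v - e/2)\<close> the two multipliers agree.\<close>

lemma Psi2_grid:
  assumes e: "e > 0" and t: "t * t = 1"
  shows "Psi2 t e ((2 * real k + t/2) * e) =
     (-1)^k * exp ((((2 * real k + t/2) * e)^2 - (t/2 * e)^2) / (2*e)) * Psi2 t e (t/2 * e)"
proof -
  have e4: "4 * e > 0" using e by simp
  define G where "G = (2 * (real k)^2 + real k * t) * e"
  have a1: "2 * ((2 * real k + t/2) * e) = t * e + real k * (4*e)" "2 * ((2 * real k + t/2) * e) - 2*e = (t - 2) * e + real k * (4*e)"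
    by (simp_all add: algebra_simps)
  have p1: "psi (4*e) (t * e + real k * (4*e)) = (-1)^k * exp G * psi (4*e) (t * e)"
  proof -
    have "((t * e + real k * (4*e))^2 - (t * e)^2) / (2 * (4*e)) = G"
      using e by (simp add: G_def power2_eq_square field_simps)
    thus ?thesis using psi_shift_nat[OF e4, of "t * e" k] by simp
  qed
  have p2: "psi (4*e) ((t - 2) * e + real k * (4*e)) = (-1)^k * exp (G - 2 * real k * e) * psi (4*e) ((t - 2) * e)"
  proof -
    have "(((t - 2) * e + real k * (4*e))^2 - ((t - 2) * e)^2) / (2 * (4*e)) = G - 2 * real k * e"
      using e by (simp add: G_def power2_eq_square field_simps)
    thus ?thesis using psi_shift_nat[OF e4, of "(t - 2) * e" k] by simp
  qed
  have G': "(((2 * real k + t/2) * e)^2 - (t/2 * e)^2) / (2*e) = G"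
    using e by (simp add: G_def power2_eq_square field_simps)
  have E: "exp ((2 * real k + t/2) * e - e/2) * exp (G - 2 * real k * e) = exp G * exp (t/2 * e - e/2)"
    unfolding exp_add[symmetric] by (rule arg_cong[of _ _ exp]) (simp add: algebra_simps)
  have b: "2 * (t/2 * e) = t * e" "2 * (t/2 * e) - 2*e = (t - 2) * e" by (simp_all add: algebra_simps)
  have F: "t * exp ((2 * real k + t/2) * e - e/2) * ((-1)^k * exp (G - 2 * real k * e) * psi (4*e) ((t - 2) * e)) =
     (-1)^k * t * (exp ((2 * real k + t/2) * e - e/2) * exp (G - 2 * real k * e)) * psi (4*e) ((t - 2) * e)"
    by (simp only: mult_ac)
  show ?thesis unfolding Psi2_def G' unfolding a1(2) b(2) unfolding a1(1) b(1) p1 p2 F E by (simp only: distrib_left mult_ac)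
qed

text \<open>This explains the offset \<open>t/2\<close> of the grid: there the two theta values
  combine into a sum of nonnegative terms, so no cancellation can occur. For \<open>t = -1\<close>
  one quasi-period carries \<open>- 3 e\<close> to \<open>e\<close>.\<close>

lemma Psi2_base:
  assumes e: "e > 0" and t: "t = 1 \<or> t = -1"
  shows "Psi2 t e (t/2 * e) = psi (4*e) e + psi (4*e) (- e)"
proof (cases "t = 1")
  case True thus ?thesis by (simp add: Psi2_def)
next
  case False
  hence t1: "t = -1" using t by simp
  have e4: "4 * e > 0" using e by simp
  have "psi (4*e) (- 3*e + 4*e) = - exp (- 3*e + 4*e/2) * psi (4*e) (- 3*e)" by (rule psi_shift[OF e4])
  hence "psi (4*e) e = - exp (- e) * psi (4*e) (- 3*e)" by simp
  thus ?thesis by (simp add: Psi2_def t1)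
qed

text \<open>The time \<open>4 e\<close> in \<open>exp (- pi^2 / (2 * (4 e)))\<close> is what
  replaces \<open>pi\<close> by \<open>pi/2\<close>.\<close>

lemma Psi2_lower:
  assumes e: "e > 0" and t: "t = 1 \<or> t = -1"
  shows "(1 - exp (- e/2))^2 * exp (- ((pi/2)^2 / (2*e))) \<le> Psi2 t e (t/2 * e)"
proof -
  have e4: "4 * e > 0" using e by simp
  have ex: "exp (- (pi^2 / (2 * (4*e)))) = exp (- ((pi/2)^2 / (2*e)))"
    using e by (simp add: power2_eq_square)
  have a: "(1 - exp (- e)) * (1 - exp (- (3*e))) * exp (- ((pi/2)^2 / (2*e))) \<le> psi (4*e) e"
    using psi_lower[OF e4, of e] e unfolding ex by simp
  have b: "0 \<le> psi (4*e) (- e)" by (rule psi_bounds(1)[OF e4]) (use e in simp)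
  have "exp (- e) \<le> exp (- e/2)" "exp (- (3*e)) \<le> exp (- e/2)" "exp (- e/2) \<le> 1" using e by auto
  hence "(1 - exp (- e/2)) * (1 - exp (- e/2)) \<le> (1 - exp (- e)) * (1 - exp (- (3*e)))"
    by (intro mult_mono) linarith+
  hence "(1 - exp (- e/2))^2 * exp (- ((pi/2)^2 / (2*e))) \<le> (1 - exp (- e)) * (1 - exp (- (3*e))) * exp (- ((pi/2)^2 / (2*e)))"
    unfolding power2_eq_square by (intro mult_right_mono) auto
  thus ?thesis unfolding Psi2_base[OF e t] using a b by linarith
qed

lemma psi_upper:
  assumes "\<eta> > 0"
  shows "\<forall>\<^sub>F e in at_right 0. \<forall>v\<ge>e. \<bar>psi e v\<bar> \<le> exp ((v^2 - pi^2 + \<eta>) / (2 * e))"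
  using psi0_upper[OF assms] at_right_0_pos[of 1, simplified]
proof (eventually_elim, safe)
  fix e v :: real assume 1: "psi e 0 \<le> exp (- ((pi^2 - \<eta>) / (2 * e)))" and e: "0 < e" and v: "e \<le> v"
  have "\<bar>psi e v\<bar> \<le> exp (v^2 / (2*e)) * psi e 0" by (rule psi_abs_le[OF e]) (use e v in simp)
  also have "\<dots> \<le> exp (v^2 / (2*e)) * exp (- ((pi^2 - \<eta>) / (2 * e)))" using 1 by simp
  also have "\<dots> = exp ((v^2 - pi^2 + \<eta>) / (2 * e))"
    unfolding exp_add[symmetric] by (rule arg_cong[of _ _ exp]) (simp add: add_divide_distrib diff_divide_distrib)
  finally show "\<bar>psi e v\<bar> \<le> exp ((v^2 - pi^2 + \<eta>) / (2 * e))" .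
qed

text \<open>Both summands obey the same bound; the resulting factor 2 is absorbed by half of \<eta>,
  as soon as \<open>\<eta> / (4 e) \<ge> 1\<close>.\<close>

lemma Psi2_upper:
  assumes eta: "\<eta> > 0" and t: "t = 1 \<or> t = -1"
  shows "\<forall>\<^sub>F e in at_right 0. \<forall>v\<ge>e. \<bar>Psi2 t e v\<bar> \<le> exp ((v^2 - (pi/2)^2 + \<eta>) / (2 * e))"
proof -
  have "filterlim (\<lambda>e::real. 4 * e) (at_right 0) (at_right 0)"
  proof -
    have "((\<lambda>e::real. 4 * e) \<longlongrightarrow> 4 * 0) (at_right 0)" by (intro tendsto_intros)
    moreover have "\<forall>\<^sub>F e::real in at_right 0. 4 * e \<in> {0<..} \<and> 4 * e \<noteq> 0"
      using at_right_0_pos[of 1, simplified] by eventually_elim auto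
    ultimately show ?thesis by (simp add: filterlim_at)
  qed
  moreover have "2 * \<eta> > 0" using eta by simp
  ultimately have "\<forall>\<^sub>F e in at_right 0. psi (4*e) 0 \<le> exp (- ((pi^2 - 2 * \<eta>) / (2 * (4*e))))"
    using psi0_upper[of "2 * \<eta>"] eventually_compose_filterlim by blast
  moreover have "\<eta> / 4 > 0" using eta by simp
  note at_right_0_pos[OF this]
  ultimately show ?thesis
  proof (eventually_elim, safe)
    fix e v :: real assume 1: "psi (4*e) 0 \<le> exp (- ((pi^2 - 2 * \<eta>) / (2 * (4*e))))" and e: "0 < e" "e < \<eta>/4" and v: "e \<le> v"
    have e4: "4 * e > 0" using e by simp
    have a: "\<bar>psi (4*e) (2 * v)\<bar> \<le> exp (v^2 / (2*e)) * psi (4*e) 0"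
      using psi_abs_le[OF e4, of "2 * v"] e v by (simp add: power2_eq_square)
    have b: "\<bar>t * exp (v - e/2) * psi (4*e) (2 * v - 2*e)\<bar> \<le> exp (v^2 / (2*e)) * psi (4*e) 0"
    proof -
      have "\<bar>t * exp (v - e/2) * psi (4*e) (2 * v - 2*e)\<bar> = exp (v - e/2) * \<bar>psi (4*e) (2 * v - 2*e)\<bar>"
        using t by (auto simp: abs_mult)
      also have "\<dots> \<le> exp (v - e/2) * (exp ((2 * v - 2*e)^2 / (2 * (4*e))) * psi (4*e) 0)"
        by (intro mult_left_mono psi_abs_le e4) (use v in auto)
      also have "\<dots> = exp (v^2 / (2*e)) * psi (4*e) 0"
      proof -
        have "exp (v - e/2) * exp ((2 * v - 2*e)^2 / (2 * (4*e))) = exp (v^2 / (2*e))"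
          unfolding exp_add[symmetric] by (rule arg_cong[of _ _ exp]) (use e in \<open>simp add: field_simps power2_eq_square\<close>)
        thus ?thesis by (simp only: mult.assoc[symmetric])
      qed
      finally show ?thesis .
    qed
    have "\<bar>Psi2 t e v\<bar> \<le> 2 * (exp (v^2 / (2*e)) * psi (4*e) 0)" unfolding Psi2_def using a b by linarith
    also have "\<dots> \<le> exp 1 * (exp (v^2 / (2*e)) * exp (- ((pi^2 - 2 * \<eta>) / (2 * (4*e)))))"
      using 1 exp_ge_add_one_self[of "1::real"] psi_bounds(1)[OF e4, of 0] e by (intro mult_mono) auto
    also have "\<dots> = exp (1 + v^2 / (2*e) - (pi^2 - 2 * \<eta>) / (2 * (4*e)))"
      by (simp flip: exp_add)
    also have "\<dots> \<le> exp ((v^2 - (pi/2)^2 + \<eta>) / (2 * e))"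
    proof -
      have "(v^2 - (pi/2)^2 + \<eta>) / (2 * e) - (1 + v^2 / (2*e) - (pi^2 - 2 * \<eta>) / (2 * (4*e))) = \<eta> / (4*e) - 1"
        using e by (simp add: field_simps power2_eq_square)
      moreover have "\<eta> / (4*e) \<ge> 1" using e by (simp add: field_simps)
      ultimately show ?thesis by simp
    qed
    finally show "\<bar>Psi2 t e v\<bar> \<le> exp ((v^2 - (pi/2)^2 + \<eta>) / (2 * e))" .
  qed
qed

text \<open>Even and odd indices give geometric series in \<open>- y^2\<close>; the sum is
  \<open>(1 + t y) / (1 + y^2)\<close>.\<close>

lemma pat_limit_pos:
  assumes y: "0 < y" "y < 1" and t: "t = 1 \<or> t = -1"
  shows "(\<Sum>j. pat (-1) (- t) j * y^j) > 0"
proof -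
  have tt: "t * t = 1" using t by auto
  have y2: "0 < y^2" "y^2 < 1" using y by (auto simp: power_less_one_iff)
  have g: "(\<lambda>i. (- (y^2))^i) sums (1 / (1 - (- (y^2))))" by (rule geometric_sums) (use y2 in simp)
  from sums_mult[OF g, of "t * y"] have B: "(\<lambda>i. t * y * (- (y^2))^i) sums (t * y * (1 / (1 - (- (y^2)))))" .
  have "(\<lambda>n. if even n then (- (y^2))^(n div 2) else t * y * (- (y^2))^((n - 1) div 2)) sums
     (t * y * (1 / (1 - (- (y^2)))) + 1 / (1 - (- (y^2))))" by (rule sums_if[OF B g])
  moreover have "(if even n then (- (y^2))^(n div 2) else t * y * (- (y^2))^((n - 1) div 2)) = pat (-1) (- t) n * y^n" for n
  proof (cases "even n")
    case True
    then obtain i where n: "n = 2 * i" by (elim evenE)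
    have "(- (y^2))^i = (-1)^i * y^(2*i)" by (simp add: power_minus[of "y^2"] power_mult)
    thus ?thesis using pat_even_odd[OF tt, of i] by (simp add: n)
  next
    case False
    then obtain i where n: "n = Suc (2 * i)" by (metis oddE Suc_eq_plus1)
    have "(- (y^2))^i = (-1)^i * y^(2*i)" by (simp add: power_minus[of "y^2"] power_mult)
    thus ?thesis using pat_even_odd[OF tt, of i] by (simp add: n mult_ac)
  qed
  ultimately have "(\<Sum>j. pat (-1) (- t) j * y^j) = (t * y + 1) / (1 + y^2)"
    by (simp add: sums_iff add_divide_distrib)
  moreover have "t * y + 1 > 0" using t y by auto
  ultimately show ?thesis using divide_pos_pos[of "t * y + 1" "1 + y^2"] add_pos_pos[OF zero_less_one y2(1)] by metis
qed

text \<open>Positive \<open>q\<close>, negative zeros. The window ends are the even multiples of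
  \<open>e\<close>: there \<open>psi\<close> is nonnegative, and the reflected term is positive
  because its argument lies in the region \<open>v \<le> e/2\<close>, where the alternating series
  has decreasing terms.\<close>

interpretation A: theta_pattern alt "1" "0" pi "1" "0" psi "\<lambda>s. 2 * s" "\<lambda>s. 2 * s+1"
proof unfold_locales
  show "3/2 < pi" using pi_gt3 by simp
  fix e v :: real assume e: "e > 0"
  show "ptr alt e v = psi e v + 1 * exp (- e/2 - v) * ptr alt e (- v - e)" by (simp add: psi_def)
  show "(1 - exp (- e/2))^2 * exp (- (pi^2 / (2*e))) \<le> psi e (0 * e)"
    using psi_lower[OF e, of 0] e by (simp add: power2_eq_square)
  have pos: "ptr alt e v > 0" if "v \<le> e/2" for v
    by (rule alt.ptr_pos_of_blocks[OF e that]) (simp add: alt_def)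
  show "v \<le> -1 \<Longrightarrow> ptr alt e v > 0" using e by (intro pos) auto
  fix s k :: nat
  show "psi e ((real 1 * real k + 0) * e) = (-1)^k * exp ((((real 1 * real k + 0) * e)^2 - (0 * e)^2) / (2*e)) * psi e (0 * e)"
    using psi_shift_nat[OF e, of 0 k] by simp
  have "psi e (real (2 * s) * e) = exp ((real (2 * s) * e)^2 / (2*e)) * psi e 0"
    using psi_shift_nat[OF e, of 0 "2 * s"] by simp
  moreover have "psi e 0 \<ge> 0" by (rule psi_bounds(1)[OF e]) (use e in simp)
  moreover have "exp (- e/2 - real (2 * s) * e) * ptr alt e (- (real (2 * s) * e) - e) > 0"
  proof -
    have "real (2 * s) * e \<ge> 0" using e by simp
    thus ?thesis using e by (intro mult_pos_pos pos) (simp, linarith)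
  qed
  ultimately have "ptr alt e (real (2 * s) * e) > 0"
    unfolding psi_def by (smt (verit) exp_gt_zero mult_nonneg_nonneg)
  thus "0 < (-1)^0 * ptr alt e ((real 1 * real (2 * s + 0) + 0) * e)" by simp
  have "alt.zcount e {-1..0} = alt.zcount e {}"
  proof (rule alt.zcount_cong)
    fix v assume "ptr alt e v = 0"
    hence "\<not> v \<le> e/2" using pos[of v] by auto
    thus "(v \<in> {-1..0}) = (v \<in> {})" using e by auto
  qed
  thus "alt.zcount e {-1..(real 1 * real 0 + 0) * e} \<le> 1" by (simp add: alt.zcount_def)
next
  fix y :: real assume y: "0 < y" "y < 1"
  have "(\<lambda>j. (- y)^j) sums (1 / (1 - (- y)))" by (rule geometric_sums) (use y in simp)
  thus "(\<Sum>j. alt j * y^j) > 0" using y by (simp add: alt_def sums_iff flip: power_minus power_mult_distrib)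
qed (auto simp: psi_upper alt_def)

interpretation B: sign_seq "pat (-1) (-1)" by (rule sign_seq_pat) auto

interpretation C: sign_seq "pat (-1) 1" by (rule sign_seq_pat) auto

lemma pat_neg_parity:
  "pat (-1) (-1) (Suc n) = (if even n then 1 else -1) * pat (-1) (-1) n"
  "pat (-1) 1 (Suc n) = (if even n then -1 else 1) * pat (-1) 1 n"
  by (simp_all add: pat_Suc)

lemma Psi2_grid_pos:
  assumes e: "e > 0" and t: "t = 1 \<or> t = -1"
  shows "0 < (-1)^k * Psi2 t e ((2 * real k + t/2) * e)"
proof -
  have tt: "t * t = 1" using t by auto
  have "0 < (1 - exp (- e/2))^2 * exp (- ((pi/2)^2 / (2*e)))" using e by simp
  hence "Psi2 t e (t/2 * e) > 0" using Psi2_lower[OF e t] by linarith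
  moreover have "(-1)^k * Psi2 t e ((2 * real k + t/2) * e) =
      exp ((((2 * real k + t/2) * e)^2 - (t/2 * e)^2) / (2*e)) * Psi2 t e (t/2 * e)"
    unfolding Psi2_grid[OF e tt] by (simp flip: mult.assoc power_mult_distrib)
  ultimately show ?thesis by simp
qed

lemma pat_B_split: "e > 0 \<Longrightarrow> ptr (pat (-1) (-1)) e v = Psi2 1 e v + 1 * exp (- e/2 - v) * ptr (pat (-1) (-1)) e (- v - e)"
  using pat_split[of 1 e v] by simp

lemma pat_C_split: "e > 0 \<Longrightarrow> ptr (pat (-1) 1) e v = Psi2 (-1) e v + (-1) * exp (- e/2 - v) * ptr (pat (-1) 1) e (- v - e)"
  using pat_split[of "-1" e v] by simp

text \<open>Negative \<open>q\<close>, negative zeros. The signs run \<open>+ + - -\<close>, so they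
  change only after odd indices, and the windows contain the cells \<open>4 s + 1\<close> and
  \<open>4 s + 3\<close>.\<close>

interpretation B: theta_pattern "pat (-1) (-1)" 2 "1/2" "pi/2" "1" "0" "Psi2 1" "\<lambda>s. 4 * s + 1" "\<lambda>s. 4 * s + 3"
proof unfold_locales
  show "3/2 < pi/2" using pi_gt3 by simp
  fix e v :: real assume e: "e > 0"
  show "ptr (pat (-1) (-1)) e v = Psi2 1 e v + 1 * exp (- e/2 - v) * ptr (pat (-1) (-1)) e (- v - e)" by (rule pat_B_split[OF e])
  show "(1 - exp (- e/2))^2 * exp (- ((pi/2)^2 / (2*e))) \<le> Psi2 1 e (1/2 * e)" by (rule Psi2_lower[OF e]) simp
  have pos: "ptr (pat (-1) (-1)) e v > 0" if "v \<le> e/2" for v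
  proof (rule B.ptr_pos_of_blocks[OF e that])
    fix i
    have e: "4 * i = 2 * (2 * i)" "4 * i + 1 = Suc (2 * (2 * i))" "4 * i + 2 = 2 * (2 * i + 1)" "4 * i + 3 = Suc (2 * (2 * i + 1))" by simp_all
    have "pat (-1) (-1) (4*i) = 1" unfolding e(1) using pat_even_odd[of 1 "2 * i"] by simp
    moreover have "pat (-1) (-1) (4*i+1) = 1" unfolding e(2) using pat_even_odd[of 1 "2 * i"] by simp
    moreover have "pat (-1) (-1) (4*i+2) = -1" unfolding e(3) using pat_even_odd[of 1 "2 * i + 1"] by simp
    moreover have "pat (-1) (-1) (4*i+3) = -1" unfolding e(4) using pat_even_odd[of 1 "2 * i + 1"] by simp
    ultimately show "pat (-1) (-1) (4*i) = 1 \<and> ((pat (-1) (-1) (4*i+1) = -1 \<and> pat (-1) (-1) (4*i+2) = 1 \<and> pat (-1) (-1) (4*i+3) = -1)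
       \<or> (pat (-1) (-1) (4*i+1) = 1 \<and> pat (-1) (-1) (4*i+2) = -1 \<and> pat (-1) (-1) (4*i+3) = -1))"
      by blast
  qed
  show "v \<le> -1 \<Longrightarrow> ptr (pat (-1) (-1)) e v > 0" using e by (intro pos) auto
  fix s k :: nat
  show "Psi2 1 e ((real 2 * real k + 1/2) * e) = (-1)^k * exp ((((real 2 * real k + 1/2) * e)^2 - (1/2 * e)^2) / (2*e)) * Psi2 1 e (1/2 * e)"
    using Psi2_grid[OF e, of 1 k] by simp
  define w where "w = (real 2 * real (2 * s + 0) + 1/2) * e"
  have w: "w > 0" using e by (auto simp: w_def intro!: mult_pos_pos add_nonneg_pos)
  have "Psi2 1 e w > 0" using Psi2_grid_pos[OF e, of 1 "2 * s"] by (simp add: w_def)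
  moreover have "exp (- e/2 - w) * ptr (pat (-1) (-1)) e (- w - e) > 0"
    by (intro mult_pos_pos pos) (use w e in auto)
  ultimately show "0 < (-1)^0 * ptr (pat (-1) (-1)) e ((real 2 * real (2 * s + 0) + 1/2) * e)"
    unfolding w_def[symmetric] using pat_B_split[OF e, of w] by simp
  have "B.zcount e {-1..1/2 * e} = B.zcount e {}"
  proof (rule B.zcount_cong)
    fix v assume "ptr (pat (-1) (-1)) e v = 0"
    hence "\<not> v \<le> e/2" using pos[of v] by auto
    thus "(v \<in> {-1..1/2 * e}) = (v \<in> {})" using e by auto
  qed
  thus "B.zcount e {-1..(real 2 * real 0 + 1/2) * e} \<le> 1" by (simp add: B.zcount_def)
next
  fix y :: real assume y: "0 < y" "y < 1"
  show "(\<Sum>j. pat (-1) (-1) j * y^j) > 0" using pat_limit_pos[OF y, of 1] by simp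
next
  fix s n :: nat
  assume 1: "real 2 * real (2 * s + 0) + 1/2 < real n + 1" "real n < real 2 * real (2 * s + 2 + 0) + 1/2"
    and 2: "n \<noteq> 4 * s + 1" "n \<noteq> 4 * s + 3"
  have "real (4 * s) < real (Suc n)" "real n < real (4 * s + 5)" using 1 by simp_all
  hence "4 * s \<le> n" "n \<le> 4 * s + 4" by linarith+
  hence "n = 4 * s \<or> n = 4 * s + 2 \<or> n = 4 * s + 4" using 2 by linarith
  hence "even n" by auto
  thus "pat (-1) (-1) (Suc n) = pat (-1) (-1) n" by (simp add: pat_neg_parity)
next
  fix \<eta> :: real assume "\<eta> > 0"
  thus "\<forall>\<^sub>F e in at_right 0. \<forall>v\<ge>e. \<bar>Psi2 1 e v\<bar> \<le> exp ((v^2 - (pi/2)^2 + \<eta>) / (2*e))" by (rule Psi2_upper) simp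
next
  show "pat (-1) (-1) (Suc (4 * s + 1)) = - pat (-1) (-1) (4 * s + 1)"
    "pat (-1) (-1) (Suc (4 * s + 3)) = - pat (-1) (-1) (4 * s + 3)" for s :: nat
    by (subst pat_neg_parity, simp)+
qed simp_all

text \<open>For the signs \<open>+ - - +\<close> the partial sums of a block become negative, so
  grouping of terms fails. Monotonicity replaces it: the window from \<open>-1 - e/2\<close> to
  \<open>- e/2\<close> has no zeros for \<open>e \<ge> 2\<close>, hence none for any smaller
  \<open>e\<close>.\<close>

lemma C_pos: 
  assumes e: "e > 0" and v: "v \<le> - e/2"
  shows "ptr (pat (-1) 1) e v > 0"
proof -
  have left: "ptr (pat (-1) 1) e v > 0" if "e > 0" "v \<le> -1" for e v
    by (rule C.ptr_pos_left) (use that in auto)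
  \<comment> \<open>The reflection \<open>v \<mapsto> - v - e\<close> fixes \<open>- e/2\<close>, so
    twice the value there is the theta series alone.\<close>
  have r: "ptr (pat (-1) 1) e (- e/2) > 0" if e: "e > 0" for e
    using pat_C_split[OF e, of "- e/2"] Psi2_grid_pos[OF e, of "-1" 0] by simp
  interpret W: zero_window "pat (-1) 1" "\<lambda>e. -1 - e/2" "\<lambda>e. - e/2"
  proof unfold_locales
    fix e :: real assume e: "e > 0"
    show "ptr (pat (-1) 1) e (-1 - e/2) \<noteq> 0" using left[OF e, of "-1 - e/2"] e by simp
    show "ptr (pat (-1) 1) e (- e/2) \<noteq> 0" using r[OF e] by simp
  qed (auto intro!: continuous_intros)
  have "v \<notin> W.zeros (max e 2)" for v
  proof
    assume "v \<in> W.zeros (max e 2)"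
    hence v: "v \<le> - max e 2 / 2" "ptr (pat (-1) 1) (max e 2) v = 0" unfolding W.zeros_def by auto
    have "max e 2 \<ge> 2" by simp
    hence "v \<le> -1" using v(1) by linarith
    moreover have "max e 2 > 0" by simp
    ultimately show False using left[of "max e 2" v] v(2) by linarith
  qed
  hence "W.zeros (max e 2) = {}" by blast
  hence "W.Z (max e 2) = 0" unfolding W.Z_eq_sum by (simp only: sum.empty)
  hence "W.Z e = 0" using W.Z_mono[OF e, of "max e 2"] by simp
  hence Z: "W.zeros e = {}" using W.card_zeros_le[OF e] W.finite_zeros[OF e] by simp
  show ?thesis
  proof (cases "v \<le> -1 - e/2")
    case True thus ?thesis using left[OF e, of v] e by simp
  next
    case False
    show ?thesis
    proof (rule ccontr)
      assume n: "\<not> ?thesis"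
      have "continuous_on {v..- e/2} (ptr (pat (-1) 1) e)" by (intro continuous_intros) (use e in auto)
      then obtain x where x: "v \<le> x" "x \<le> - e/2" "ptr (pat (-1) 1) e x = 0"
        using IVT'[of "ptr (pat (-1) 1) e" v 0 "- e/2"] n r[OF e] v by auto
      hence "x \<in> W.zeros e" unfolding W.zeros_def using False by auto
      thus False using Z by blast
    qed
  qed
qed

lemma C_barrier:
  assumes e: "e > 0"
  shows "ptr (pat (-1) 1) e ((2 * real (2 * s + 1) - 1/2) * e) < 0"
proof -
  define w where "w = (2 * real (2 * s + 1) - 1/2) * e"
  have w: "w > 0" using e by (auto simp: w_def intro!: mult_pos_pos)
  have "Psi2 (-1) e w < 0" using Psi2_grid_pos[OF e, of "-1" "2 * s + 1"] by (simp add: w_def)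
  moreover have "exp (- e/2 - w) * ptr (pat (-1) 1) e (- w - e) > 0"
    by (intro mult_pos_pos C_pos e) (use w e in auto)
  ultimately show ?thesis
    unfolding w_def[symmetric] using pat_C_split[OF e, of w] by simp
qed

text \<open>Below the first window lies one unpaired zero: for large \<open>e\<close> only the cell
  0 changes sign there, and monotonicity carries the bound to smaller \<open>e\<close>.\<close>

lemma C_low:
  assumes e: "e > 0"
  shows "C.zcount e {-1..3/2 * e} \<le> 1"
proof -
  have left: "ptr (pat (-1) 1) e v > 0" if "e > 0" "v \<le> e/2 - 1" for e v
    by (rule C.ptr_pos_left) (use that in auto)
  interpret W: zero_window "pat (-1) 1" "\<lambda>e. -1" "\<lambda>e. 3/2 * e"
  proof unfold_locales
    fix e :: real assume e: "e > 0"
    show "-1 < 3/2 * e" using e by simp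
    show "ptr (pat (-1) 1) e (-1) \<noteq> 0" using left[OF e, of "-1"] e by simp
    show "ptr (pat (-1) 1) e (3/2 * e) \<noteq> 0" using C_barrier[OF e, of 0] by simp
  qed (auto intro!: continuous_intros)
  define E where "E = max e 10"
  have E: "E \<ge> 10" "E > 0" "e \<le> E" by (auto simp: E_def)
  have c1: "pat (-1) 1 (Suc 0) = - pat (-1) 1 0" "pat (-1) 1 (Suc 1) = pat (-1) 1 1" by (simp_all add: pat_neg_parity)
  obtain v1 where v1: "real 0 * E < v1" "v1 < (real 0 + 1) * E" "ptr (pat (-1) 1) E v1 = 0"
    using C.cell_exists[OF E(1) c1(1)] by blast
  have "W.zeros E \<subseteq> {v1}"
  proof
    fix v assume v: "v \<in> W.zeros E"
    hence z: "ptr (pat (-1) 1) E v = 0" and vi: "v \<le> 3/2 * E" unfolding W.zeros_def by auto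
    have "v > E/2 - 1" using left[OF E(2), of v] z by fastforce
    hence v0: "v \<ge> 0" using E by simp
    have "v < E"
    proof (rule ccontr)
      assume "\<not> v < E"
      thus False using C.cell_same[OF E(1), of 1 v] c1(2) z vi E by simp
    qed
    thus "v \<in> {v1}" using C.cell_unique[OF E(1) c1(1), of v v1] v0 z v1 by simp
  qed
  hence "W.zeros E = {} \<or> W.zeros E = {v1}" by blast
  moreover have "zorder (pt (pat (-1) 1) (of_real E)) (of_real v1) = 1"
    by (rule C.cell_zero(3)[OF E(1) _ _ c1(1) v1(3)]) (use v1 in auto)
  moreover have "A = {} \<or> A = {v1} \<Longrightarrow> f v1 = 1 \<Longrightarrow> sum f A \<le> 1" for A and f :: "real \<Rightarrow> nat" by auto
  ultimately have "W.Z E \<le> 1" unfolding W.Z_eq_sum by (metis nat_one_as_int nat_int of_nat_1)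
  thus ?thesis using W.Z_mono[OF e E(3)] by simp
qed

text \<open>Negative \<open>q\<close>, positive zeros. The signs change after even indices; as the
  zero of the cell 0 has no partner, the windows start at the grid point of index 1, and at their
  ends both summands are negative.\<close>

interpretation C: theta_pattern "pat (-1) 1" 2 "-1/2" "pi/2" "-1" "1" "Psi2 (-1)" "\<lambda>s. 4 * s + 2" "\<lambda>s. 4 * s + 4"
proof unfold_locales
  show "3/2 < pi/2" using pi_gt3 by simp
  fix e v :: real assume e: "e > 0"
  show "ptr (pat (-1) 1) e v = Psi2 (-1) e v + (-1) * exp (- e/2 - v) * ptr (pat (-1) 1) e (- v - e)" by (rule pat_C_split[OF e])
  show "(1 - exp (- e/2))^2 * exp (- ((pi/2)^2 / (2*e))) \<le> Psi2 (-1) e (-1/2 * e)" by (rule Psi2_lower[OF e]) simp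
  show "v \<le> -1 \<Longrightarrow> ptr (pat (-1) 1) e v > 0" using e by (intro C.ptr_pos_left) auto
  fix s k :: nat
  show "Psi2 (-1) e ((real 2 * real k + -1/2) * e) = (-1)^k * exp ((((real 2 * real k + -1/2) * e)^2 - (-1/2 * e)^2) / (2*e)) * Psi2 (-1) e (-1/2 * e)"
    using Psi2_grid[OF e, of "-1" k] by simp
  show "0 < (-1)^1 * ptr (pat (-1) 1) e ((real 2 * real (2 * s + 1) + -1/2) * e)"
    using C_barrier[OF e, of s] by simp
  show "C.zcount e {-1..(real 2 * real 1 + -1/2) * e} \<le> 1" using C_low[OF e] by simp
next
  fix y :: real assume y: "0 < y" "y < 1"
  show "(\<Sum>j. pat (-1) 1 j * y^j) > 0" using pat_limit_pos[OF y, of "-1"] by simp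
next
  fix s n :: nat
  assume 1: "real 2 * real (2 * s + 1) + -1/2 < real n + 1" "real n < real 2 * real (2 * s + 2 + 1) + -1/2"
    and 2: "n \<noteq> 4 * s + 2" "n \<noteq> 4 * s + 4"
  have "real (4 * s + 1) < real (Suc n)" "real n < real (4 * s + 6)" using 1 by simp_all
  hence "4 * s + 1 \<le> n" "n \<le> 4 * s + 5" by linarith+
  hence "n = 4 * s + 1 \<or> n = 4 * s + 3 \<or> n = 4 * s + 5" using 2 by linarith
  hence "odd n" by auto
  thus "pat (-1) 1 (Suc n) = pat (-1) 1 n" by (simp add: pat_neg_parity)
next
  fix \<eta> :: real assume "\<eta> > 0"
  thus "\<forall>\<^sub>F e in at_right 0. \<forall>v\<ge>e. \<bar>Psi2 (-1) e v\<bar> \<le> exp ((v^2 - (pi/2)^2 + \<eta>) / (2*e))" by (rule Psi2_upper) simp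
next
  show "pat (-1) 1 (Suc (4 * s + 2)) = - pat (-1) 1 (4 * s + 2)"
    "pat (-1) 1 (Suc (4 * s + 4)) = - pat (-1) 1 (4 * s + 4)" for s :: nat
    by (subst pat_neg_parity, simp)+
qed simp_all

section \<open>The zeros of the partial theta function\<close>

lemma triangle_of_nat: "(of_nat (j * (j + 1) div 2) :: complex) = of_nat j * (of_nat j + 1) / 2"
proof -
  have "even (j * (j + 1))" by simp
  then obtain m where m: "j * (j + 1) = 2 * m" by (elim evenE)
  have "(of_nat j :: complex) * (of_nat j + 1) = of_nat (j * (j + 1))" by (simp add: algebra_simps)
  also have "\<dots> = 2 * of_nat m" unfolding m by simp
  finally show ?thesis unfolding m by simp
qed

text \<open>The shift by \<open>e/2\<close> completes the exponent:
  \<open>j (w + e/2) - e j (j + 1) / 2 = j w - e j^2 / 2\<close>.\<close>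

lemma theta_eq_pt:
  "theta (of_real (k * exp (- e))) (of_real s * exp (w + of_real e / 2)) = pt (pat k s) (of_real e) w"
  unfolding theta_def pt_def
proof (rule arg_cong[of _ _ suminf], rule ext)
  fix j
  have "(of_real (exp (- e)) :: complex) ^ (j * (j + 1) div 2) = exp (- (of_nat (j * (j + 1) div 2) * of_real e))"
    by (simp add: exp_of_nat_mult[symmetric] exp_of_real[symmetric])
  hence "(of_real (k * exp (- e)) :: complex) ^ (j * (j + 1) div 2) * (of_real s * exp (w + of_real e / 2)) ^ j =
     of_real (pat k s j) * (exp (- (of_nat (j * (j + 1) div 2) * of_real e)) * exp (of_nat j * (w + of_real e / 2)))"
    by (simp add: pat_def power_mult_distrib exp_of_nat_mult)
  also have "exp (- (of_nat (j * (j + 1) div 2) * of_real e)) * exp (of_nat j * (w + of_real e / 2)) =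
      exp (of_nat j * w - of_real e * (of_nat j)^2 / 2)"
    unfolding exp_add[symmetric] triangle_of_nat by (rule arg_cong[of _ _ exp]) (simp add: field_simps power2_eq_square)
  finally show "(of_real (k * exp (- e)) :: complex) ^ (j * (j + 1) div 2) * (of_real s * exp (w + of_real e / 2)) ^ j =
     ptt (pat k s) j (of_real e) w" by (simp add: ptt_def)
qed

lemma theta_0: "theta q 0 = 1"
proof -
  have "(\<lambda>j. q ^ (j * (j + 1) div 2) * 0 ^ j) sums q ^ (0 * (0 + 1) div 2)"
    using powser_sums_zero[of "\<lambda>j. q ^ (j * (j + 1) div 2)"] by simp
  thus ?thesis by (simp add: theta_def sums_iff)
qed

locale sign_pattern =
  fixes k s :: real
  assumes k: "k = 1 \<or> k = -1" and s: "s = 1 \<or> s = -1"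
begin

sublocale sign_seq "pat k s" by (rule sign_seq_pat) (use k s in auto)

definition coord :: "real \<Rightarrow> real \<Rightarrow> real" where "coord e v = s * exp (v + e/2)"

lemma s_mult_s: "s * s = 1" using s by auto

lemma coord_inverse: "s * x > 0 \<Longrightarrow> coord e (ln (s * x) - e/2) = x"
  using s_mult_s by (simp add: coord_def mult.assoc[symmetric])

lemma ln_coord: "ln (s * coord e v) - e/2 = v"
  using s_mult_s by (simp add: coord_def mult.assoc[symmetric])

lemma theta_coord: "theta (of_real (k * exp (- e))) (of_real (coord e v)) = pt (pat k s) (of_real e) (of_real v)"
proof -
  have "exp (of_real v + of_real e / 2 :: complex) = of_real (exp (v + e/2))"
    by (metis exp_of_real of_real_add of_real_divide of_real_numeral)
  hence "complex_of_real (coord e v) = of_real s * exp (of_real v + of_real e / 2)"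
    unfolding coord_def of_real_mult by (rule arg_cong[OF sym])
  thus ?thesis by (rule ssubst) (rule theta_eq_pt)
qed

lemma theta_zero_iff: "e > 0 \<Longrightarrow> theta (of_real (k * exp (- e))) (of_real (coord e v)) = 0 \<longleftrightarrow> ptr (pat k s) e v = 0"
  by (simp only: theta_coord pt_eq_0_real_iff)

text \<open>The change of variable is locally biholomorphic, so orders are preserved. Its inverse
  \<open>g\<close> uses the principal logarithm at the positive number \<open>s * z0\<close>, away
  from the cut.\<close>

lemma zorder_theta:
  assumes e: "e > 0"
  shows "zorder (theta (of_real (k * exp (- e)))) (of_real (coord e v)) = zorder (pt (pat k s) (of_real e)) (of_real v)"
proof -
  define c where "c = pat k s"
  define z0 where "z0 = (of_real (coord e v) :: complex)"
  define g where "g z = Ln (of_real s * z) - of_real e / 2" for z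
  have sz0: "of_real s * z0 = of_real (exp (v + e/2))"
    using s_mult_s by (simp add: z0_def coord_def mult.assoc[symmetric] flip: of_real_mult)
  have z0: "z0 \<noteq> 0" using sz0 by auto
  have nonpos: "of_real s * z0 \<notin> \<real>\<^sub>\<le>\<^sub>0" unfolding sz0 by (simp add: complex_nonpos_Reals_iff)
  have gz0: "g z0 = of_real v" unfolding g_def sz0 by (simp add: Ln_of_real)
  have gan: "g analytic_on {z0}" unfolding g_def using nonpos by (auto intro!: analytic_intros)
  have eqf: "theta (of_real (k * exp (- e))) z = (pt c (of_real e) \<circ> g) z" if "z \<noteq> 0" for z
  proof -
    have "of_real s * exp (g z + of_real e / 2) = (of_real (s * s) :: complex) * z"
      using that s by (auto simp: g_def)
    hence "of_real s * exp (g z + of_real e / 2) = z" using s_mult_s by simp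
    thus ?thesis using theta_eq_pt[of k e s "g z"] by (simp add: c_def)
  qed
  have "\<forall>\<^sub>F z in nhds z0. z \<noteq> 0" using z0 by (intro t1_space_nhds)
  hence ev: "\<forall>\<^sub>F z in nhds z0. theta (of_real (k * exp (- e))) z = (pt c (of_real e) \<circ> g) z"
    by eventually_elim (rule eqf)
  have "zorder (theta (of_real (k * exp (- e)))) z0 = zorder (pt c (of_real e) \<circ> g) z0"
    by (rule zorder_cong) (use ev in \<open>auto simp: eventually_nhds_conv_at\<close>)
  also have "\<dots> = zorder (pt c (of_real e)) (g z0) * zorder (\<lambda>x. g x - g z0) z0"
  proof (rule zorder_compose')
    have an: "pt c (of_real e) analytic_on {g z0}" unfolding c_def by (rule pt_analytic) (use e in simp)
    thus "isolated_singularity_at (pt c (of_real e)) (g z0)" "not_essential (pt c (of_real e)) (g z0)"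
      by (auto intro: isolated_singularity_at_analytic not_essential_analytic)
    show "g analytic_on {z0}" by (rule gan)
    show "\<forall>\<^sub>F w in at (g z0). pt c (of_real e) w \<noteq> 0"
    proof -
      have "finite {w \<in> cball (g z0) 1. pt c (of_real e) w = 0}"
        unfolding c_def by (intro finite_zeros_pt e compact_cball)
      hence "\<not> g z0 islimpt {w \<in> cball (g z0) 1. pt c (of_real e) w = 0}" by (simp add: islimpt_finite)
      hence "\<forall>\<^sub>F w in at (g z0). w \<notin> {w \<in> cball (g z0) 1. pt c (of_real e) w = 0}"
        by (simp add: islimpt_conv_frequently_at frequently_def)
      moreover have "\<forall>\<^sub>F w in at (g z0). w \<in> ball (g z0) 1"
        by (rule eventually_at_in_open') auto
      ultimately show ?thesis by eventually_elim auto
    qed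
    show "\<forall>\<^sub>F w in at z0. g w \<noteq> g z0"
    proof -
      have "\<forall>\<^sub>F w in at z0. w \<noteq> 0" using \<open>\<forall>\<^sub>F z in nhds z0. z \<noteq> 0\<close> by (simp add: eventually_nhds_conv_at)
      moreover have "\<forall>\<^sub>F w in at z0. w \<noteq> z0" by (simp add: eventually_at_filter)
      ultimately show ?thesis
      proof eventually_elim
        case (elim w)
        have "s \<noteq> 0" using s by auto
        show ?case
        proof
          assume "g w = g z0"
          hence "exp (Ln (of_real s * w)) = exp (Ln (of_real s * z0))" by (simp add: g_def)
          thus False using elim z0 \<open>s \<noteq> 0\<close> by simp
        qed
      qed
    qed
  qed
  also have "zorder (\<lambda>x. g x - g z0) z0 = 1"
  proof (rule zorder_zero_eqI')
    show "(\<lambda>x. g x - g z0) analytic_on {z0}" by (intro analytic_intros gan)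
    have "((\<lambda>x. g x - g z0) has_field_derivative of_real s / (of_real s * z0)) (at z0)"
      unfolding g_def using nonpos by (auto intro!: derivative_eq_intros simp: field_simps)
    hence "deriv (\<lambda>x. g x - g z0) z0 = of_real s / (of_real s * z0)" by (rule DERIV_imp_deriv)
    thus "(deriv ^^ nat 1) (\<lambda>x. g x - g z0) z0 \<noteq> 0" using s z0 by auto
  qed auto
  finally have "zorder (theta (of_real (k * exp (- e)))) z0 = zorder (pt c (of_real e)) (g z0)"
    by (simp only: mult_1_right)
  thus ?thesis unfolding gz0 unfolding z0_def c_def .
qed

lemma zero_count_eq:
  assumes e: "e > 0" and JV: "\<And>v. coord e v \<in> J \<longleftrightarrow> v \<in> V" and pos: "\<And>x. x \<in> J \<Longrightarrow> s * x > 0"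
  shows "zero_count J (k * exp (- e)) = zcount e V"
proof -
  have "bij_betw (coord e) {v. v \<in> V \<and> ptr (pat k s) e v = 0} {x. x \<in> J \<and> theta (of_real (k * exp (- e))) (of_real x) = 0}"
  proof (rule bij_betwI[where g = "\<lambda>x. ln (s * x) - e/2"])
    show "(\<lambda>x. ln (s * x) - e/2) \<in> {x. x \<in> J \<and> theta (of_real (k * exp (- e))) (of_real x) = 0} \<rightarrow> {v. v \<in> V \<and> ptr (pat k s) e v = 0}"
    proof
      fix x assume x: "x \<in> {x. x \<in> J \<and> theta (of_real (k * exp (- e))) (of_real x) = 0}"
      hence cx: "coord e (ln (s * x) - e/2) = x" using pos coord_inverse by blast
      thus "ln (s * x) - e/2 \<in> {v. v \<in> V \<and> ptr (pat k s) e v = 0}"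
        using x JV[of "ln (s * x) - e/2"] theta_zero_iff[OF e, of "ln (s * x) - e/2"] by simp
    qed
    show "coord e \<in> {v. v \<in> V \<and> ptr (pat k s) e v = 0} \<rightarrow> {x. x \<in> J \<and> theta (of_real (k * exp (- e))) (of_real x) = 0}"
      using JV theta_zero_iff[OF e] by auto
  qed (use ln_coord coord_inverse pos in auto)
  from sum.reindex_bij_betw[OF this, of "\<lambda>x. nat (zorder (theta (of_real (k * exp (- e)))) (of_real x))"]
  show ?thesis unfolding zero_count_def zcount_def zorder_theta[OF e] by (rule sym)
qed

end

lemma (in sign_pattern) zero_count_far:
  assumes e: "e > 0" and a: "a > 0"
  shows "zero_count {x. exp al \<le> s * x \<and> s * x \<le> a} (k * exp (- e)) = zcount e {al - e/2..ln a - e/2}"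
proof (rule zero_count_eq[OF e])
  fix v
  have sc: "s * coord e v = exp (v + e/2)" using s_mult_s by (simp add: coord_def mult.assoc[symmetric])
  have "exp (v + e/2) \<le> a \<longleftrightarrow> v + e/2 \<le> ln a" using a by (simp add: ln_ge_iff)
  thus "coord e v \<in> {x. exp al \<le> s * x \<and> s * x \<le> a} \<longleftrightarrow> v \<in> {al - e/2..ln a - e/2}"
    by (auto simp: sc)
next
  fix x assume "x \<in> {x. exp al \<le> s * x \<and> s * x \<le> a}"
  hence "exp al \<le> s * x" by blast
  thus "s * x > 0" using exp_gt_zero[of al] by linarith
qed

lemma (in sign_pattern) zero_count_near:
  assumes e: "e > 0"
  shows "zero_count {x. 0 < s * x \<and> s * x \<le> exp al} (k * exp (- e)) = zcount e {..al - e/2}"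
proof (rule zero_count_eq[OF e])
  fix v
  have sc: "s * coord e v = exp (v + e/2)" using s_mult_s by (simp add: coord_def mult.assoc[symmetric])
  show "coord e v \<in> {x. 0 < s * x \<and> s * x \<le> exp al} \<longleftrightarrow> v \<in> {..al - e/2}"
    by (auto simp: sc)
qed auto

locale theta_pattern' = sign_pattern k s + theta_pattern "pat k s" d o1 al vs kap Psi n1 n2
  for k s d o1 al vs kap Psi n1 n2
begin

section \<open>From \<open>e\<close> back to \<open>q\<close>\<close>

lemma one_minus_exp_ratio: "((\<lambda>e::real. (1 - exp (- e)) / e) \<longlongrightarrow> 1) (at_right 0)"
proof -
  have "((\<lambda>e::real. - exp (- e)) has_real_derivative 1) (at 0)"
    by (auto intro!: derivative_eq_intros)
  hence "((\<lambda>e::real. (- exp (- e) - (- exp (- 0))) / (e - 0)) \<longlongrightarrow> 1) (at 0)"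
    by (simp add: has_field_derivative_iff)
  hence "((\<lambda>e::real. (1 - exp (- e)) / e) \<longlongrightarrow> 1) (at 0)" by simp
  thus ?thesis by (rule filterlim_mono) (auto simp: at_le)
qed

text \<open>The limits are obtained in terms of \<open>e = - ln (k * q)\<close> but are claimed with
  \<open>1 - k * q\<close>; the quotient of the two quantities tends to 1.\<close>

lemma count_transfer:
  assumes lim: "((\<lambda>e. e * real (Z e)) \<longlongrightarrow> L) (at_right 0)"
    and NZ: "\<And>e. e > 0 \<Longrightarrow> N (k * exp (- e)) = Z e"
    and F: "filterlim (\<lambda>q. - ln (k * q)) (at_right 0) F" "\<forall>\<^sub>F q in F. k * q > 0"
  shows "((\<lambda>q. real (N q) * (1 - k * q)) \<longlongrightarrow> L) F"
proof -
  have "((\<lambda>e. (e * real (Z e)) * ((1 - exp (- e)) / e)) \<longlongrightarrow> L * 1) (at_right 0)"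
    by (intro tendsto_mult lim one_minus_exp_ratio)
  moreover have "\<forall>\<^sub>F e in at_right 0. (e * real (Z e)) * ((1 - exp (- e)) / e) = real (N (k * exp (- e))) * (1 - exp (- e))"
    using at_right_0_pos[of 1, simplified] by eventually_elim (simp add: NZ)
  ultimately have "((\<lambda>e. real (N (k * exp (- e))) * (1 - exp (- e))) \<longlongrightarrow> L) (at_right 0)"
    by (simp add: tendsto_cong)
  from filterlim_compose[OF this F(1)]
  have "((\<lambda>q. real (N (k * exp (- (- ln (k * q))))) * (1 - exp (- (- ln (k * q))))) \<longlongrightarrow> L) F" .
  moreover have "\<forall>\<^sub>F q in F. real (N (k * exp (- (- ln (k * q))))) * (1 - exp (- (- ln (k * q)))) = real (N q) * (1 - k * q)"
    using F(2)
  proof eventually_elim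
    case (elim q)
    have "k * (k * q) = q" using k by auto
    moreover have "exp (- (- ln (k * q))) = k * q" using elim by simp
    ultimately show ?case by (simp only:)
  qed
  ultimately show ?thesis by (simp add: tendsto_cong)
qed

text \<open>The zeros are sought only on the outer side of \<open>exp u\<close>, so that they stay
  in the closed half-line even when \<open>u = al\<close>.\<close>

lemma dense_zeros:
  assumes u: "u \<ge> al" and dl: "\<delta> > 0"
  shows "\<exists>h>0. \<forall>e. 0 < e \<and> e < h \<longrightarrow> (\<exists>v. ptr (pat k s) e v = 0 \<and> exp u \<le> exp (v + e/2) \<and> exp (v + e/2) < exp u + \<delta>)"
proof -
  have "((\<lambda>t. exp (u + t)) \<longlongrightarrow> exp (u + 0)) (at_right 0)" by (intro tendsto_intros)
  hence "\<forall>\<^sub>F t in at_right 0. exp (u + t) < exp u + \<delta>" by (rule order_tendstoD) (use dl in simp)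
  moreover have "\<forall>\<^sub>F t in at_right (0::real). 0 < t \<and> t < 1" by (rule at_right_0_pos) simp
  ultimately have "\<forall>\<^sub>F t in at_right 0. exp (u + t) < exp u + \<delta> \<and> 0 < t" by eventually_elim simp
  then obtain t where t: "exp (u + t) < exp u + \<delta>" "t > 0" using eventually_happens'[of "at_right (0::real)"] by force
  define h1 where "h1 = t / 3"
  have h1: "h1 > 0" using t by (simp add: h1_def)
  have d0: "real d > 0" using d by simp
  have "\<forall>\<^sub>F e in at_right 0. (u + 2 * h1 - (u + h1)) / (real d * e) - 2 \<le> real (card {v \<in> {u + h1..u + 2 * h1}. ptr (pat k s) e v = 0})"
    by (rule zeros_lower) (use u h1 in auto)
  moreover have p: "min h1 (h1 / (2 * real d)) > 0" using h1 d0 by simp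
  note at_right_0_pos[OF p]
  ultimately have "\<forall>\<^sub>F e in at_right 0. (\<exists>v. ptr (pat k s) e v = 0 \<and> exp u \<le> exp (v + e/2) \<and> exp (v + e/2) < exp u + \<delta>)"
  proof eventually_elim
    case (elim e)
    have "2 * (real d * e) < h1" using elim d0 by (simp add: field_simps)
    hence "2 < h1 / (real d * e)" using elim d0 by (simp add: less_divide_eq)
    moreover have "u + 2 * h1 - (u + h1) = h1" by simp
    ultimately have "card {v \<in> {u + h1..u + 2 * h1}. ptr (pat k s) e v = 0} \<noteq> 0" using elim(1) by (intro notI) simp
    then obtain v where v: "v \<in> {u + h1..u + 2 * h1}" "ptr (pat k s) e v = 0"
      by (metis (mono_tags, lifting) card.empty empty_Collect_eq)
    have "exp (v + e/2) \<le> exp (u + t)" using v elim h1 by (simp add: h1_def)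
    hence "exp (v + e/2) < exp u + \<delta>" using t(1) by linarith
    moreover have "exp u \<le> exp (v + e/2)" using v elim h1 by simp
    ultimately show ?case using v by blast
  qed
  thus ?thesis unfolding eventually_at_right_field by blast
qed

text \<open>Near a given point zeros exist for every small \<open>e\<close>, so it suffices that
  arbitrarily small times have their zeros in \<open>E\<close>.\<close>

lemma dense:
  assumes E: "\<And>h. h > 0 \<Longrightarrow> \<exists>e. 0 < e \<and> e < h \<and> (\<forall>z. theta (of_real (k * exp (- e))) z = 0 \<longrightarrow> z \<in> E)"
  shows "everywhere_dense_in E {x. exp al \<le> s * x}"
  unfolding everywhere_dense_in_def
proof
  fix z assume "z \<in> complex_of_real ` {x. exp al \<le> s * x}"
  then obtain x where x: "z = of_real x" "exp al \<le> s * x" by blast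
  show "z \<in> closure (E \<inter> complex_of_real ` {x. exp al \<le> s * x})"
    unfolding closure_approachable
  proof (intro allI impI)
    fix \<delta> :: real assume dl: "\<delta> > 0"
    define u where "u = ln (s * x)"
    have sx: "s * x > 0" using x(2) exp_gt_zero[of al] by linarith
    have u: "u \<ge> al" "exp u = s * x" using x sx by (auto simp: u_def ln_ge_iff)
    obtain h where h: "h > 0" "\<And>e. 0 < e \<Longrightarrow> e < h \<Longrightarrow> \<exists>v. ptr (pat k s) e v = 0 \<and> exp u \<le> exp (v + e/2) \<and> exp (v + e/2) < exp u + \<delta>"
      using dense_zeros[OF u(1) dl] by blast
    obtain e where e: "0 < e" "e < h" "\<And>z. theta (of_real (k * exp (- e))) z = 0 \<Longrightarrow> z \<in> E" using E[OF h(1)] by blast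
    obtain v where v: "ptr (pat k s) e v = 0" "exp u \<le> exp (v + e/2)" "exp (v + e/2) < exp u + \<delta>" using h(2)[OF e(1,2)] by blast
    define y where "y = coord e v"
    have sy: "s * y = exp (v + e/2)" using s_mult_s by (simp add: y_def coord_def mult.assoc[symmetric])
    have "of_real y \<in> E" using e(3) theta_zero_iff[OF e(1), of v] v(1) by (simp add: y_def)
    moreover have "exp al \<le> s * y" unfolding sy using v(2) u(2) x(2) by linarith
    moreover have "dist (complex_of_real y) z < \<delta>"
    proof -
      have "dist (complex_of_real y) z = \<bar>y - x\<bar>" unfolding x(1) dist_norm by (metis norm_of_real of_real_diff)
      also have "\<dots> = \<bar>s * y - s * x\<bar>" using s by auto
      also have "\<dots> < \<delta>" using v sy u by simp
      finally show ?thesis .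
    qed
    ultimately show "\<exists>y\<in>E \<inter> complex_of_real ` {x. exp al \<le> s * x}. dist y z < \<delta>" by blast
  qed
qed

end

section \<open>Negative spectral numbers\<close>

lemma filterlim_neg_exp: "filterlim (\<lambda>e::real. - exp (- e)) (at_left 0) at_top"
proof -
  have "((\<lambda>e::real. exp (- e)) \<longlongrightarrow> 0) at_top"
    by (rule filterlim_compose[OF exp_at_bot]) (simp add: filterlim_uminus_at_bot_at_top)
  from tendsto_minus[OF this] have "((\<lambda>e::real. - exp (- e)) \<longlongrightarrow> 0) at_top" by simp
  thus ?thesis by (simp add: filterlim_at)
qed

lemma filterlim_neg_ln: "filterlim (\<lambda>q::real. - ln (- q)) at_top (at_left 0)"
proof -
  have "filterlim (\<lambda>q::real. - q) (at_right 0) (at_left 0)"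
    by (simp add: filterlim_at_left_to_right filterlim_ident)
  hence "filterlim (\<lambda>q::real. ln (- q)) at_bot (at_left 0)" by (rule filterlim_compose[OF ln_at_0])
  thus ?thesis by (simp add: filterlim_uminus_at_top)
qed

text \<open>As the error in the two-term balance vanishes, the ratio of the dominant terms tends to
  1. In the original variables this says that the zero in the cell \<open>n\<close> is asymptotic to
  \<open>- q^(- n - 1)\<close>, so it carries the label \<open>n + 1\<close>.\<close>

lemma (in sign_seq) cell_ratio_tendsto:
  assumes cc: "c (Suc n) = - c n"
    and V: "\<forall>\<^sub>F e in at_top. ptr c e (V e) = 0 \<and> real n * e \<le> V e \<and> V e \<le> (real n + 1) * e"
  shows "((\<lambda>e. exp (V e - (real n + 1/2) * e)) \<longlongrightarrow> 1) at_top"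
proof (rule Lim_transform2)
  show "((\<lambda>_. 1 :: real) \<longlongrightarrow> 1) at_top" by simp
  show "((\<lambda>e. 1 - exp (V e - (real n + 1/2) * e)) \<longlongrightarrow> 0) at_top"
  proof (rule Lim_null_comparison)
    have "((\<lambda>e. 4 * cell_err e) \<longlongrightarrow> 4 * 0) at_top" by (intro tendsto_mult_left cell_err_tendsto)
    thus "((\<lambda>e. 4 * cell_err e) \<longlongrightarrow> 0) at_top" by simp
    show "\<forall>\<^sub>F e in at_top. norm (1 - exp (V e - (real n + 1/2) * e)) \<le> 4 * cell_err e"
      using V eventually_ge_at_top[of 10]
    proof eventually_elim
      case (elim e)
      define R where "R = exp (V e - (real n + 1/2) * e)"
      have 1: "\<bar>R - 1\<bar> \<le> cell_err e * (1 + R)"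
        unfolding R_def by (rule cell_zero(1)[OF elim(2) _ _ cc]) (use elim in auto)
      have b: "0 < cell_err e" "cell_err e \<le> 1/10" using cell_err_bounds[OF elim(2)] by auto
      have Rp: "R > 0" by (simp add: R_def)
      have "cell_err e * (1 + R) \<le> 1/10 * (1 + R)" using b Rp by (intro mult_right_mono) auto
      hence "\<bar>R - 1\<bar> \<le> 1/10 + R/10" using 1 by simp
      hence "R \<le> 3" by (simp add: abs_le_iff)
      hence "cell_err e * (1 + R) \<le> cell_err e * 4" using b by (intro mult_left_mono) auto
      thus ?case using 1 by (simp add: R_def abs_minus_commute)
    qed
  qed
qed

text \<open>The parity conditions say that \<open>- q^(- n - 1)\<close> has the sign
  \<open>s\<close> for \<open>n = n1 i\<close> and \<open>n = n2 i\<close>.\<close>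

locale neg_pattern = theta_pattern' "-1" s d o1 al vs kap Psi n1 n2
  for s d o1 al vs kap Psi n1 n2 +
  assumes par1: "(-1)^(n1 i) = s" and par2: "(-1)^(n2 i) = s"
begin

abbreviation "c \<equiv> pat (-1) s"

lemma theta_neg_zero_iff: "e > 0 \<Longrightarrow> theta (of_real (- exp (- e))) (of_real (coord e v)) = 0 \<longleftrightarrow> ptr c e v = 0"
  using theta_zero_iff[of e v] by simp

lemma zorder_neg: "e > 0 \<Longrightarrow> zorder (theta (of_real (- exp (- e)))) (of_real (coord e v)) = zorder (pt c (of_real e)) (of_real v)"
  using zorder_theta[of e v] by simp

section \<open>Branches of zeros followed from \<open>q = 0\<close>\<close>

lemma minus_powi_neg_eq:
  assumes "(-1)^n = s"
  shows "- ((- exp (- e)) powi (- int (Suc n))) = s * exp (real (Suc n) * e)"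
proof -
  have "(- exp (- e)) ^ Suc n = (-1)^Suc n * exp (- (real (Suc n) * e))"
    by (subst power_minus) (simp only: exp_of_nat_mult[symmetric] mult_minus_right)
  also have "(-1)^Suc n = - s" using assms by simp
  finally have "inverse ((- exp (- e)) ^ Suc n) = - s * exp (real (Suc n) * e)"
    using s by (auto simp: exp_minus)
  thus ?thesis unfolding power_int_minus power_int_of_nat by simp
qed

text \<open>Before the logarithm can be taken, the sign of the branch must be known: near
  \<open>q = 0\<close> it is \<open>s\<close> by the asymptotics, and it cannot change because
  \<open>theta q 0 = 1\<close>.\<close>

lemma branch_coord:
  assumes br: "zero_branch (Suc n) b F" and b: "-1 < b" "b < 0" and n: "(-1)^n = s"
  defines "V \<equiv> \<lambda>e. ln (s * F (- exp (- e))) - e/2"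
  shows "continuous_on {- ln (- b)..} V"
    and "\<And>e. - ln (- b) \<le> e \<Longrightarrow> F (- exp (- e)) = coord e (V e) \<and> ptr c e (V e) = 0"
    and "\<And>e. - ln (- b) < e \<Longrightarrow> zorder (pt c (of_real e)) (of_real (V e)) = 1"
    and "((\<lambda>e. exp (V e - (real n + 1/2) * e)) \<longlongrightarrow> 1) at_top"
proof -
  have cF: "continuous_on {b..<0} F" and zF: "\<And>q. q \<in> {b..<0} \<Longrightarrow> theta (of_real q) (of_real (F q)) = 0"
    and sF: "\<And>q. q \<in> {b<..<0} \<Longrightarrow> zorder (theta (of_real q)) (of_real (F q)) = 1"
    and aF: "F \<sim>[at_left 0] (\<lambda>q. - (q powi (- int (Suc n))))"
    using br by (auto simp: zero_branch_def)
  have eb: "- ln (- b) > 0" using b by simp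
  have q_in: "- exp (- e) \<in> {b..<0}" if "- ln (- b) \<le> e" for e
  proof -
    have "exp (- e) \<le> exp (ln (- b))" using that by simp
    thus ?thesis using b by simp
  qed
  have "\<forall>\<^sub>F q in at_left (0::real). - (q powi (- int (Suc n))) \<noteq> 0"
    by (auto simp: eventually_at_left_field intro!: exI[of _ "-1"])
  hence "((\<lambda>q. F q / - (q powi (- int (Suc n)))) \<longlongrightarrow> 1) (at_left 0)"
    by (intro asymp_equivD_strong[OF aF]) (auto elim: eventually_mono)
  from filterlim_compose[OF this filterlim_neg_exp]
  have lim: "((\<lambda>e. F (- exp (- e)) / (s * exp (real (Suc n) * e))) \<longlongrightarrow> 1) at_top"
    unfolding minus_powi_neg_eq[OF n] .
  have Fne: "F q \<noteq> 0" if "q \<in> {b..<0}" for q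
    using zF[OF that] theta_0[of "of_real q"] by auto
  have "\<forall>\<^sub>F e in at_top. F (- exp (- e)) / (s * exp (real (Suc n) * e)) > 0"
    using lim by (rule order_tendstoD) simp
  hence sev: "\<forall>\<^sub>F e in at_top. s * F (- exp (- e)) > 0"
  proof eventually_elim
    case (elim e)
    have "s * F (- exp (- e)) = exp (real (Suc n) * e) * (F (- exp (- e)) / (s * exp (real (Suc n) * e)))"
      using s by auto
    also have "\<dots> > 0" using elim by (rule mult_pos_pos[OF exp_gt_zero])
    finally show ?case .
  qed
  have pos: "s * F q > 0" if q: "q \<in> {b..<0}" for q
  proof (rule ccontr)
    assume np: "\<not> s * F q > 0"
    have "\<forall>\<^sub>F e in at_top. s * F (- exp (- e)) > 0 \<and> e \<ge> - ln (- q)"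
      using sev eventually_ge_at_top by (rule eventually_conj)
    then obtain e where e: "s * F (- exp (- e)) > 0" "e \<ge> - ln (- q)" by (auto simp: eventually_at_top_linorder)
    have "exp (- e) \<le> exp (ln (- q))" using e by simp
    moreover have "exp (ln (- q)) = - q" using q by simp
    ultimately have qe: "q \<le> - exp (- e)" by linarith
    have "continuous_on {q..- exp (- e)} (\<lambda>q. s * F q)"
      by (intro continuous_intros continuous_on_subset[OF cF]) (use q in \<open>auto simp: le_less_trans\<close>)
    then obtain x where x: "q \<le> x" "x \<le> - exp (- e)" "s * F x = 0"
      using IVT'[of "\<lambda>q. s * F q" q 0 "- exp (- e)"] np e qe by auto
    have "x < 0" using x(2) exp_gt_zero[of "- e"] by linarith
    hence "x \<in> {b..<0}" using x q by auto
    thus False using Fne x(3) s by auto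
  qed
  have cV: "F (- exp (- e)) = coord e (V e)" if "- ln (- b) \<le> e" for e
    unfolding V_def by (rule coord_inverse[symmetric]) (rule pos[OF q_in[OF that]])
  thus FV: "F (- exp (- e)) = coord e (V e) \<and> ptr c e (V e) = 0" if "- ln (- b) \<le> e" for e
    using zF[OF q_in[OF that]] that theta_neg_zero_iff[of e "V e"] eb by simp
  show "zorder (pt c (of_real e)) (of_real (V e)) = 1" if e: "- ln (- b) < e" for e
  proof -
    have "exp (- e) < exp (ln (- b))" using e by simp
    hence "- exp (- e) \<in> {b<..<0}" using b by simp
    from sF[OF this] show ?thesis using cV[of e] e eb zorder_neg[of e "V e"] by simp
  qed
  show "continuous_on {- ln (- b)..} V"
    unfolding V_def
    by (intro continuous_intros continuous_on_compose2[OF cF]) (use q_in pos in \<open>force+\<close>)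
  have "\<forall>\<^sub>F e in at_top. F (- exp (- e)) / (s * exp (real (Suc n) * e)) = exp (V e - (real n + 1/2) * e)"
    using eventually_ge_at_top[of "- ln (- b)"]
  proof eventually_elim
    case (elim e)
    have "coord e (V e) / (s * exp (real (Suc n) * e)) = exp (V e + e/2) / exp (real (Suc n) * e)"
      using s by (auto simp: coord_def)
    also have "\<dots> = exp (V e - (real n + 1/2) * e)"
      unfolding exp_diff[symmetric] by (rule arg_cong[of _ _ exp]) (simp add: algebra_simps)
    finally show ?case using cV[OF elim] by simp
  qed
  with lim show "((\<lambda>e. exp (V e - (real n + 1/2) * e)) \<longlongrightarrow> 1) at_top" by (simp add: tendsto_cong)
qed

lemma eventually_in_cell:
  assumes "((\<lambda>e. exp (V e - (real n + 1/2) * e)) \<longlongrightarrow> 1) at_top"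
  shows "\<forall>\<^sub>F e in at_top. real n * e \<le> V e \<and> V e \<le> (real n + 1) * e"
proof -
  have "\<forall>\<^sub>F e in at_top. 1/2 < exp (V e - (real n + 1/2) * e)" "\<forall>\<^sub>F e in at_top. exp (V e - (real n + 1/2) * e) < 2"
    by (rule order_tendstoD[OF assms]; simp)+
  thus ?thesis using eventually_ge_at_top[of 10]
  proof eventually_elim
    case (elim e)
    have e5: "exp (5::real) > 2" using exp_ge_add_one_self[of "5::real"] by linarith
    have "exp (- 5 :: real) < 1/2" using e5 by (simp add: exp_minus field_simps)
    hence "exp (- 5) < exp (V e - (real n + 1/2) * e)" "exp (V e - (real n + 1/2) * e) < exp 5"
      using elim e5 by linarith+
    hence "- 5 < V e - (real n + 1/2) * e" "V e - (real n + 1/2) * e < 5" by simp_all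
    thus ?case using elim(3) by (simp add: algebra_simps)
  qed
qed

text \<open>A small interval around the simple zero has count 1, and by upper semicontinuity the
  count does not exceed 1 at nearby times.\<close>

lemma locally_unique:
  assumes t: "t > 0" and z: "zorder (pt c (of_real t)) (of_real v) = 1"
  shows "\<exists>dl>0. \<forall>\<^sub>F e in at t. \<forall>x y. \<bar>x - v\<bar> \<le> dl \<and> \<bar>y - v\<bar> \<le> dl \<and> ptr c e x = 0 \<and> ptr c e y = 0 \<longrightarrow> x = y"
proof -
  have v0: "ptr c t v = 0" using zorder_pt(2)[OF t, of "of_real v"] z pt_of_real[OF t, of v] by simp
  define A where "A = {x \<in> {v - 1..v + 1}. ptr c t x = 0} - {v}"
  have fin: "finite ((\<lambda>x. \<bar>x - v\<bar>) ` A)" unfolding A_def using finite_zeros_ptr[OF t] by auto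
  have pos: "0 < x" if "x \<in> (\<lambda>x. \<bar>x - v\<bar>) ` A" for x using that by (auto simp: A_def)
  obtain r where "r > 0" "\<forall>x\<in>(\<lambda>x. \<bar>x - v\<bar>) ` A. r \<le> x" using finite_pos_lower_bound[OF fin pos] by blast
  hence r: "r > 0" "\<And>x. x \<in> A \<Longrightarrow> r \<le> \<bar>x - v\<bar>" by auto
  define dl where "dl = min (r/2) 1"
  have dl: "dl > 0" "dl \<le> 1" "dl < r" using r by (auto simp: dl_def min_def)
  have nz: "x = v" if "\<bar>x - v\<bar> \<le> dl" "ptr c t x = 0" for x
  proof (rule ccontr)
    assume "x \<noteq> v"
    hence "x \<in> A" using that dl by (auto simp: A_def abs_le_iff)
    thus False using r(2) that dl by force
  qed
  have "{x. x \<in> {v - dl..v + dl} \<and> ptr c t x = 0} = {v}"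
    using nz v0 dl by (auto simp: abs_le_iff)
  hence Z1: "zcount t {v - dl..v + dl} = 1" using z by (simp add: zcount_def)
  have "\<forall>\<^sub>F e in at t. zcount e {v - dl..v + dl} \<le> zcount t {v - dl..v + dl}"
    by (rule zcount_usc[OF t]) (use dl nz[of "v - dl"] nz[of "v + dl"] in auto)
  moreover have "\<forall>\<^sub>F e in at t. e > 0" using t order_tendstoD(1)[OF tendsto_ident_at] by blast
  ultimately have "\<forall>\<^sub>F e in at t. \<forall>x y. \<bar>x - v\<bar> \<le> dl \<and> \<bar>y - v\<bar> \<le> dl \<and> ptr c e x = 0 \<and> ptr c e y = 0 \<longrightarrow> x = y"
  proof eventually_elim
    case (elim e)
    have le1: "card {x \<in> {v - dl..v + dl}. ptr c e x = 0} \<le> 1"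
      using card_le_zcount[OF elim(2), of "{v - dl..v + dl}" "v - dl" "v + dl"] elim(1) Z1 by simp
    show ?case
    proof (intro allI impI, elim conjE)
      fix x y assume xy: "\<bar>x - v\<bar> \<le> dl" "\<bar>y - v\<bar> \<le> dl" "ptr c e x = 0" "ptr c e y = 0"
      hence "x \<in> {x \<in> {v - dl..v + dl}. ptr c e x = 0}" "y \<in> {x \<in> {v - dl..v + dl}. ptr c e x = 0}"
        by (auto simp: abs_le_iff)
      thus "x = y" using le1 unfolding One_nat_def card_le_Suc0_iff_eq[OF finite_zeros_ptr[OF elim(2)]] by blast
    qed
  qed
  thus ?thesis using dl by blast
qed

text \<open>For large \<open>e\<close> both branches lie in the same cell and agree. At the supremum
  of the times of disagreement they agree by continuity, and local uniqueness extends this to a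
  neighbourhood, a contradiction. As \<open>b1 < b2\<close>, the first branch is simple at all times
  considered, including the last.\<close>

lemma branch_unique:
  assumes br1: "zero_branch (Suc n) b1 F1" and br2: "zero_branch (Suc n) b2 F2"
    and b: "-1 < b1" "b1 < b2" "b2 < 0" and n: "(-1)^n = s" and cc: "c (Suc n) = - c n"
  shows "F1 b2 = F2 b2"
proof -
  define V1 where "V1 e = ln (s * F1 (- exp (- e))) - e/2" for e
  define V2 where "V2 e = ln (s * F2 (- exp (- e))) - e/2" for e
  define e1 where "e1 = - ln (- b1)"
  define e2 where "e2 = - ln (- b2)"
  have e12: "0 < e1" "e1 < e2" using b by (auto simp: e1_def e2_def)
  note B1 = branch_coord[OF br1 b(1) order.strict_trans[OF b(2,3)] n, folded V1_def e1_def]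
  note B2 = branch_coord[OF br2 order.strict_trans[OF b(1,2)] b(3) n, folded V2_def e2_def]
  have "\<forall>\<^sub>F e in at_top. V1 e = V2 e"
    using eventually_in_cell[OF B1(4)] eventually_in_cell[OF B2(4)] eventually_ge_at_top[of 10] eventually_ge_at_top[of e2]
  proof eventually_elim
    case (elim e)
    show ?case using cell_unique[OF elim(3) cc, of "V1 e" "V2 e"] elim B1(2)[of e] B2(2)[of e] e12 by simp
  qed
  then obtain M where M: "\<And>e. e \<ge> M \<Longrightarrow> V1 e = V2 e" by (auto simp: eventually_at_top_linorder)
  define T where "T = {e. e \<ge> e2 \<and> V1 e \<noteq> V2 e}"
  have "T = {}"
  proof (rule ccontr)
    assume ne: "T \<noteq> {}"
    have bdd: "bdd_above T" using M by (intro bdd_aboveI[of _ M]) (auto simp: T_def intro: ccontr)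
    define t where "t = Sup T"
    have t2: "t \<ge> e2" using ne bdd cSup_upper[of _ T] by (force simp: T_def t_def)
    have t0: "t > 0" using t2 e12 by simp
    have cont: "continuous_on {e2..} V1" "continuous_on {e2..} V2"
      using B1(1) B2(1) e12 by (auto intro: continuous_on_subset)
    have lim: "(V1 \<longlongrightarrow> V1 t) (at t within {e2..})" "(V2 \<longlongrightarrow> V2 t) (at t within {e2..})"
      using cont t2 by (auto simp: continuous_on_def)
    have limr: "(V1 \<longlongrightarrow> V1 t) (at_right t)" "(V2 \<longlongrightarrow> V2 t) (at_right t)"
      by (rule tendsto_within_subset[OF lim(1)] tendsto_within_subset[OF lim(2)]; use t2 in force)+
    have "\<forall>\<^sub>F e in at_right t. e > t" by (simp add: eventually_at_right_less)
    hence "\<forall>\<^sub>F e in at_right t. V1 e = V2 e"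
    proof eventually_elim
      case (elim e)
      hence "e \<notin> T" using cSup_upper[OF _ bdd, of e] by (auto simp: t_def)
      thus ?case using elim t2 by (simp add: T_def)
    qed
    hence "(V2 \<longlongrightarrow> V1 t) (at_right t)" using limr(1) by (simp add: tendsto_cong)
    hence eqt: "V1 t = V2 t" using limr(2) tendsto_unique[of "at_right t"] by auto
    have zt: "zorder (pt c (of_real t)) (of_real (V1 t)) = 1" by (rule B1(3)) (use t2 e12 in simp)
    obtain dl where dl: "dl > 0" "\<forall>\<^sub>F e in at t. \<forall>x y. \<bar>x - V1 t\<bar> \<le> dl \<and> \<bar>y - V1 t\<bar> \<le> dl \<and> ptr c e x = 0 \<and> ptr c e y = 0 \<longrightarrow> x = y"
      using locally_unique[OF t0 zt] by blast
    have "\<forall>\<^sub>F e in at t within {e2..}. \<bar>V1 e - V1 t\<bar> < dl" "\<forall>\<^sub>F e in at t within {e2..}. \<bar>V2 e - V1 t\<bar> < dl"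
      using lim dl(1) unfolding eqt[symmetric] by (auto simp: tendsto_iff dist_real_def)
    moreover have "\<forall>\<^sub>F e in at t within {e2..}. \<forall>x y. \<bar>x - V1 t\<bar> \<le> dl \<and> \<bar>y - V1 t\<bar> \<le> dl \<and> ptr c e x = 0 \<and> ptr c e y = 0 \<longrightarrow> x = y"
      by (rule filter_leD[OF at_le dl(2)]) simp
    moreover have "\<forall>\<^sub>F e in at t within {e2..}. e \<ge> e2" by (auto simp: eventually_at_filter)
    ultimately have "\<forall>\<^sub>F e in at t within {e2..}. V1 e = V2 e"
    proof eventually_elim
      case (elim e)
      have "ptr c e (V1 e) = 0" "ptr c e (V2 e) = 0" using B1(2)[of e] B2(2)[of e] elim(4) e12 by auto
      moreover have "\<bar>V1 e - V1 t\<bar> \<le> dl" "\<bar>V2 e - V1 t\<bar> \<le> dl" using elim(1,2) by auto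
      ultimately show ?case using elim(3) by blast
    qed
    then obtain r where r: "r > 0" "\<And>e. e \<ge> e2 \<Longrightarrow> e \<noteq> t \<Longrightarrow> dist e t < r \<Longrightarrow> V1 e = V2 e"
      by (auto simp: eventually_at)
    have "t - r < Sup T" using r(1) by (simp add: t_def)
    then obtain x where x: "x \<in> T" "t - r < x" using less_cSup_iff[of T "t - r"] ne bdd by auto
    have "x \<le> t" unfolding t_def by (rule cSup_upper[OF x(1) bdd])
    hence "dist x t < r" using x by (auto simp: dist_real_def)
    thus False using x(1) r(2)[of x] eqt by (auto simp: T_def)
  qed
  hence "V1 e2 = V2 e2" by (auto simp: T_def)
  moreover have "- exp (- e2) = b2" using b by (simp add: e2_def)
  ultimately show ?thesis using B1(2)[of e2] B2(2)[of e2] e12 by simp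
qed

text \<open>If there were two values, the branch reaching the smaller one would be simple at the
  larger one, where the other branch, which coincides with it, is double.\<close>

lemma coalesce_unique:
  assumes "coalesce_at (Suc n) j b1" "coalesce_at (Suc n) j b2" and n: "(-1)^n = s" and cc: "c (Suc n) = - c n"
  shows "b1 = b2"
proof -
  have False if c1: "coalesce_at (Suc n) j b1" and c2: "coalesce_at (Suc n) j b2" and lt: "b1 < b2" for b1 b2
  proof -
    obtain f1 where f1: "-1 < b1" "zero_branch (Suc n) b1 f1" using c1 by (auto simp: coalesce_at_def)
    obtain f2 where f2: "b2 < 0" "zero_branch (Suc n) b2 f2" "zorder (theta (of_real b2)) (of_real (f2 b2)) = 2"
      using c2 by (auto simp: coalesce_at_def)
    have "f1 b2 = f2 b2" by (rule branch_unique[OF f1(2) f2(2) f1(1) lt f2(1) n cc])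
    moreover have "zorder (theta (of_real b2)) (of_real (f1 b2)) = 1"
      using f1(2) lt f2(1) by (auto simp: zero_branch_def)
    ultimately show False using f2(3) by simp
  qed
  thus ?thesis using assms(1,2) by (metis linorder_neqE_linordered_idom)
qed

lemma zero_branchI:
  assumes b: "b > 0" and V: "continuous_on {b..} V" "\<And>e. e \<ge> b \<Longrightarrow> ptr c e (V e) = 0"
      "\<And>e. e > b \<Longrightarrow> zorder (pt c (of_real e)) (of_real (V e)) = 1"
    and cell: "\<forall>\<^sub>F e in at_top. real n * e \<le> V e \<and> V e \<le> (real n + 1) * e"
    and n: "(-1)^n = s" and cc: "c (Suc n) = - c n"
  shows "zero_branch (Suc n) (- exp (- b)) (\<lambda>q. coord (- ln (- q)) (V (- ln (- q))))"
proof -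
  have e_in: "- ln (- q) \<ge> b" if "q \<in> {- exp (- b)..<0}" for q
  proof -
    have "ln (- q) \<le> ln (exp (- b))" using that by (subst ln_le_cancel_iff) auto
    thus ?thesis by simp
  qed
  have qe: "- exp (- (- ln (- q))) = q" if "q < 0" for q :: real using that by simp
  have "continuous_on {- exp (- b)..<0} (\<lambda>q. coord (- ln (- q)) (V (- ln (- q))))"
    unfolding coord_def by (intro continuous_intros continuous_on_compose2[OF V(1)]) (use e_in in auto)
  moreover have "theta (of_real q) (of_real (coord (- ln (- q)) (V (- ln (- q))))) = 0" if q: "q \<in> {- exp (- b)..<0}" for q
  proof -
    have "theta (of_real (- exp (- (- ln (- q))))) (of_real (coord (- ln (- q)) (V (- ln (- q))))) = 0"
      using theta_neg_zero_iff[of "- ln (- q)" "V (- ln (- q))"] V(2)[OF e_in[OF q]] e_in[OF q] b by auto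
    moreover have "q < 0" using q by simp
    ultimately show ?thesis by (simp only: qe)
  qed
  moreover have "zorder (theta (of_real q)) (of_real (coord (- ln (- q)) (V (- ln (- q))))) = 1" if q: "q \<in> {- exp (- b)<..<0}" for q
  proof -
    have "ln (- q) < ln (exp (- b))" using q by (subst ln_less_cancel_iff) auto
    hence e: "- ln (- q) > b" by simp
    have "zorder (theta (of_real (- exp (- (- ln (- q)))))) (of_real (coord (- ln (- q)) (V (- ln (- q))))) = 1"
      using zorder_neg[of "- ln (- q)" "V (- ln (- q))"] V(3)[OF e] e b by auto
    moreover have "q < 0" using q by simp
    ultimately show ?thesis by (simp only: qe)
  qed
  moreover have "(\<lambda>q. coord (- ln (- q)) (V (- ln (- q)))) \<sim>[at_left 0] (\<lambda>q. - (q powi (- int (Suc n))))"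
  proof (rule asymp_equivI')
    have "\<forall>\<^sub>F e in at_top. ptr c e (V e) = 0 \<and> real n * e \<le> V e \<and> V e \<le> (real n + 1) * e"
      using cell eventually_ge_at_top[of b] by eventually_elim (use V(2) in auto)
    from cell_ratio_tendsto[OF cc this]
    have "((\<lambda>e. exp (V e - (real n + 1/2) * e)) \<longlongrightarrow> 1) at_top" .
    from filterlim_compose[OF this filterlim_neg_ln]
    have "((\<lambda>q. exp (V (- ln (- q)) - (real n + 1/2) * (- ln (- q)))) \<longlongrightarrow> 1) (at_left 0)" .
    moreover have "\<forall>\<^sub>F q in at_left (0::real). exp (V (- ln (- q)) - (real n + 1/2) * (- ln (- q))) =
        coord (- ln (- q)) (V (- ln (- q))) / - (q powi (- int (Suc n)))"
    proof -
      have "\<forall>\<^sub>F q in at_left (0::real). q < 0" by (auto simp: eventually_at_filter)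
      thus ?thesis
      proof eventually_elim
        case (elim q)
        define e where "e = - ln (- q)"
        have q: "q = - exp (- e)" using elim by (simp add: e_def)
        have "exp (V e - (real n + 1/2) * e) = exp (V e + e/2) / exp (real (Suc n) * e)"
          unfolding exp_diff[symmetric] by (rule arg_cong[of _ _ exp]) (simp add: algebra_simps)
        also have "\<dots> = coord e (V e) / (s * exp (real (Suc n) * e))" using s by (auto simp: coord_def)
        also have "s * exp (real (Suc n) * e) = - (q powi (- int (Suc n)))" unfolding q by (rule minus_powi_neg_eq[OF n, symmetric])
        finally show ?case by (simp only: e_def)
      qed
    qed
    ultimately show "((\<lambda>q. coord (- ln (- q)) (V (- ln (- q))) / - (q powi (- int (Suc n)))) \<longlongrightarrow> 1) (at_left 0)"
      by (simp add: tendsto_cong)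
  qed
  ultimately show ?thesis unfolding zero_branch_def by blast
qed

text \<open>The smaller and the larger zero of a far window are continuous down to the collision,
  and for large \<open>e\<close> they occupy the cells \<open>n1 i\<close> and \<open>n2 i\<close>,
  which gives them their labels.\<close>

lemma coalesce_exists:
  assumes h: "h > 0"
  shows "\<exists>S. \<forall>i\<ge>S. \<exists>b. 0 < b \<and> b < h \<and> coalesce_at (Suc (n1 i)) (Suc (n2 i)) (- exp (- b))"
proof -
  obtain S where S: "\<And>i. i \<ge> S \<Longrightarrow> \<exists>b v. 0 < b \<and> b < h \<and> zero_window.zeros c (lw i) (lw (Suc i)) b = {v} \<and>
     zorder (pt c (of_real b)) (of_real v) = 2 \<and>
     (\<forall>e>b. card (zero_window.zeros c (lw i) (lw (Suc i)) e) = 2 \<and> zcount e {lw i e..lw (Suc i) e} = 2)"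
    using spectral_window[OF h] by blast
  have "\<exists>b. 0 < b \<and> b < h \<and> coalesce_at (Suc (n1 i)) (Suc (n2 i)) (- exp (- b))" if i: "i \<ge> S" for i
  proof -
    interpret W: zero_window c "lw i" "lw (Suc i)" by (rule window)
    obtain b v where bv: "0 < b" "b < h" "W.zeros b = {v}" "zorder (pt c (of_real b)) (of_real v) = 2"
      "\<forall>e>b. card (W.zeros e) = 2 \<and> zcount e {lw i e..lw (Suc i) e} = 2" using S[OF i] by blast
    define V1 where "V1 e = Min (W.zeros e)" for e
    define V2 where "V2 e = Max (W.zeros e)" for e
    have ne: "W.zeros e \<noteq> {}" if "e \<ge> b" for e
    proof (cases "e = b")
      case False
      hence "card (W.zeros e) = 2" using bv(5) that by simp
      thus ?thesis by auto
    qed (simp add: bv(3))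
    have mem: "V1 e \<in> W.zeros e" "V2 e \<in> W.zeros e" if "e \<ge> b" for e
      unfolding V1_def V2_def using ne[OF that] W.finite_zeros[of e] that bv(1) by auto
    have cont: "continuous_on {b..} V1" "continuous_on {b..} V2"
      unfolding V1_def V2_def by (rule W.branches_continuous[OF bv(1,3,5)])+
    have zero: "ptr c e (V1 e) = 0" "ptr c e (V2 e) = 0" if "e \<ge> b" for e
      using mem[OF that] unfolding W.zeros_def by auto
    have simple: "zorder (pt c (of_real e)) (of_real (V1 e)) = 1" "zorder (pt c (of_real e)) (of_real (V2 e)) = 1" if e: "e > b" for e
      by (rule W.zeros_simple; use bv(1,5) e mem[of e] in simp)+
    have cells: "\<forall>\<^sub>F e in at_top. (real (n1 i) * e \<le> V1 e \<and> V1 e \<le> (real (n1 i) + 1) * e) \<and> (real (n2 i) * e \<le> V2 e \<and> V2 e \<le> (real (n2 i) + 1) * e)"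
      using eventually_ge_at_top[of 10]
    proof eventually_elim
      case (elim e)
      obtain v1 v2 where v: "W.zeros e = {v1, v2}" "real (n1 i) * e < v1" "v1 < (real (n1 i) + 1) * e"
        "real (n2 i) * e < v2" "v2 < (real (n2 i) + 1) * e" "v1 < v2"
        by (rule window_initial[OF elim, of i])
      have "V1 e = v1" "V2 e = v2" unfolding V1_def V2_def v(1) using v(6) by auto
      thus ?case using v by simp
    qed
    let ?f = "\<lambda>V q. coord (- ln (- q)) (V (- ln (- q)))"
    have br1: "zero_branch (Suc (n1 i)) (- exp (- b)) (?f V1)"
      by (rule zero_branchI[OF bv(1) cont(1)]) (use zero simple cells par1 cd1 in \<open>auto elim: eventually_mono\<close>)
    have br2: "zero_branch (Suc (n2 i)) (- exp (- b)) (?f V2)"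
      by (rule zero_branchI[OF bv(1) cont(2)]) (use zero simple cells par2 cd2 in \<open>auto elim: eventually_mono\<close>)
    have "V1 b = v" "V2 b = v" using mem[of b] bv(3) by auto
    hence eq: "?f V1 (- exp (- b)) = ?f V2 (- exp (- b))" "?f V1 (- exp (- b)) = coord b v" by simp_all
    have "zorder (theta (of_real (- exp (- b)))) (of_real (?f V1 (- exp (- b)))) = 2"
      unfolding eq(2) using zorder_neg[OF bv(1), of v] bv(4) by simp
    hence "coalesce_at (Suc (n1 i)) (Suc (n2 i)) (- exp (- b))"
      unfolding coalesce_at_def using bv(1) br1 br2 eq(1)
      by (intro conjI exI[of _ "?f V1"] exI[of _ "?f V2"]) simp_all
    thus ?thesis using bv by blast
  qed
  thus ?thesis by blast
qed

text \<open>Uniqueness is what turns the description by \<open>THE\<close> into the value found.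
  Only far windows are treated, which is enough for density.\<close>

lemma coalesce_THE:
  assumes h: "h > 0"
  shows "\<exists>S. \<forall>i\<ge>S. \<exists>b. 0 < b \<and> b < h \<and> (THE b. coalesce_at (Suc (n1 i)) (Suc (n2 i)) b) = - exp (- b)"
proof -
  obtain S where S: "\<And>i. i \<ge> S \<Longrightarrow> \<exists>b. 0 < b \<and> b < h \<and> coalesce_at (Suc (n1 i)) (Suc (n2 i)) (- exp (- b))"
    using coalesce_exists[OF h] by blast
  have "\<exists>b. 0 < b \<and> b < h \<and> (THE b. coalesce_at (Suc (n1 i)) (Suc (n2 i)) b) = - exp (- b)" if i: "i \<ge> S" for i
  proof -
    obtain b where b: "0 < b" "b < h" "coalesce_at (Suc (n1 i)) (Suc (n2 i)) (- exp (- b))" using S[OF i] by blast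
    have "(THE b. coalesce_at (Suc (n1 i)) (Suc (n2 i)) b) = - exp (- b)"
      by (rule the_equality[where P = "coalesce_at (Suc (n1 i)) (Suc (n2 i))", OF b(3)])
         (rule coalesce_unique[OF _ b(3) par1 cd1])
    thus ?thesis using b by blast
  qed
  thus ?thesis by blast
qed

end

section \<open>Assembly of the three cases\<close>

interpretation A': theta_pattern' 1 "-1" 1 0 pi 1 0 psi "\<lambda>i. 2 * i" "\<lambda>i. 2 * i + 1"
  by (intro theta_pattern'.intro sign_pattern.intro) (use A.theta_pattern_axioms in \<open>simp_all add: pat_alt\<close>)

interpretation B': neg_pattern "-1" 2 "1/2" "pi/2" 1 0 "Psi2 1" "\<lambda>i. 4 * i + 1" "\<lambda>i. 4 * i + 3"
  by (intro neg_pattern.intro theta_pattern'.intro sign_pattern.intro neg_pattern_axioms.intro B.theta_pattern_axioms) simp_all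

interpretation C': neg_pattern 1 2 "-1/2" "pi/2" "-1" 1 "Psi2 (-1)" "\<lambda>i. 4 * i + 2" "\<lambda>i. 4 * i + 4"
  by (intro neg_pattern.intro theta_pattern'.intro sign_pattern.intro neg_pattern_axioms.intro C.theta_pattern_axioms) simp_all

lemma filterlim_log_left: "filterlim (\<lambda>q. - ln (1 * q)) (at_right 0) (at_left (1::real))"
proof -
  have "((\<lambda>q. - ln (1 * q)) \<longlongrightarrow> - ln (1 * 1)) (at_left (1::real))" by (intro tendsto_intros) auto
  moreover have "\<forall>\<^sub>F q in at_left (1::real). 0 < q \<and> q < 1"
    by (auto simp: eventually_at_left_field intro!: exI[of _ 0])
  hence "\<forall>\<^sub>F q in at_left (1::real). - ln (1 * q) \<in> {0<..} - {0}" by eventually_elim simp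
  ultimately show ?thesis by (auto simp: filterlim_at elim: eventually_mono)
qed

lemma filterlim_log_right: "filterlim (\<lambda>q. - ln (-1 * q)) (at_right 0) (at_right (-1::real))"
proof -
  have "((\<lambda>q. - ln (-1 * q)) \<longlongrightarrow> - ln (-1 * -1)) (at_right (-1::real))" by (intro tendsto_intros) auto
  moreover have "\<forall>\<^sub>F q in at_right (-1::real). -1 < q \<and> q < 0"
    by (auto simp: eventually_at_right_field intro!: exI[of _ 0])
  hence "\<forall>\<^sub>F q in at_right (-1::real). - ln (-1 * q) \<in> {0<..} - {0}" by eventually_elim simp
  ultimately show ?thesis by (auto simp: filterlim_at elim: eventually_mono)
qed

lemma ev_left_pos: "\<forall>\<^sub>F q in at_left (1::real). 1 * q > 0"
  by (auto simp: eventually_at_left_field intro!: exI[of _ 0])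

lemma ev_right_neg: "\<forall>\<^sub>F q in at_right (-1::real). -1 * q > 0"
  by (auto simp: eventually_at_right_field intro!: exI[of _ 0])

lemma smallo_inverse:
  fixes f g :: "real \<Rightarrow> real"
  assumes "((\<lambda>x. f x * g x) \<longlongrightarrow> 0) F" "\<forall>\<^sub>F x in F. g x \<noteq> 0"
  shows "f \<in> o[F](\<lambda>x. 1 / g x)"
proof (rule smalloI_tendsto)
  show "((\<lambda>x. f x / (1 / g x)) \<longlongrightarrow> 0) F" using assms(1) by simp
  show "\<forall>\<^sub>F x in F. 1 / g x \<noteq> 0" using assms(2) by eventually_elim simp
qed

lemma (in theta_pattern') near_limit:
  assumes F: "filterlim (\<lambda>q. - ln (k * q)) (at_right 0) F" "\<forall>\<^sub>F q in F. k * q > 0"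
  shows "(\<lambda>q. real (zero_count {x. 0 < s * x \<and> s * x \<le> exp al} q)) \<in> o[F](\<lambda>q. 1 / (1 - k * q))"
proof (rule smallo_inverse)
  show "((\<lambda>q. real (zero_count {x. 0 < s * x \<and> s * x \<le> exp al} q) * (1 - k * q)) \<longlongrightarrow> 0) F"
    by (rule count_transfer[OF zcount_small zero_count_near F])
  have "\<forall>\<^sub>F q in F. - ln (k * q) \<noteq> 0" using F(1) by (auto simp: filterlim_at elim: eventually_mono)
  thus "\<forall>\<^sub>F q in F. 1 - k * q \<noteq> 0" by eventually_elim auto
qed

lemma (in theta_pattern') far_limit:
  assumes F: "filterlim (\<lambda>q. - ln (k * q)) (at_right 0) F" "\<forall>\<^sub>F q in F. k * q > 0" and a: "a \<ge> exp al"
  shows "((\<lambda>q. real (zero_count {x. exp al \<le> s * x \<and> s * x \<le> a} q) * (1 - k * q)) \<longlongrightarrow> ln (a / exp al) / real d) F"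
proof -
  have a0: "a > 0" using a exp_gt_zero[of al] by linarith
  have "ln (a / exp al) = ln a - al" using a0 by (simp add: ln_div)
  moreover have "ln a \<ge> al" using a a0 by (simp add: ln_ge_iff)
  ultimately show ?thesis
    using count_transfer[OF zcount_limit zero_count_far[OF _ a0] F] by simp
qed

lemma positive_spectral_small:
  assumes h: "h > 0"
  shows "\<exists>e. 0 < e \<and> e < h \<and> exp (- e) \<in> positive_spectral"
proof -
  obtain b v where bv: "0 < b" "b < h" "zorder (pt (pat 1 (-1)) (of_real b)) (of_real v) = 2"
    using A'.spectral_window[OF h] by blast
  have "zorder (theta (of_real (1 * exp (- b)))) (of_real (A'.coord b v)) = 2"
    using A'.zorder_theta[OF bv(1), of v] bv(3) by simp
  moreover have "ptr (pat 1 (-1)) b v = 0"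
    using A'.zorder_pt(2)[OF bv(1), of "of_real v"] bv(3) A'.pt_of_real[OF bv(1), of v] by simp
  hence "theta (of_real (1 * exp (- b))) (of_real (A'.coord b v)) = 0" using A'.theta_zero_iff[OF bv(1)] by blast
  ultimately have "spectral (of_real (exp (- b)))"
    unfolding spectral_def using bv(1) by (intro conjI exI[of _ "of_real (A'.coord b v)"]) simp_all
  thus ?thesis using bv by (auto simp: positive_spectral_def)
qed

text \<open>\<open>M\<close> is the indexing by \<open>2 m - 1\<close> or by \<open>2 m\<close>, so
  that one statement serves both families of spectral numbers.\<close>

lemma (in neg_pattern) dense_neg:
  assumes K: "\<And>i. \<exists>m\<ge>1. q (M m) = (THE b. coalesce_at (Suc (n1 i)) (Suc (n2 i)) b)"
  shows "everywhere_dense_in {z. \<exists>m::nat. m \<ge> 1 \<and> theta (of_real (q (M m))) z = 0} {x. exp al \<le> s * x}"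
proof (rule dense)
  fix h :: real assume "h > 0"
  then obtain i b where b: "0 < b" "b < h" "(THE b. coalesce_at (Suc (n1 i)) (Suc (n2 i)) b) = - exp (- b)"
    using coalesce_THE by blast
  moreover obtain m where "m \<ge> 1" "q (M m) = (THE b. coalesce_at (Suc (n1 i)) (Suc (n2 i)) b)" using K by blast
  ultimately have m: "m \<ge> 1" "q (M m) = - 1 * exp (- b)" by simp_all
  show "\<exists>e. 0 < e \<and> e < h \<and> (\<forall>z. theta (of_real (- 1 * exp (- e))) z = 0 \<longrightarrow> z \<in> {z. \<exists>m::nat. m \<ge> 1 \<and> theta (of_real (q (M m))) z = 0})"
    using b(1,2) m by (intro exI[of _ b] conjI allI impI CollectI exI[of _ m]) simp_all
qed

theorem theorem6:
  shows "
    (\<lambda>q. real (zero_count {- exp pi..<0} q)) \<in> o[at_left 1](\<lambda>q::real. 1 / (1 - q)) \<and>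
    everywhere_dense_in
           {z. \<exists>q\<in>positive_spectral. theta (of_real q) z = 0} {..- exp pi} \<and>
    (\<forall>a::real. a \<ge> exp pi \<longrightarrow>
           ((\<lambda>q. real (l_count a q) * (1 - q)) \<longlongrightarrow> ln (a / exp pi)) (at_left 1)) \<and>
    (\<lambda>q. real (zero_count {- exp (pi / 2)..<0} q))
           \<in> o[at_right (- 1)](\<lambda>q::real. 1 / (1 + q)) \<and>
    everywhere_dense_in
           {z. \<exists>s::nat. s \<ge> 1 \<and> theta (of_real (qbar (2 * s - 1))) z = 0} {..- exp (pi / 2)} \<and>
    (\<forall>a::real. a \<ge> exp (pi / 2) \<longrightarrow>
           ((\<lambda>q. real (n_count a q) * (1 + q)) \<longlongrightarrow> ln (a / exp (pi / 2)) / 2) (at_right (- 1))) \<and>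
    (\<lambda>q. real (zero_count {0<..exp (pi / 2)} q))
           \<in> o[at_right (- 1)](\<lambda>q::real. 1 / (1 + q)) \<and>
    everywhere_dense_in
           {z. \<exists>s::nat. s \<ge> 1 \<and> theta (of_real (qbar (2 * s))) z = 0} {exp (pi / 2)..} \<and>
    (\<forall>a::real. a \<ge> exp (pi / 2) \<longrightarrow>
           ((\<lambda>q. real (p_count a q) * (1 + q)) \<longlongrightarrow> ln (a / exp (pi / 2)) / 2) (at_right (- 1)))"
proof -
  note FL = filterlim_log_left ev_left_pos and FR = filterlim_log_right ev_right_neg
  have near: "{- exp A..<0} = {x. 0 < - 1 * x \<and> - 1 * x \<le> exp A}" for A :: real by auto
  have near': "{0<..exp A} = {x. 0 < 1 * x \<and> 1 * x \<le> exp A}" for A :: real by auto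
  have far: "{- a..- exp A} = {x. exp A \<le> - 1 * x \<and> - 1 * x \<le> a}" for a A :: real by auto
  have far': "{exp A..a} = {x. exp A \<le> 1 * x \<and> 1 * x \<le> a}" for a A :: real by auto
  have half: "{..- exp A} = {x. exp A \<le> - 1 * x}" for A :: real by auto
  have half': "{exp A..} = {x. exp A \<le> 1 * x}" for A :: real by auto
  have m: "1 - 1 * q = 1 - q" "1 - -1 * q = 1 + q" for q :: real by simp_all
  have 1: "(\<lambda>q. real (zero_count {- exp pi..<0} q)) \<in> o[at_left 1](\<lambda>q::real. 1 / (1 - q))"
    unfolding near using A'.near_limit[OF FL] by (simp only: m)
  have 2: "everywhere_dense_in {z. \<exists>q\<in>positive_spectral. theta (of_real q) z = 0} {..- exp pi}"
    unfolding half
  proof (rule A'.dense)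
    fix h :: real assume "h > 0"
    then obtain e where "0 < e" "e < h" "1 * exp (- e) \<in> positive_spectral" using positive_spectral_small by auto
    thus "\<exists>e. 0 < e \<and> e < h \<and> (\<forall>z. theta (of_real (1 * exp (- e))) z = 0 \<longrightarrow> z \<in> {z. \<exists>q\<in>positive_spectral. theta (of_real q) z = 0})"
      by blast
  qed
  have 3: "((\<lambda>q. real (l_count a q) * (1 - q)) \<longlongrightarrow> ln (a / exp pi)) (at_left 1)" if "a \<ge> exp pi" for a
    unfolding l_count_def far using A'.far_limit[OF FL that] by (simp only: m of_nat_1 div_by_1)
  have 4: "(\<lambda>q. real (zero_count {- exp (pi / 2)..<0} q)) \<in> o[at_right (- 1)](\<lambda>q::real. 1 / (1 + q))"
    unfolding near using B'.near_limit[OF FR] by (simp only: m)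
  have 5: "everywhere_dense_in {z. \<exists>s::nat. s \<ge> 1 \<and> theta (of_real (qbar (2 * s - 1))) z = 0} {..- exp (pi / 2)}"
    unfolding half
  proof (rule B'.dense_neg)
    fix i :: nat
    \<comment> \<open>With \<open>m = i + 1\<close> the labels for \<open>qbar (2 * m - 1)\<close>
      are \<open>4 i + 2\<close> and \<open>4 i + 4\<close>, the successors of the two cells of
      window \<open>i\<close>.\<close>
    have "2 * (2 * (i + 1) - 1) = Suc (4 * i + 1)" "Suc (4 * i + 1) + 2 = Suc (4 * i + 3)" "odd (2 * (i + 1) - 1)"
      by simp_all
    thus "\<exists>m\<ge>1. qbar (2 * m - 1) = (THE b. coalesce_at (Suc (4 * i + 1)) (Suc (4 * i + 3)) b)"
      unfolding qbar_def by (intro exI[of _ "i + 1"]) (simp only: if_True simp_thms le_add2)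
  qed
  have 6: "((\<lambda>q. real (n_count a q) * (1 + q)) \<longlongrightarrow> ln (a / exp (pi / 2)) / 2) (at_right (- 1))" if "a \<ge> exp (pi / 2)" for a
    unfolding n_count_def far using B'.far_limit[OF FR that] by (simp only: m of_nat_numeral)
  have 7: "(\<lambda>q. real (zero_count {0<..exp (pi / 2)} q)) \<in> o[at_right (- 1)](\<lambda>q::real. 1 / (1 + q))"
    unfolding near' using C'.near_limit[OF FR] by (simp only: m)
  have 8: "everywhere_dense_in {z. \<exists>s::nat. s \<ge> 1 \<and> theta (of_real (qbar (2 * s))) z = 0} {exp (pi / 2)..}"
    unfolding half'
  proof (rule C'.dense_neg)
    fix i :: nat
    \<comment> \<open>Here the labels \<open>4 m - 1\<close> and \<open>4 m + 1\<close> are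
      \<open>4 i + 3\<close> and \<open>4 i + 5\<close>; the label 1 of the unpaired zero does not
      occur.\<close>
    have "2 * (2 * (i + 1)) - 1 = Suc (4 * i + 2)" "2 * (2 * (i + 1)) + 1 = Suc (4 * i + 4)" "\<not> odd (2 * (i + 1))"
      by simp_all
    thus "\<exists>m\<ge>1. qbar (2 * m) = (THE b. coalesce_at (Suc (4 * i + 2)) (Suc (4 * i + 4)) b)"
      unfolding qbar_def by (intro exI[of _ "i + 1"]) (simp only: if_False simp_thms le_add2)
  qed
  have 9: "((\<lambda>q. real (p_count a q) * (1 + q)) \<longlongrightarrow> ln (a / exp (pi / 2)) / 2) (at_right (- 1))" if "a \<ge> exp (pi / 2)" for a
    unfolding p_count_def far' using C'.far_limit[OF FR that] by (simp only: m of_nat_numeral)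
  show ?thesis using 1 2 3 4 5 6 7 8 9 by blast
qed

end
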